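(* Let $\hat x_1,\dots,\hat x_n$ be linearly independent operators in $\mathcal H$ (not necessarily Hermitian) satisfying the Lie algebra commutation relations $$\hat x_i\hat x_k-\hat x_k\hat x_i=C_{ik}^j\hat x_j ,$$ and let $$\varrho(\beta,\bar\beta)=\chi(\beta,\bar\beta)^{-1}\,\mathrm e^{\beta^k\hat x_k^*}\varrho_0\,\mathrm e^{\bar\beta^k\hat x_k},\qquad \chi(\beta,\bar\beta)=\mathrm{Tr}\,\varrho_0\,\mathrm e^{\bar\beta^k\hat x_k}\mathrm e^{\beta^k\hat x_k^*},$$ be the corresponding canonical family of density operators, for $\beta$ in a neighborhood $\mathcal O\subset\mathbb C^n$ of $\beta=0$ in which $\chi$ is finite and the matrix $\mathsf K(\bar\beta)$ (see context) exists. Let $\vartheta_i(\beta,\bar\beta)$, $i=1,\dots,m$, be complex-valued functions on $\mathcal O$ differentiable independently in $\beta$ and $\bar\beta$, let $\mathsf D=[\partial\vartheta_i/\partial\beta^k]$, and let $\mathsf S=[S_{ik}]$ be the covariance matrix of the generators, $$S_{ik}(\beta,\bar\beta)=\mathrm{Tr}\,\varrho(\beta,\bar\beta)(\hat x_i-\mu_i)(\hat x_k-\mu_k)^*,\qquad \mu_k=\mathrm{Tr}\,\hat x_k\varrho(\beta,\bar\beta),$$ assumed nondegenerate. Then for every quantum probability measure $\Pi(\mathrm d\lambda)$ whose complex results $\lambda_i$ are unbiased estimates of $\vartheta_i(\beta,\bar\beta)$ on $\mathcal O$, the covariance matrix $\mathsf R(\beta,\bar\beta)=\big[\int(\lambda_i-\vartheta_i)(\bar\lambda_j-\bar\vartheta_j)\mathrm{Tr}[\Pi(\mathrm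 d\lambda)\varrho(\beta,\bar\beta)]\big]$ satisfies $$\mathsf R(\beta,\bar\beta)\ \ge\ \mathsf D\,\mathsf K(\bar\beta)^\dagger\,\mathsf S^{-1}\,\mathsf K(\bar\beta)\,\mathsf D^\dagger$$ for all $\beta\in\mathcal O$, with $\mathsf D,\mathsf S$ taken at $(\beta,\bar\beta)$.
   Context: Repeated indices are summed. $\mathsf C_k=[C_{ik}^j]$ is the $n\times n$ matrix with row index $i$ and column index $j$, and $\mathsf K(\bar\beta)=\bar\beta^k\mathsf C_k\big(\mathrm e^{\bar\beta^k\mathsf C_k}-\mathsf I\big)^{-1}$, understood as the inverse of the matrix $\sum_{r\ge0}(\bar\beta^k\mathsf C_k)^r/(r+1)!$; it exists at least in some neighborhood of $\beta=0$. $\partial/\partial\beta^k$, $\partial/\partial\bar\beta^k$ are Wirtinger derivatives. A quantum probability measure (QPM) is a positive-operator-valued measure $\Pi$ on $\mathcal H$ with total mass $\hat1$; the results $\lambda_i$ are unbiased if $\int\lambda_i\,\mathrm{Tr}[\Pi(\mathrm d\lambda)\varrho(\beta,\bar\beta)]=\vartheta_i(\beta,\bar\beta)$ for all $\beta\in\mathcal O$. $A\ge B$ means $A-B$ is Hermitian and nonnegative definite; $\dagger$ is the Hermitian adjoint. Standing regularity assumptions: $\chi$ is smooth where finite with finite first and second moments, the exponentials and all operators, integrals and traces occurring are well defined and finite, the operators $\mathrm e^{-\bar\beta^k\hat x_k}\frac{\partial}{\partial\bar\beta^i}\mathrm e^{\bar\beta^k\hat x_k}$ are given by the usual Lie-algebraic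 series in the $\hat x_j$, and differentiation with respect to the parameters may be interchanged with the trace. *)

theory Defs
  imports "HOL-Analysis.Analysis"
begin

section \<open>Complex Hilbert spaces\<close>

class complex_hilbert = banach +
  fixes scaleC :: "complex \<Rightarrow> 'a \<Rightarrow> 'a" (infixr "*\<^sub>C" 75)
    and cinner :: "'a \<Rightarrow> 'a \<Rightarrow> complex"  (* antilinear in the first argument *)
  assumes scaleC_add_right: "a *\<^sub>C (u + v) = a *\<^sub>C u + a *\<^sub>C v"
    and scaleC_add_left: "(a + b) *\<^sub>C v = a *\<^sub>C v + b *\<^sub>C v"
    and scaleC_scaleC: "a *\<^sub>C (b *\<^sub>C v) = (a * b) *\<^sub>C v"
    and scaleC_one: "1 *\<^sub>C v = v"
    and scaleR_scaleC: "r *\<^sub>R v = complex_of_real r *\<^sub>C v"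
    and cinner_commute: "cinner u v = cnj (cinner v u)"
    and cinner_add_right: "cinner u (v + w) = cinner u v + cinner u w"
    and cinner_scaleC_right: "cinner u (a *\<^sub>C v) = a * cinner u v"
    and norm_eq_sqrt_cinner: "norm v = sqrt (Re (cinner v v))"

section \<open>Bounded operators, trace class, density operators\<close>

definition bounded_clinear :: "('h::complex_hilbert \<Rightarrow> 'h) \<Rightarrow> bool" where
  "bounded_clinear T \<longleftrightarrow> bounded_linear T \<and> (\<forall>c v. T (c *\<^sub>C v) = c *\<^sub>C T v)"

definition positive_op :: "('h::complex_hilbert \<Rightarrow> 'h) \<Rightarrow> bool" where
  "positive_op T \<longleftrightarrow> bounded_clinear T \<and> (\<forall>v. cinner v (T v) \<in> \<real>\<^sub>\<ge>\<^sub>0)"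

text \<open>Orthonormal bases are maximal orthonormal sets; the Hilbert space need not be separable.\<close>

definition is_onb :: "'h::complex_hilbert set \<Rightarrow> bool" where
  "is_onb B \<longleftrightarrow> (\<forall>e\<in>B. norm e = 1) \<and> (\<forall>e\<in>B. \<forall>f\<in>B. e \<noteq> f \<longrightarrow> cinner e f = 0)
     \<and> (\<forall>v. (\<forall>e\<in>B. cinner e v = 0) \<longrightarrow> v = 0)"

text \<open>Trace class operators on a Hilbert space are the nuclear operators
  \<open>T = \<Sum>\<^sub>n |a\<^sub>n\<rangle>\<langle>b\<^sub>n|\<close> with \<open>\<Sum>\<^sub>n \<parallel>a\<^sub>n\<parallel> \<parallel>b\<^sub>n\<parallel> < \<infinity>\<close>; for them the sum defining \<open>tr\<close>
  converges absolutely and does not depend on the basis.\<close>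

definition trace_class :: "('h::complex_hilbert \<Rightarrow> 'h) \<Rightarrow> bool" where
  "trace_class T \<longleftrightarrow> (\<exists>a b :: nat \<Rightarrow> 'h. summable (\<lambda>n. norm (a n) * norm (b n)) \<and>
     (\<forall>v. (\<lambda>n. cinner (b n) v *\<^sub>C a n) sums T v))"

definition tr :: "('h::complex_hilbert \<Rightarrow> 'h) \<Rightarrow> complex" where
  "tr T = infsum (\<lambda>e. cinner e (T e)) (SOME B. is_onb B)"

definition density_op :: "('h::complex_hilbert \<Rightarrow> 'h) \<Rightarrow> bool" where
  "density_op \<rho> \<longleftrightarrow> positive_op \<rho> \<and> trace_class \<rho> \<and> tr \<rho> = 1"

section \<open>Unbounded operators\<close>

text \<open>An unbounded operator is a function together with the domain \<open>S\<close> on which its values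
  matter.  The bounded extension of a densely defined operator is unique if it exists.\<close>

definition csubspace :: "'h::complex_hilbert set \<Rightarrow> bool" where
  "csubspace S \<longleftrightarrow> 0 \<in> S \<and> (\<forall>u\<in>S. \<forall>v\<in>S. u + v \<in> S) \<and> (\<forall>c. \<forall>v\<in>S. c *\<^sub>C v \<in> S)"

definition clinear_on :: "'h::complex_hilbert set \<Rightarrow> ('h \<Rightarrow> 'h) \<Rightarrow> bool" where
  "clinear_on S T \<longleftrightarrow> (\<forall>u\<in>S. \<forall>v\<in>S. T (u + v) = T u + T v) \<and> (\<forall>c. \<forall>v\<in>S. T (c *\<^sub>C v) = c *\<^sub>C T v)"

definition adj_dom :: "'h::complex_hilbert set \<Rightarrow> ('h \<Rightarrow> 'h) \<Rightarrow> 'h set" where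
  "adj_dom S T = {v. \<exists>w. \<forall>u\<in>S. cinner (T u) v = cinner u w}"

definition adj :: "'h::complex_hilbert set \<Rightarrow> ('h \<Rightarrow> 'h) \<Rightarrow> 'h \<Rightarrow> 'h" where
  "adj S T v = (THE w. \<forall>u\<in>S. cinner (T u) v = cinner u w)"

definition bounded_ext :: "'h::complex_hilbert set \<Rightarrow> ('h \<Rightarrow> 'h) \<Rightarrow> 'h \<Rightarrow> 'h" where
  "bounded_ext S T = (THE B. bounded_clinear B \<and> (\<forall>v\<in>S. B v = T v))"

definition has_trace_class_ext :: "'h::complex_hilbert set \<Rightarrow> ('h \<Rightarrow> 'h) \<Rightarrow> bool" where
  "has_trace_class_ext S T \<longleftrightarrow> (\<exists>B. trace_class B \<and> (\<forall>v\<in>S. B v = T v))"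

text \<open>\<open>Tr \<tau> A B\<close> for a trace class \<open>\<tau>\<close> and unbounded \<open>A\<close>, \<open>B\<close>, where \<open>S\<close> is the domain of \<open>A\<close>.
  As usual for unbounded factors it is read, by cyclicity, as the trace of the trace class
  operator that extends \<open>B \<tau> A\<close>; for bounded \<open>A\<close>, \<open>B\<close> and \<open>S = UNIV\<close> this is the trace of
  \<open>\<tau> A B\<close>.\<close>

definition tr_prod :: "'h::complex_hilbert set \<Rightarrow> ('h \<Rightarrow> 'h) \<Rightarrow> ('h \<Rightarrow> 'h) \<Rightarrow> ('h \<Rightarrow> 'h) \<Rightarrow> complex" where
  "tr_prod S \<tau> A B = tr (bounded_ext S (\<lambda>v. B (\<tau> (A v))))"

text \<open>The exponential is the strongly convergent power series; here \<open>S\<close> is invariant under \<open>T\<close>.\<close>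

definition exp_dom :: "'h::complex_hilbert set \<Rightarrow> ('h \<Rightarrow> 'h) \<Rightarrow> 'h set" where
  "exp_dom S T = {v\<in>S. summable (\<lambda>r. (1 / fact r) *\<^sub>R (T ^^ r) v)}"

definition op_exp :: "('h::complex_hilbert \<Rightarrow> 'h) \<Rightarrow> 'h \<Rightarrow> 'h" where
  "op_exp T v = (\<Sum>r. (1 / fact r) *\<^sub>R (T ^^ r) v)"

text \<open>\<open>e\<^sup>-\<^sup>X (\<partial>\<^sub>i e\<^sup>X) = \<Sum>\<^sub>r (-1)\<^sup>r / (r+1)! ad\<^sub>X\<^sup>r (\<partial>\<^sub>i X)\<close>, the series being applied to \<open>Y = \<partial>\<^sub>i X\<close>.\<close>

definition commutator :: "('h::complex_hilbert \<Rightarrow> 'h) \<Rightarrow> ('h \<Rightarrow> 'h) \<Rightarrow> 'h \<Rightarrow> 'h" where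
  "commutator X Y v = X (Y v) - Y (X v)"

definition lie_series :: "('h::complex_hilbert \<Rightarrow> 'h) \<Rightarrow> ('h \<Rightarrow> 'h) \<Rightarrow> 'h \<Rightarrow> 'h" where
  "lie_series X Y v = (\<Sum>r. ((-1) ^ r / fact (r + 1)) *\<^sub>R (commutator X ^^ r) Y v)"

section \<open>The canonical family\<close>

definition vcnj :: "complex^'n \<Rightarrow> complex^'n" where
  "vcnj \<beta> = (\<chi> k. cnj (\<beta> $ k))"

definition lincomb :: "complex^'n \<Rightarrow> ('n \<Rightarrow> 'h \<Rightarrow> 'h) \<Rightarrow> 'h::complex_hilbert \<Rightarrow> 'h" where
  "lincomb c A v = (\<Sum>k\<in>UNIV. (c $ k) *\<^sub>C A k v)"

text \<open>In the following, \<open>S\<close> is the common invariant domain of the generators.  First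
  \<open>e\<close> to the power \<open>\<beta>\<^sup>k x\<^sub>k\<^sup>*\<close> and \<open>e\<close> to the power \<open>\<beta>\<^sup>k x\<^sub>k\<close> with conjugated \<open>\<beta>\<close>.\<close>

abbreviation exp_adj :: "'h::complex_hilbert set \<Rightarrow> ('n::finite \<Rightarrow> 'h \<Rightarrow> 'h) \<Rightarrow> complex^'n \<Rightarrow> 'h \<Rightarrow> 'h" where
  "exp_adj S x \<beta> \<equiv> op_exp (lincomb \<beta> (\<lambda>k. adj S (x k)))"

abbreviation exp_gen :: "('n::finite \<Rightarrow> 'h::complex_hilbert \<Rightarrow> 'h) \<Rightarrow> complex^'n \<Rightarrow> 'h \<Rightarrow> 'h" where
  "exp_gen x \<beta> \<equiv> op_exp (lincomb (vcnj \<beta>) x)"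

abbreviation exp_gen_dom :: "'h::complex_hilbert set \<Rightarrow> ('n::finite \<Rightarrow> 'h \<Rightarrow> 'h) \<Rightarrow> complex^'n \<Rightarrow> 'h set" where
  "exp_gen_dom S x \<beta> \<equiv> exp_dom S (lincomb (vcnj \<beta>) x)"

definition can_chi :: "'h::complex_hilbert set \<Rightarrow> ('n::finite \<Rightarrow> 'h \<Rightarrow> 'h) \<Rightarrow> ('h \<Rightarrow> 'h) \<Rightarrow> complex^'n \<Rightarrow> complex" where
  "can_chi S x \<rho>\<^sub>0 \<beta> = tr_prod (exp_gen_dom S x \<beta>) \<rho>\<^sub>0 (exp_gen x \<beta>) (exp_adj S x \<beta>)"

definition can_rho :: "'h::complex_hilbert set \<Rightarrow> ('n::finite \<Rightarrow> 'h \<Rightarrow> 'h) \<Rightarrow> ('h \<Rightarrow> 'h) \<Rightarrow> complex^'n \<Rightarrow> 'h \<Rightarrow> 'h" where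
  "can_rho S x \<rho>\<^sub>0 \<beta> v = inverse (can_chi S x \<rho>\<^sub>0 \<beta>) *\<^sub>C
     bounded_ext (exp_gen_dom S x \<beta>) (\<lambda>u. exp_adj S x \<beta> (\<rho>\<^sub>0 (exp_gen x \<beta> u))) v"

definition mean :: "('n \<Rightarrow> 'h::complex_hilbert \<Rightarrow> 'h) \<Rightarrow> ('h \<Rightarrow> 'h) \<Rightarrow> 'n \<Rightarrow> complex" where
  "mean x \<rho> k = tr (\<lambda>v. x k (\<rho> v))"

definition centered :: "('n \<Rightarrow> 'h::complex_hilbert \<Rightarrow> 'h) \<Rightarrow> ('h \<Rightarrow> 'h) \<Rightarrow> 'n \<Rightarrow> 'h \<Rightarrow> 'h" where
  "centered x \<rho> k v = x k v - mean x \<rho> k *\<^sub>C v"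

definition gen_cov :: "'h::complex_hilbert set \<Rightarrow> ('n::finite \<Rightarrow> 'h \<Rightarrow> 'h) \<Rightarrow> ('h \<Rightarrow> 'h) \<Rightarrow> complex^'n^'n" where
  "gen_cov S x \<rho> = (\<chi> i k. tr_prod S \<rho> (centered x \<rho> i) (adj S (centered x \<rho> k)))"

section \<open>Matrices and Wirtinger derivatives\<close>

definition hadj :: "complex^'n^'m \<Rightarrow> complex^'m^'n" where
  "hadj A = (\<chi> i j. cnj (A $ j $ i))"

definition mat_ge :: "complex^'n^'n \<Rightarrow> complex^'n^'n \<Rightarrow> bool" where
  "mat_ge A B \<longleftrightarrow> hadj (A - B) = A - B \<and>
     (\<forall>v::complex^'n. (\<Sum>i\<in>UNIV. \<Sum>j\<in>UNIV. cnj (v $ i) * (A - B) $ i $ j * v $ j) \<in> \<real>\<^sub>\<ge>\<^sub>0)"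

text \<open>The powers are matrix powers; \<open>^\<close> on type \<open>vec\<close> would be componentwise.\<close>

definition matpow :: "complex^'n^'n \<Rightarrow> nat \<Rightarrow> complex^'n^'n" where
  "matpow A r = (((**) A) ^^ r) (mat 1)"

text \<open>\<open>struct_mat C \<gamma> = \<gamma>\<^sup>k C\<^sub>k\<close> where \<open>C\<^sub>k\<close> has the entry \<open>C i k j\<close>, the coefficient of \<open>x\<^sub>j\<close>
  in \<open>[x\<^sub>i, x\<^sub>k]\<close>, in row \<open>i\<close> and column \<open>j\<close>.\<close>

definition struct_mat :: "('n::finite \<Rightarrow> 'n \<Rightarrow> 'n \<Rightarrow> complex) \<Rightarrow> complex^'n \<Rightarrow> complex^'n^'n" where
  "struct_mat C \<gamma> = (\<chi> i j. \<Sum>k\<in>UNIV. \<gamma> $ k * C i k j)"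

definition K_series :: "('n::finite \<Rightarrow> 'n \<Rightarrow> 'n \<Rightarrow> complex) \<Rightarrow> complex^'n \<Rightarrow> complex^'n^'n" where
  "K_series C \<gamma> = (\<Sum>r. (1 / fact (r + 1)) *\<^sub>R matpow (struct_mat C \<gamma>) r)"

definition K_mat :: "('n::finite \<Rightarrow> 'n \<Rightarrow> 'n \<Rightarrow> complex) \<Rightarrow> complex^'n \<Rightarrow> complex^'n^'n" where
  "K_mat C \<gamma> = matrix_inv (K_series C \<gamma>)"

text \<open>\<open>wirtinger k f \<beta> = \<partial>f/\<partial>\<beta>\<^sup>k\<close>.  Functions of \<open>(\<beta>, \<beta>)\<close> with the second \<open>\<beta>\<close> conjugated are
  functions of \<open>\<beta>\<close>; differentiability in both arguments is real differentiability.\<close>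

definition wirtinger :: "'n::finite \<Rightarrow> (complex^'n \<Rightarrow> complex) \<Rightarrow> complex^'n \<Rightarrow> complex" where
  "wirtinger k f \<beta> = (frechet_derivative f (at \<beta>) (axis k 1)
     - \<i> * frechet_derivative f (at \<beta>) (axis k \<i>)) / 2"

section \<open>Quantum probability measures\<close>

definition qpm :: "((complex^'m) set \<Rightarrow> 'h \<Rightarrow> 'h::complex_hilbert) \<Rightarrow> bool" where
  "qpm M \<longleftrightarrow> (\<forall>E\<in>sets borel. positive_op (M E)) \<and> M UNIV = id \<and>
     (\<forall>A. range A \<subseteq> sets borel \<longrightarrow> disjoint_family A \<longrightarrow>
        (\<forall>v. (\<lambda>n::nat. cinner v (M (A n) v)) sums cinner v (M (\<Union>n. A n) v)))"

text \<open>The distribution \<open>Tr[M(d\<lambda>) \<rho>]\<close> of the results in the state \<open>\<rho>\<close>.\<close>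

definition outcome :: "((complex^'m) set \<Rightarrow> 'h \<Rightarrow> 'h::complex_hilbert) \<Rightarrow> ('h \<Rightarrow> 'h) \<Rightarrow> (complex^'m) measure" where
  "outcome M \<rho> = measure_of UNIV (sets borel) (\<lambda>E. ennreal (Re (tr (M E \<circ> \<rho>))))"

text \<open>Integrals with respect to a complex measure \<open>\<tau>\<close>, such as \<open>Tr[M(d\<lambda>) T]\<close> for a \<open>T\<close> that is not
  positive: \<open>\<tau>\<close> is decomposed as \<open>m\<^sub>0 + \<i> m\<^sub>1 - m\<^sub>2 - \<i> m\<^sub>3\<close> with finite positive measures for all of
  which \<open>f\<close> is integrable.\<close>

definition has_cmeasure_integral ::
    "((complex^'m) set \<Rightarrow> complex) \<Rightarrow> (complex^'m \<Rightarrow> complex) \<Rightarrow> complex \<Rightarrow> bool" where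
  "has_cmeasure_integral \<tau> f I \<longleftrightarrow> (\<exists>m :: nat \<Rightarrow> (complex^'m) measure.
     (\<forall>k<4. finite_measure (m k) \<and> sets (m k) = sets borel \<and> integrable (m k) f) \<and>
     (\<forall>E\<in>sets borel. \<tau> E = (\<Sum>k<4. \<i> ^ k * complex_of_real (measure (m k) E))) \<and>
     I = (\<Sum>k<4. \<i> ^ k * (LINT l|m k. f l)))"

definition result_cov :: "((complex^'m) set \<Rightarrow> 'h \<Rightarrow> 'h::complex_hilbert) \<Rightarrow> ('h \<Rightarrow> 'h) \<Rightarrow> ('m \<Rightarrow> complex) \<Rightarrow> complex^'m^'m" where
  "result_cov M \<rho> t = (\<chi> i j. LINT l|outcome M \<rho>. (l $ i - t i) * (cnj (l $ j) - cnj (t j)))"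

end

theory Submission
  imports Defs
begin

text \<open>The Lie series makes every \<open>\<partial>\<rho>/\<partial>\<beta>\<^sup>k\<close> a linear combination of the operators \<open>x\<^sub>l\<^sup>* \<rho>\<close>, with
  coefficients the conjugated entries of \<open>K\<^sup>-\<^sup>1\<close>, up to a multiple of \<open>\<rho>\<close>.  That multiple is irrelevant
  because the deviations \<open>\<lambda>\<^sub>i - \<theta>\<^sub>i\<close> of unbiased results have mean \<open>0\<close>.  Hence, for \<open>y\<close> a combination
  of the centered generators, differentiating the unbiasedness condition expresses
  \<open>\<integral> g(\<lambda>) Tr M(d\<lambda>) y\<^sup>* \<rho>\<close> for \<open>g = \<Sum>\<^sub>i v\<^sub>i\<^sup>* (\<lambda>\<^sub>i - \<theta>\<^sub>i)\<close> by the derivatives \<open>D\<close>.  For a result \<open>g\<close>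
  with finitely many values, the positivity of \<open>Tr M\<^sub>w (y\<^sup>* - z\<^sub>w) \<rho> (y - z\<^sub>w\<^sup>*)\<close> bounds this integral by
  \<open>Tr y\<^sup>* \<rho> y\<close>, a value of the quadratic form of \<open>S\<close>, and \<open>\<integral> |g|\<^sup>2\<close>, a value of that of \<open>R\<close>;
  dominated convergence gives the general case, and optimizing over \<open>y\<close> gives the matrix inequality.\<close>

section \<open>Inner product and orthonormal bases\<close>

text \<open>Apart from the scalar \<chi>, only the left factor of \<rho> depends on \<beta> rather
  than on its conjugate. The Wirtinger derivative falls on that factor alone and brings out adjoint
  generators with conjugated coefficients. Two obstacles shape the rest. The generators are
  unbounded and y^* \<rho> y is given only through a trace class extension, so positivity is checked
  as a quadratic form on a dense domain and carried over by continuity. Moreover, the decomposition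
  behind \<open>has_cmeasure_integral\<close> is unrelated to the distribution
  \<open>outcome\<close>, so the two integrals cannot be compared directly; with finitely many
  results only numbers such as Tr M_w d\<rho> and Tr M_w \<rho> occur, and these can be. The
  additive form of the Cauchy-Schwarz inequality, 2 Re (mixed term) \<le> sum of the two squares, is
  kept up to the end because it passes to limits; the optimal coefficients b then solve the linear
  equation S b = K (hadj D) v.\<close>

lemma cinner_add_left: "cinner (u + v) w = cinner u w + cinner v (w::'h::complex_hilbert)"
  by (metis cinner_add_right cinner_commute complex_cnj_add)

lemma cinner_scaleC_left: "cinner (a *\<^sub>C u) w = cnj a * cinner u (w::'h::complex_hilbert)"
  by (metis cinner_commute cinner_scaleC_right complex_cnj_mult)

lemma cmod_cinner_commute: "cmod (cinner u v) = cmod (cinner v (u::'h::complex_hilbert))"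
  by (metis cinner_commute complex_mod_cnj)

lemma cinner_zero_right [simp]: "cinner u (0::'h::complex_hilbert) = 0"
  using cinner_add_right[of u 0 0] by simp

lemma cinner_zero_left [simp]: "cinner (0::'h::complex_hilbert) u = 0"
  using cinner_add_left[of 0 0 u] by simp

lemma cinner_minus_right: "cinner u (- v) = - cinner u (v::'h::complex_hilbert)"
  using cinner_add_right[of u v "- v"] by (simp add: add_eq_0_iff)

lemma cinner_minus_left: "cinner (- u) v = - cinner u (v::'h::complex_hilbert)"
  using cinner_add_left[of u "- u" v] by (simp add: add_eq_0_iff)

lemma cinner_diff_right: "cinner u (v - w) = cinner u v - cinner u (w::'h::complex_hilbert)"
  using cinner_add_right[of u v "- w"] by (simp add: cinner_minus_right)

lemma cinner_diff_left: "cinner (u - v) w = cinner u w - cinner v (w::'h::complex_hilbert)"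
  using cinner_add_left[of u "- v" w] by (simp add: cinner_minus_left)

lemma cinner_scaleR_right: "cinner u (r *\<^sub>R v) = of_real r * cinner u (v::'h::complex_hilbert)"
  by (simp add: scaleR_scaleC cinner_scaleC_right)

lemma cinner_scaleR_left: "cinner (r *\<^sub>R u) v = of_real r * cinner u (v::'h::complex_hilbert)"
  by (simp add: scaleR_scaleC cinner_scaleC_left)

lemma cinner_sum_right: "cinner u (\<Sum>i\<in>I. f i) = (\<Sum>i\<in>I. cinner u (f i::'h::complex_hilbert))"
  by (induction I rule: infinite_finite_induct) (auto simp: cinner_add_right)

lemma cinner_sum_left: "cinner (\<Sum>i\<in>I. f i) u = (\<Sum>i\<in>I. cinner (f i) (u::'h::complex_hilbert))"
  by (induction I rule: infinite_finite_induct) (auto simp: cinner_add_left)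

lemmas cinner_simps = cinner_add_left cinner_add_right cinner_diff_left cinner_diff_right
  cinner_minus_left cinner_minus_right cinner_scaleC_left cinner_scaleC_right
  cinner_scaleR_left cinner_scaleR_right cinner_sum_left cinner_sum_right

lemma complex_mult_cnj_eq:
  "z * cnj z = (of_real (cmod z))\<^sup>2" "cnj z * z = (of_real (cmod z))\<^sup>2"
  using complex_norm_square[of z] by (simp_all add: mult.commute)

lemma cinner_self: "cinner v v = of_real ((norm (v::'h::complex_hilbert))\<^sup>2)"
proof -
  have "0 \<le> sqrt (Re (cinner v v))"
    by (metis norm_eq_sqrt_cinner norm_ge_zero)
  then have "(norm v)\<^sup>2 = Re (cinner v v)"
    by (simp add: norm_eq_sqrt_cinner)
  moreover have "Im (cinner v v) = 0"
    by (metis cinner_commute complex_cnj cancel_comm_monoid_add_class.diff_cancel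
        complex_cnj_cancel_iff cnj.simps(2) neg_equal_zero)
  ultimately show ?thesis
    by (simp add: complex_eq_iff)
qed

lemma cinner_self_eq_0 [simp]: "cinner v v = 0 \<longleftrightarrow> v = (0::'h::complex_hilbert)"
  by (simp add: cinner_self)

lemma scaleC_simps [simp]:
  fixes v :: "'h::complex_hilbert"
  shows "1 *\<^sub>C v = v" "0 *\<^sub>C v = 0" "a *\<^sub>C (0::'h) = 0" "(-1) *\<^sub>C v = - v"
proof -
  show "1 *\<^sub>C v = v" by (rule scaleC_one)
  show z: "0 *\<^sub>C v = 0" using scaleC_add_left[of 0 0 v] by simp
  show "a *\<^sub>C (0::'h) = 0" using scaleC_add_right[of a 0 "0::'h"] by simp
  have "0 = (1 + (-1)) *\<^sub>C v" using z by simp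
  also have "\<dots> = v + (-1) *\<^sub>C v" by (simp only: scaleC_add_left scaleC_one)
  finally show "(-1) *\<^sub>C v = - v" by (metis minus_unique)
qed

lemma scaleC_diff_right: "a *\<^sub>C (u - v) = a *\<^sub>C u - a *\<^sub>C (v::'h::complex_hilbert)"
  using scaleC_add_right[of a "u - v" v] by simp

lemma scaleC_minus_right: "a *\<^sub>C (- v) = - (a *\<^sub>C (v::'h::complex_hilbert))"
  using scaleC_add_right[of a "- v" v] by (simp add: add_eq_0_iff2)

lemma scaleC_minus_left: "(- a) *\<^sub>C v = - (a *\<^sub>C (v::'h::complex_hilbert))"
  using scaleC_add_left[of "- a" a v] by (simp add: add_eq_0_iff2)

lemma scaleC_diff_left: "(a - b) *\<^sub>C v = a *\<^sub>C v - b *\<^sub>C (v::'h::complex_hilbert)"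
  using scaleC_add_left[of "a - b" b v] by simp

lemma scaleC_sum_right: "a *\<^sub>C (\<Sum>i\<in>I. f i) = (\<Sum>i\<in>I. a *\<^sub>C (f i::'h::complex_hilbert))"
  by (induction I rule: infinite_finite_induct) (auto simp: scaleC_add_right)

lemma scaleC_sum_left: "(\<Sum>i\<in>I. f i) *\<^sub>C (v::'h::complex_hilbert) = (\<Sum>i\<in>I. f i *\<^sub>C v)"
  by (induction I rule: infinite_finite_induct) (auto simp: scaleC_add_left)

lemma norm_scaleC: "norm (a *\<^sub>C (v::'h::complex_hilbert)) = cmod a * norm v"
proof -
  have "complex_of_real ((norm (a *\<^sub>C v))\<^sup>2) = of_real ((cmod a * norm v)\<^sup>2)"
    by (simp only: cinner_self[symmetric] cinner_scaleC_left cinner_scaleC_right)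
      (simp add: cinner_self power_mult_distrib complex_mult_cnj_eq mult.assoc[symmetric])
  then show ?thesis
    by (metis norm_ge_zero of_real_eq_iff mult_nonneg_nonneg power2_eq_imp_eq)
qed

text \<open>A discriminant argument with a complex variable. It serves the inner product and also
  the forms of positive operators, where c may vanish at a nonzero vector; hence the separate case c
  = 0.\<close>

lemma cmod_power2_le_of_quadratic:
  fixes a c :: real and z :: complex
  assumes "\<And>t. 0 \<le> a + 2 * Re (t * z) + (cmod t)\<^sup>2 * c" and "0 \<le> c"
  shows "(cmod z)\<^sup>2 \<le> a * c"
proof (cases "c = 0")
  case True
  have "z = 0"
  proof (rule ccontr)
    assume "z \<noteq> 0"
    \<comment> \<open>With c = 0 the bound is affine in t; this t makes 2 Re (t z) equal to -2 (|a|
      + 1) and so pushes it below 0.\<close>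
    define t where "t = - of_real ((\<bar>a\<bar> + 1) / (cmod z)\<^sup>2) * cnj z"
    have "t * z = - of_real ((\<bar>a\<bar> + 1) / (cmod z)\<^sup>2) * (z * cnj z)"
      by (simp add: t_def)
    also have "\<dots> = - of_real (\<bar>a\<bar> + 1)"
      using \<open>z \<noteq> 0\<close> by (simp add: complex_norm_square[symmetric])
    finally show False
      using assms(1)[of t] True by (simp add: abs_if split: if_splits)
  qed
  then show ?thesis by (simp add: True)
next
  case False
  \<comment> \<open>The minimiser of the quadratic.\<close>
  define t where "t = - cnj z / of_real c"
  have "t * z = - of_real ((cmod z)\<^sup>2 / c)"
    by (simp add: t_def complex_mult_cnj_eq)
  moreover have "(cmod t)\<^sup>2 * c = (cmod z)\<^sup>2 / c"
    using False by (simp add: t_def norm_divide power_divide power2_eq_square)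
  ultimately have "(cmod z)\<^sup>2 / c \<le> a"
    using assms(1)[of t] by simp
  then show ?thesis
    using False assms(2) by (simp add: field_simps)
qed

lemma cinner_Cauchy_Schwarz: "cmod (cinner u v) \<le> norm u * norm (v::'h::complex_hilbert)"
proof -
  have "(cmod (cinner u v))\<^sup>2 \<le> (norm u)\<^sup>2 * (norm v)\<^sup>2"
  proof (rule cmod_power2_le_of_quadratic)
    fix t
    have *: "Re (cinner u (t *\<^sub>C v)) = Re (cinner (t *\<^sub>C v) u)"
      by (metis cinner_commute cnj.simps(1))
    have "(norm (u + t *\<^sub>C v))\<^sup>2 = Re (cinner (u + t *\<^sub>C v) (u + t *\<^sub>C v))"
      by (simp add: cinner_self)
    also have "\<dots> = (norm u)\<^sup>2 + 2 * Re (cinner u (t *\<^sub>C v)) + (norm (t *\<^sub>C v))\<^sup>2"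
      using * by (simp only: cinner_add_left cinner_add_right) (simp add: cinner_self)
    finally have "(norm (u + t *\<^sub>C v))\<^sup>2
        = (norm u)\<^sup>2 + 2 * Re (t * cinner u v) + (cmod t)\<^sup>2 * (norm v)\<^sup>2"
      by (simp add: cinner_scaleC_right norm_scaleC power_mult_distrib)
    then show "0 \<le> (norm u)\<^sup>2 + 2 * Re (t * cinner u v) + (cmod t)\<^sup>2 * (norm v)\<^sup>2"
      by (metis zero_le_power2)
  qed simp
  then have "(cmod (cinner u v))\<^sup>2 \<le> (norm u * norm v)\<^sup>2"
    by (simp add: power_mult_distrib)
  then show ?thesis
    by (rule power2_le_imp_le) simp
qed

lemma bounded_bilinear_cinner: "bounded_bilinear (cinner :: 'h::complex_hilbert \<Rightarrow> _)"
  by (unfold_locales; (intro exI[of _ 1] allI)?)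
     (simp_all add: cinner_simps scaleR_conv_of_real cinner_Cauchy_Schwarz)

lemma bounded_bilinear_scaleC:
  "bounded_bilinear (scaleC :: complex \<Rightarrow> 'h \<Rightarrow> 'h::complex_hilbert)"
  by (unfold_locales; (intro exI[of _ 1] allI)?)
     (simp_all add: scaleC_add_left scaleC_add_right scaleR_scaleC scaleC_scaleC norm_scaleC
        scaleR_conv_of_real mult.commute)

lemmas tendsto_cinner [tendsto_intros] = bounded_bilinear.tendsto[OF bounded_bilinear_cinner]
lemmas bounded_linear_cinner_right =
  bounded_bilinear.bounded_linear_right[OF bounded_bilinear_cinner]
lemmas bounded_linear_cinner_left =
  bounded_bilinear.bounded_linear_left[OF bounded_bilinear_cinner]

lemma cinner_right_extensionality:
  assumes "closure A = UNIV" and "\<And>u. u \<in> A \<Longrightarrow> cinner u v = cinner u (w::'h::complex_hilbert)"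
  shows "v = w"
proof -
  have "closed {u. cinner u (v - w) = 0}"
    by (intro closed_Collect_eq continuous_intros
        linear_continuous_on[OF bounded_linear_cinner_left])
  then have "closure A \<subseteq> {u. cinner u (v - w) = 0}"
    using assms(2) by (intro closure_minimal) (auto simp: cinner_diff_right)
  then have "cinner (v - w) (v - w) = 0"
    using assms(1) by blast
  then show ?thesis by simp
qed

lemma cinner_right_eqI: "(\<And>u. cinner u v = cinner u w) \<Longrightarrow> v = (w::'h::complex_hilbert)"
  by (rule cinner_right_extensionality[of UNIV]) auto

text \<open>\<open>tr\<close> picks its basis with \<open>SOME\<close>, so a basis must exist.
  Zorn's lemma gives a maximal orthonormal set; a unit vector orthogonal to all of it could still be
  adjoined.\<close>

lemma exists_is_onb: "\<exists>B::'h::complex_hilbert set. is_onb B"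
proof -
  define A :: "'h set set" where
    "A = {B. (\<forall>e\<in>B. norm e = 1) \<and> (\<forall>e\<in>B. \<forall>f\<in>B. e \<noteq> f \<longrightarrow> cinner e f = 0)}"
  have "\<exists>B\<in>A. \<forall>X\<in>A. B \<subseteq> X \<longrightarrow> X = B"
  proof (rule subset_Zorn_nonempty)
    show "A \<noteq> {}" by (auto simp: A_def)
    fix \<C> assume "\<C> \<noteq> {}" and C: "subset.chain A \<C>"
    show "\<Union>\<C> \<in> A"
      unfolding A_def
    proof (intro CollectI conjI ballI impI)
      fix e assume "e \<in> \<Union>\<C>" then show "norm e = 1"
        using C by (auto simp: A_def subset.chain_def)
    next
      fix e f assume "e \<in> \<Union>\<C>" "f \<in> \<Union>\<C>" "e \<noteq> f"
      then obtain X Y where "X \<in> \<C>" "Y \<in> \<C>" "e \<in> X" "f \<in> Y" by blast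
      then obtain Z where "Z \<in> \<C>" "e \<in> Z" "f \<in> Z"
        using C unfolding subset_chain_def by blast
      then show "cinner e f = 0"
        using C \<open>e \<noteq> f\<close> by (auto simp: A_def subset_chain_def)
    qed
  qed
  then obtain B where B: "B \<in> A" and max: "\<And>X. X \<in> A \<Longrightarrow> B \<subseteq> X \<Longrightarrow> X = B" by blast
  have "v = 0" if v: "\<forall>e\<in>B. cinner e v = 0" for v
  proof (rule ccontr)
    assume "v \<noteq> 0"
    define w where "w = (1 / norm v) *\<^sub>R v"
    have nw: "norm w = 1" using \<open>v \<noteq> 0\<close> by (simp add: w_def)
    have ew: "cinner e w = 0" if "e \<in> B" for e
      using v that by (simp add: w_def cinner_scaleR_right)
    then have we: "cinner w e = 0" if "e \<in> B" for e
      using that by (metis cinner_commute complex_cnj_zero)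
    have "insert w B \<in> A"
      using B nw ew we by (auto simp: A_def)
    with max have "w \<in> B" by blast
    with ew have "cinner w w = 0" by blast
    with nw show False by (simp add: cinner_self)
  qed
  then have "is_onb B" using B by (auto simp: A_def is_onb_def)
  then show ?thesis ..
qed

section \<open>Bessel, Fourier and Parseval for bases of any cardinality\<close>

locale onb =
  fixes B :: "'h::complex_hilbert set"
  assumes is_onb: "is_onb B"
begin

lemma norm_basis: "e \<in> B \<Longrightarrow> norm e = 1"
  using is_onb[unfolded is_onb_def, THEN conjunct1] by (rule bspec)

lemma cinner_basis: "e \<in> B \<Longrightarrow> f \<in> B \<Longrightarrow> cinner e f = (if e = f then 1 else 0)"
proof (cases "e = f")
  case True
  then show "e \<in> B \<Longrightarrow> ?thesis" by (simp add: cinner_self norm_basis)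
next
  case False
  then have "e \<in> B \<Longrightarrow> f \<in> B \<Longrightarrow> cinner e f = 0"
    using is_onb[unfolded is_onb_def, THEN conjunct2, THEN conjunct1] by blast
  then show "e \<in> B \<Longrightarrow> f \<in> B \<Longrightarrow> ?thesis" using False by simp
qed

lemma norm_sum_basis_power2:
  assumes "finite F" "F \<subseteq> B"
  shows "(norm (\<Sum>e\<in>F. c e *\<^sub>C e))\<^sup>2 = (\<Sum>e\<in>F. (cmod (c e))\<^sup>2)"
proof -
  have "cinner (\<Sum>e\<in>F. c e *\<^sub>C e) (\<Sum>e\<in>F. c e *\<^sub>C e)
      = (\<Sum>e\<in>F. \<Sum>f\<in>F. cnj (c e) * (c f * (if e = f then 1 else 0)))"
    using assms(2) unfolding cinner_sum_left cinner_sum_right cinner_scaleC_left cinner_scaleC_right sum_distrib_left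
    by (intro sum.cong refl) (simp add: cinner_basis subset_iff)
  also have "\<dots> = (\<Sum>e\<in>F. of_real ((cmod (c e))\<^sup>2))"
    using assms(1) by (intro sum.cong refl)
      (simp add: complex_mult_cnj_eq if_distrib[where f="\<lambda>x. _ * x"] cong: if_cong)
  also have "\<dots> = of_real (\<Sum>e\<in>F. (cmod (c e))\<^sup>2)"
    by simp
  finally have "complex_of_real ((norm (\<Sum>e\<in>F. c e *\<^sub>C e))\<^sup>2) = of_real (\<Sum>e\<in>F. (cmod (c e))\<^sup>2)"
    by (simp only: cinner_self)
  then show ?thesis
    by (simp only: of_real_eq_iff)
qed

lemma Bessel:
  assumes "finite F" "F \<subseteq> B"
  shows "(\<Sum>e\<in>F. (cmod (cinner e v))\<^sup>2) \<le> (norm v)\<^sup>2"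
proof -
  define w where "w = (\<Sum>e\<in>F. cinner e v *\<^sub>C e)"
  define s where "s = (\<Sum>e\<in>F. (cmod (cinner e v))\<^sup>2)"
  have ww: "cinner w w = of_real s"
    using norm_sum_basis_power2[OF assms, of "\<lambda>e. cinner e v"] by (simp add: cinner_self w_def s_def)
  have wv: "cinner w v = of_real s"
    by (simp add: w_def s_def cinner_simps complex_mult_cnj_eq)
  then have vw: "cinner v w = of_real s"
    by (metis cinner_commute complex_cnj_complex_of_real)
  have "of_real ((norm (v - w))\<^sup>2) = (of_real ((norm v)\<^sup>2 - s) :: complex)"
    by (simp only: cinner_self[symmetric] cinner_diff_left cinner_diff_right ww wv vw)
      (simp add: cinner_self)
  then have "(norm (v - w))\<^sup>2 = (norm v)\<^sup>2 - s"
    by (simp only: of_real_eq_iff)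
  then show ?thesis
    by (metis s_def diff_ge_0_iff_ge zero_le_power2)
qed

lemma summable_on_power2_coefficients: "(\<lambda>e. (cmod (cinner e v))\<^sup>2) summable_on B"
proof (rule nonneg_bdd_above_summable_on)
  show "bdd_above (sum (\<lambda>e. (cmod (cinner e v))\<^sup>2) ` {F. F \<subseteq> B \<and> finite F})"
    by (rule bdd_aboveI2[of _ _ "(norm v)\<^sup>2"]) (simp add: Bessel)
qed simp

text \<open>For nested finite sets the squared norm of the difference of the partial sums is the
  difference of the sums of |<e,v>|^2, so the partial sums are Cauchy along finite subsets and
  completeness gives a limit w. The coefficients of v - w vanish, and maximality of the basis forces
  v = w.\<close>

lemma has_sum_Fourier: "((\<lambda>e. cinner e v *\<^sub>C e) has_sum v) B"
proof -
  let ?f = "\<lambda>e. cinner e v *\<^sub>C e" and ?g = "\<lambda>e. (cmod (cinner e v))\<^sup>2"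
  obtain L where lim: "(sum ?g \<longlongrightarrow> L) (finite_subsets_at_top B)"
    using summable_on_power2_coefficients unfolding summable_on_def has_sum_def by blast
  have "\<exists>P. eventually P (finite_subsets_at_top B) \<and>
          (\<forall>F F'. P F \<and> P F' \<longrightarrow> dist (sum ?f F) (sum ?f F') < \<epsilon>)" if "\<epsilon> > 0" for \<epsilon>
  proof -
    \<comment> \<open>Two sums of \<open>?g\<close> within d of the limit L differ by less than 2 d,
      the square of \<epsilon> / 2; comparing both \<open>F\<close> and \<open>F'\<close> with
      \<open>X\<close> then costs \<epsilon> in all.\<close>
    define d where "d = (\<epsilon> / 2)\<^sup>2 / 2"
    have "d > 0" using that by (simp add: d_def)
    have "eventually (\<lambda>F. dist (sum ?g F) L < d) (finite_subsets_at_top B)"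
      using lim \<open>d > 0\<close> by (auto simp: tendsto_iff)
    then have "\<exists>X. finite X \<and> X \<subseteq> B \<and>
        (\<forall>F. finite F \<and> X \<subseteq> F \<and> F \<subseteq> B \<longrightarrow> dist (sum ?g F) L < d)"
      by (simp only: eventually_finite_subsets_at_top)
    then obtain X where X: "finite X" "X \<subseteq> B"
      and XF: "\<And>F. finite F \<Longrightarrow> X \<subseteq> F \<Longrightarrow> F \<subseteq> B \<Longrightarrow> dist (sum ?g F) L < d"
      by metis
    have *: "norm (sum ?f F - sum ?f X) < \<epsilon> / 2" if F: "finite F" "X \<subseteq> F" "F \<subseteq> B" for F
    proof -
      have "(norm (sum ?f F - sum ?f X))\<^sup>2 = (norm (sum ?f (F - X)))\<^sup>2"
        using F X by (simp add: sum_diff)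
      also have "\<dots> = sum ?g (F - X)"
        using F by (intro norm_sum_basis_power2) auto
      also have "\<dots> = sum ?g F - sum ?g X"
        using F X by (simp add: sum_diff)
      also have "\<dots> < 2 * d"
        using XF[OF F] XF[of X] X unfolding dist_real_def by auto
      also have "\<dots> = (\<epsilon> / 2)\<^sup>2"
        by (simp add: d_def)
      finally show ?thesis
        by (rule power2_less_imp_less) (use \<open>\<epsilon> > 0\<close> in simp)
    qed
    have ev: "eventually (\<lambda>F. finite F \<and> X \<subseteq> F \<and> F \<subseteq> B) (finite_subsets_at_top B)"
      unfolding eventually_finite_subsets_at_top using X by (intro exI[of _ X]) simp
    have "dist (sum ?f F) (sum ?f F') < \<epsilon>"
      if "finite F \<and> X \<subseteq> F \<and> F \<subseteq> B" "finite F' \<and> X \<subseteq> F' \<and> F' \<subseteq> B" for F F'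
      using *[of F] *[of F'] that dist_triangle2[of "sum ?f F" "sum ?f F'" "sum ?f X"]
      by (simp add: dist_norm)
    with ev show ?thesis
      by (intro exI[of _ "\<lambda>F. finite F \<and> X \<subseteq> F \<and> F \<subseteq> B"] conjI allI impI) simp_all
  qed
  then have "cauchy_filter (filtermap (sum ?f) (finite_subsets_at_top B))"
    by (simp add: cauchy_filter_metric_filtermap)
  moreover have "complete (UNIV::'h set)"
    by (meson Cauchy_convergent UNIV_I complete_def convergent_def)
  ultimately obtain w where "(sum ?f \<longlongrightarrow> w) (finite_subsets_at_top B)"
    using complete_uniform[where S="UNIV::'h set"] by (force simp: filterlim_def)
  then have w: "(?f has_sum w) B"
    by (simp add: has_sum_def)
  have "cinner e (v - w) = 0" if "e \<in> B" for e
  proof -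
    have "((\<lambda>f. cinner e (?f f)) has_sum cinner e w) B"
      by (rule has_sum_bounded_linear[OF bounded_linear_cinner_right w])
    moreover have "((\<lambda>f. cinner e (?f f)) has_sum cinner e v) B"
      by (rule has_sum_finite_neutralI[of "{e}"])
        (use that in \<open>auto simp: cinner_scaleC_right cinner_basis norm_basis cinner_self\<close>)
    ultimately have "cinner e w = cinner e v"
      by (rule has_sum_unique)
    then show ?thesis
      by (simp add: cinner_diff_right)
  qed
  then have "v - w = 0"
    using is_onb[unfolded is_onb_def, THEN conjunct2, THEN conjunct2] by blast
  then show ?thesis using w by simp
qed

lemma has_sum_Parseval: "((\<lambda>e. cinner u e * cinner e v) has_sum cinner u v) B"
  using has_sum_bounded_linear[OF bounded_linear_cinner_right has_sum_Fourier, of u v]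
  by (simp add: cinner_scaleC_right mult.commute)

lemma sum_abs_Parseval_le:
  assumes "finite F" "F \<subseteq> B"
  shows "(\<Sum>e\<in>F. cmod (cinner u e * cinner e v)) \<le> norm u * norm v"
proof -
  have "(\<Sum>e\<in>F. cmod (cinner u e * cinner e v))
      \<le> L2_set (\<lambda>e. cmod (cinner e u)) F * L2_set (\<lambda>e. cmod (cinner e v)) F"
    using L2_set_mult_ineq[of "\<lambda>e. cmod (cinner e u)" "\<lambda>e. cmod (cinner e v)" F]
    by (simp add: norm_mult cmod_cinner_commute[of u])
  also have "\<dots> \<le> norm u * norm v"
    using Bessel[OF assms, of u] Bessel[OF assms, of v]
    by (intro mult_mono) (auto simp: L2_set_def intro!: real_le_lsqrt sum_nonneg)
  finally show ?thesis .
qed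

end

section \<open>Nuclear operators and the trace\<close>

lemma bounded_clinearD:
  assumes "bounded_clinear T"
  shows "T (u + v) = T u + T v" "T (u - v) = T u - T v" "T (c *\<^sub>C v) = c *\<^sub>C T v" "T 0 = 0"
    "T (- v) = - T v" "T (\<Sum>i\<in>I. f i) = (\<Sum>i\<in>I. T (f i))" "bounded_linear T"
  using assms bounded_linear.linear linear_add linear_diff linear_0 linear_neg linear_sum[of T f I]
  unfolding bounded_clinear_def by blast+

lemma bounded_clinear_compose:
  "bounded_clinear S \<Longrightarrow> bounded_clinear T \<Longrightarrow> bounded_clinear (S \<circ> T)"
  unfolding bounded_clinear_def o_def by (auto intro: bounded_linear_compose)

lemma bounded_clinear_id: "bounded_clinear id" "bounded_clinear (\<lambda>v. v)"
  by (auto simp: bounded_clinear_def id_def)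

lemma bounded_clinear_diff:
  "bounded_clinear S \<Longrightarrow> bounded_clinear T \<Longrightarrow> bounded_clinear (\<lambda>v. S v - T v)"
  unfolding bounded_clinear_def by (auto intro: bounded_linear_sub simp: scaleC_diff_right)

text \<open>The witnesses of \<open>trace_class\<close> are exposed because traces are computed from
  them, as the sum of the numbers \<open>cinner (b n) (a n)\<close>, in which no basis
  occurs.\<close>

definition nuclear_rep :: "(nat \<Rightarrow> 'h) \<Rightarrow> (nat \<Rightarrow> 'h) \<Rightarrow> ('h \<Rightarrow> 'h::complex_hilbert) \<Rightarrow> bool" where
  "nuclear_rep a b T \<longleftrightarrow> summable (\<lambda>n. norm (a n) * norm (b n)) \<and>
     (\<forall>v. (\<lambda>n. cinner (b n) v *\<^sub>C a n) sums T v)"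

lemma trace_class_iff_nuclear_rep: "trace_class T \<longleftrightarrow> (\<exists>a b. nuclear_rep a b T)"
  by (simp add: trace_class_def nuclear_rep_def)

lemma nuclear_rep_sums: "nuclear_rep a b T \<Longrightarrow> (\<lambda>n. cinner (b n) v *\<^sub>C a n) sums T v"
  by (simp add: nuclear_rep_def)

lemma nuclear_rep_norm_le:
  assumes "nuclear_rep a b T"
  shows "norm (T v) \<le> (\<Sum>n. norm (a n) * norm (b n)) * norm v"
proof -
  have s: "summable (\<lambda>n. norm (a n) * norm (b n))"
    using assms by (simp add: nuclear_rep_def)
  have le: "norm (cinner (b n) v *\<^sub>C a n) \<le> norm (a n) * norm (b n) * norm v" for n
    using mult_right_mono[OF cinner_Cauchy_Schwarz[of "b n" v], of "norm (a n)"]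
    by (simp add: norm_scaleC mult_ac)
  have s': "summable (\<lambda>n. norm (a n) * norm (b n) * norm v)"
    using s by (rule summable_mult2)
  then have sn: "summable (\<lambda>n. norm (cinner (b n) v *\<^sub>C a n))"
    by (rule summable_comparison_test_ev[rotated]) (use le in simp)
  have "norm (T v) = norm (\<Sum>n. cinner (b n) v *\<^sub>C a n)"
    using nuclear_rep_sums[OF assms, of v] by (simp add: sums_iff)
  also have "\<dots> \<le> (\<Sum>n. norm (cinner (b n) v *\<^sub>C a n))"
    by (rule summable_norm[OF sn])
  also have "\<dots> \<le> (\<Sum>n. norm (a n) * norm (b n) * norm v)"
    by (rule suminf_le[OF le sn s'])
  also have "\<dots> = (\<Sum>n. norm (a n) * norm (b n)) * norm v"
    using s by (rule suminf_mult2[symmetric])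
  finally show ?thesis .
qed

lemma nuclear_rep_bounded_clinear:
  assumes "nuclear_rep a b T"
  shows "bounded_clinear T"
proof -
  have add: "T (u + v) = T u + T v" for u v
  proof (rule sums_unique2[OF nuclear_rep_sums[OF assms]])
    show "(\<lambda>n. cinner (b n) (u + v) *\<^sub>C a n) sums (T u + T v)"
      using sums_add[OF nuclear_rep_sums[OF assms, of u] nuclear_rep_sums[OF assms, of v]]
      by (simp add: cinner_add_right scaleC_add_left)
  qed
  have scale: "T (c *\<^sub>C v) = c *\<^sub>C T v" for c v
  proof (rule sums_unique2[OF nuclear_rep_sums[OF assms]])
    show "(\<lambda>n. cinner (b n) (c *\<^sub>C v) *\<^sub>C a n) sums (c *\<^sub>C T v)"
      using bounded_linear.sums[OF bounded_bilinear.bounded_linear_right[OF bounded_bilinear_scaleC]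
          nuclear_rep_sums[OF assms, of v], of c]
      by (simp add: cinner_scaleC_right scaleC_scaleC)
  qed
  have "bounded_linear T"
    by (rule bounded_linear_intro[where K="\<Sum>n. norm (a n) * norm (b n)"])
      (use add scale nuclear_rep_norm_le[OF assms] in \<open>simp_all add: scaleR_scaleC mult.commute\<close>)
  with scale show ?thesis
    by (simp add: bounded_clinear_def)
qed

lemma trace_class_bounded_clinear: "trace_class T \<Longrightarrow> bounded_clinear T"
  unfolding trace_class_iff_nuclear_rep using nuclear_rep_bounded_clinear by blast

lemma nuclear_rep_compose:
  assumes "nuclear_rep a b T" and M: "bounded_clinear M"
  shows "nuclear_rep (M \<circ> a) b (M \<circ> T)"
proof -
  obtain K where K: "\<And>v. norm (M v) \<le> norm v * K" and "K > 0"
    using bounded_linear.pos_bounded[OF bounded_clinearD(7)[OF M]] by blast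
  have "summable (\<lambda>n. norm (M (a n)) * norm (b n))"
  proof (rule summable_comparison_test_ev)
    show "summable (\<lambda>n. K * (norm (a n) * norm (b n)))"
      using assms(1) by (intro summable_mult) (simp add: nuclear_rep_def)
    have "norm (M (a n)) * norm (b n) \<le> K * (norm (a n) * norm (b n))" for n
      using mult_right_mono[OF K[of "a n"], of "norm (b n)"] by (simp add: mult_ac)
    then show "\<forall>\<^sub>F n in sequentially. norm (norm (M (a n)) * norm (b n)) \<le> K * (norm (a n) * norm (b n))"
      by simp
  qed
  moreover have "(\<lambda>n. cinner (b n) v *\<^sub>C M (a n)) sums M (T v)" for v
    using bounded_linear.sums[OF bounded_clinearD(7)[OF M] nuclear_rep_sums[OF assms(1), of v]]
    by (simp add: bounded_clinearD(3)[OF M])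
  ultimately show ?thesis
    by (simp add: nuclear_rep_def)
qed

lemma trace_class_compose: "trace_class T \<Longrightarrow> bounded_clinear M \<Longrightarrow> trace_class (M \<circ> T)"
  unfolding trace_class_iff_nuclear_rep using nuclear_rep_compose by blast

lemma nuclear_rep_adjoint:
  assumes "nuclear_rep a b T"
  shows "nuclear_rep b a (\<lambda>v. \<Sum>n. cinner (a n) v *\<^sub>C b n)"
    and "cinner u (\<Sum>n. cinner (a n) v *\<^sub>C b n) = cinner (T u) v"
proof -
  have "summable (\<lambda>n. norm (cinner (a n) v *\<^sub>C b n))" for v
  proof (rule summable_comparison_test_ev)
    show "summable (\<lambda>n. norm v * (norm (a n) * norm (b n)))"
      using assms by (intro summable_mult) (simp add: nuclear_rep_def)
    have "norm (cinner (a n) v *\<^sub>C b n) \<le> norm v * (norm (a n) * norm (b n))" for n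
      using mult_right_mono[OF cinner_Cauchy_Schwarz[of "a n" v], of "norm (b n)"]
      by (simp add: norm_scaleC mult_ac)
    then show "\<forall>\<^sub>F n in sequentially. norm (norm (cinner (a n) v *\<^sub>C b n))
        \<le> norm v * (norm (a n) * norm (b n))"
      by simp
  qed
  then have s: "(\<lambda>n. cinner (a n) v *\<^sub>C b n) sums (\<Sum>n. cinner (a n) v *\<^sub>C b n)" for v
    by (simp add: summable_norm_cancel summable_sums)
  then show "nuclear_rep b a (\<lambda>v. \<Sum>n. cinner (a n) v *\<^sub>C b n)"
    using assms by (simp add: nuclear_rep_def mult.commute)
  have "(\<lambda>n. cinner (a n) v * cinner u (b n)) sums cinner u (\<Sum>n. cinner (a n) v *\<^sub>C b n)"
    using bounded_linear.sums[OF bounded_linear_cinner_right s[of v], of u]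
    by (simp add: cinner_scaleC_right)
  moreover have "(\<lambda>n. cinner (a n) v * cinner u (b n)) sums cinner (T u) v"
  proof -
    have "cnj (cinner (b n) u) = cinner u (b n)" for n
      by (metis cinner_commute)
    then show ?thesis
      using bounded_linear.sums[OF bounded_linear_cinner_left nuclear_rep_sums[OF assms, of u], of v]
      by (simp add: cinner_scaleC_left mult.commute)
  qed
  ultimately show "cinner u (\<Sum>n. cinner (a n) v *\<^sub>C b n) = cinner (T u) v"
    by (rule sums_unique2)
qed

lemma nuclear_rep_compose_right:
  assumes "nuclear_rep a b T" and M: "bounded_clinear M" and sa: "\<And>u v. cinner u (M v) = cinner (M u) v"
  shows "nuclear_rep a (M \<circ> b) (T \<circ> M)"
proof -
  \<comment> \<open>The adjoint has the two sequences exchanged; composing it with \<open>M\<close>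
    supplies the summability of ||a_n|| ||M b_n||.\<close>
  note 1 = nuclear_rep_compose[OF nuclear_rep_adjoint(1)[OF assms(1)] M]
  have "summable (\<lambda>n. norm (a n) * norm (M (b n)))"
    using 1 by (simp add: nuclear_rep_def mult.commute)
  moreover have "(\<lambda>n. cinner (M (b n)) v *\<^sub>C a n) sums T (M v)" for v
    using nuclear_rep_sums[OF assms(1), of "M v"] by (simp add: sa)
  ultimately show ?thesis
    by (simp add: nuclear_rep_def)
qed

text \<open>Merges two nuclear representations into one indexed by \<open>nat\<close>, the first on
  the even and the second on the odd indices.\<close>

lemma sums_interleave:
  fixes f g :: "nat \<Rightarrow> 'a::real_normed_vector"
  assumes "f sums x" "g sums y"
  shows "(\<lambda>n. if even n then f (n div 2) else g (n div 2)) sums (x + y)"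
proof -
  have "(\<lambda>n. if even n then f (n div 2) else 0) sums x"
    by (rule sums_mono_reindex[of "\<lambda>n. 2 * n", THEN iffD1])
      (use assms(1) in \<open>auto simp: strict_mono_def elim!: evenE\<close>)
  moreover have "(\<lambda>n. if even n then 0 else g (n div 2)) sums y"
    by (rule sums_mono_reindex[of "\<lambda>n. 2 * n + 1", THEN iffD1])
      (use assms(2) in \<open>auto simp: strict_mono_def elim!: oddE\<close>)
  ultimately have "(\<lambda>n. (if even n then f (n div 2) else 0) + (if even n then 0 else g (n div 2)))
      sums (x + y)"
    by (rule sums_add)
  then show ?thesis
    by (rule sums_cong[THEN iffD1, rotated]) simp
qed

lemma trace_class_add:
  assumes "trace_class S" "trace_class T"
  shows "trace_class (\<lambda>v. S v + T v)"
proof -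
  obtain a b c d where 1: "nuclear_rep a b S" and 2: "nuclear_rep c d T"
    using assms unfolding trace_class_iff_nuclear_rep by blast
  let ?a = "\<lambda>n. if even n then a (n div 2) else c (n div 2)"
  let ?b = "\<lambda>n. if even n then b (n div 2) else d (n div 2)"
  obtain x y where "(\<lambda>n. norm (a n) * norm (b n)) sums x" "(\<lambda>n. norm (c n) * norm (d n)) sums y"
    using 1 2 unfolding nuclear_rep_def summable_def by blast
  from sums_interleave[OF this] have "(\<lambda>n. norm (?a n) * norm (?b n)) sums (x + y)"
    by (rule sums_cong[THEN iffD1, rotated]) simp
  then have "summable (\<lambda>n. norm (?a n) * norm (?b n))"
    by (rule sums_summable)
  moreover have "(\<lambda>n. cinner (?b n) v *\<^sub>C ?a n) sums (S v + T v)" for v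
    using sums_interleave[OF nuclear_rep_sums[OF 1, of v] nuclear_rep_sums[OF 2, of v]]
    by (rule sums_cong[THEN iffD1, rotated]) simp
  ultimately have "nuclear_rep ?a ?b (\<lambda>v. S v + T v)"
    by (simp add: nuclear_rep_def)
  then show ?thesis
    unfolding trace_class_iff_nuclear_rep by blast
qed

lemma bounded_clinear_scaleC: "bounded_clinear (scaleC c)"
  using bounded_bilinear.bounded_linear_right[OF bounded_bilinear_scaleC]
  by (simp add: bounded_clinear_def scaleC_scaleC mult.commute)

lemma trace_class_scaleC: "trace_class T \<Longrightarrow> trace_class (\<lambda>v. c *\<^sub>C T v)"
  using trace_class_compose[OF _ bounded_clinear_scaleC, of T c] by (simp add: o_def)

lemma trace_class_zero: "trace_class (\<lambda>v. 0)"
  unfolding trace_class_def by (intro exI[of _ "\<lambda>_. 0"]) simp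

lemma trace_class_sum: "(\<And>i. i \<in> I \<Longrightarrow> trace_class (T i)) \<Longrightarrow> trace_class (\<lambda>v. \<Sum>i\<in>I. T i v)"
  by (induction I rule: infinite_finite_induct) (auto intro: trace_class_add trace_class_zero)

text \<open>Fubini for the double family <b_n,e> <e,a_n>. Bessel bounds its absolute sum over e by
  ||a_n|| ||b_n||, so it is absolutely summable. Summing over e first gives <b_n,a_n> by Parseval,
  summing over n first gives <e,T e>; the trace is therefore the same in every basis.\<close>

lemma has_sum_trace_nuclear_rep:
  assumes T: "nuclear_rep a b T" and "is_onb B"
  shows "((\<lambda>e. cinner e (T e)) has_sum (\<Sum>n. cinner (b n) (a n))) B"
    and "summable (\<lambda>n. cinner (b n) (a n))"
proof -
  interpret onb B by standard fact
  let ?f = "\<lambda>(n, e). cinner (b n) e * cinner e (a n)"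
  have "(\<lambda>p. norm (?f p)) summable_on UNIV \<times> B"
    unfolding Infinite_Sum.abs_summable_on_Sigma_iff prod.case
  proof (intro conjI ballI)
    fix n
    have bdd: "bdd_above (sum (\<lambda>e. norm (cinner (b n) e * cinner e (a n))) ` {F. F \<subseteq> B \<and> finite F})" for n
      by (rule bdd_aboveI2[of _ _ "norm (b n) * norm (a n)"]) (simp add: sum_abs_Parseval_le)
    then show *: "(\<lambda>e. norm (cinner (b n) e * cinner e (a n))) summable_on B" for n
      by (intro nonneg_bdd_above_summable_on) simp_all
    have "(\<Sum>\<^sub>\<infinity>e\<in>B. norm (cinner (b n) e * cinner e (a n))) \<le> norm (a n) * norm (b n)" for n
      by (rule infsum_le_finite_sums[OF *]) (subst mult.commute, rule sum_abs_Parseval_le)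
    moreover have "0 \<le> (\<Sum>\<^sub>\<infinity>e\<in>B. norm (cinner (b n) e * cinner e (a n)))" for n
      by (rule infsum_nonneg) simp
    moreover have "summable (\<lambda>n. norm (a n) * norm (b n))"
      using T by (simp add: nuclear_rep_def)
    ultimately have "summable (\<lambda>n. norm (\<Sum>\<^sub>\<infinity>e\<in>B. norm (cinner (b n) e * cinner e (a n))))"
      by - (rule summable_comparison_test[of _ "\<lambda>n. norm (a n) * norm (b n)"], simp_all)
    then show "(\<lambda>n. norm (\<Sum>\<^sub>\<infinity>e\<in>B. norm (cinner (b n) e * cinner e (a n)))) summable_on UNIV"
      by (intro norm_summable_imp_summable_on) simp
  qed
  then obtain s where s: "(?f has_sum s) (UNIV \<times> B)"
    using abs_summable_summable unfolding summable_on_def by blast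
  have "((\<lambda>n. cinner (b n) (a n)) has_sum s) UNIV"
    by (rule has_sum_SigmaD[OF s]) (use has_sum_Parseval in simp)
  then have s': "(\<lambda>n. cinner (b n) (a n)) sums s"
    by (rule has_sum_imp_sums)
  then show "summable (\<lambda>n. cinner (b n) (a n))"
    by (rule sums_summable)
  have "((\<lambda>(e, n). cinner (b n) e * cinner e (a n)) has_sum s) (B \<times> UNIV)"
    using has_sum_swap[where f="?f" and A=UNIV and B=B and S=s] s by simp
  then have "((\<lambda>e. cinner e (T e)) has_sum s) B"
  proof (rule has_sum_SigmaD)
    fix e assume "e \<in> B"
    have "summable (\<lambda>n. norm (cinner (b n) e * cinner e (a n)))"
    proof (rule summable_comparison_test_ev)
      show "summable (\<lambda>n. norm (a n) * norm (b n))"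
        using T by (simp add: nuclear_rep_def)
      have "norm (cinner (b n) e * cinner e (a n)) \<le> norm (a n) * norm (b n)" for n
        using mult_mono[OF cinner_Cauchy_Schwarz[of "b n" e] cinner_Cauchy_Schwarz[of e "a n"]]
          norm_basis[OF \<open>e \<in> B\<close>] by (simp add: norm_mult mult.commute)
      then show "\<forall>\<^sub>F n in sequentially. norm (norm (cinner (b n) e * cinner e (a n))) \<le> norm (a n) * norm (b n)"
        by simp
    qed
    moreover have "(\<lambda>n. cinner (b n) e * cinner e (a n)) sums cinner e (T e)"
      using bounded_linear.sums[OF bounded_linear_cinner_right nuclear_rep_sums[OF T, of e], of e]
      by (simp add: cinner_scaleC_right)
    ultimately show "((\<lambda>n. case (e, n) of (e, n) \<Rightarrow> cinner (b n) e * cinner e (a n)) has_sum cinner e (T e)) UNIV"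
      using norm_summable_imp_has_sum by simp
  qed
  then show "((\<lambda>e. cinner e (T e)) has_sum (\<Sum>n. cinner (b n) (a n))) B"
    using sums_unique[OF s'] by simp
qed

lemma is_onb_some: "is_onb (SOME B::'h::complex_hilbert set. is_onb B)"
  using exists_is_onb by (rule someI_ex)

lemma tr_nuclear_rep: "nuclear_rep a b T \<Longrightarrow> (\<lambda>n. cinner (b n) (a n)) sums tr T"
  unfolding tr_def
  using has_sum_trace_nuclear_rep[OF _ is_onb_some, of a b T] by (simp add: infsumI summable_sums)

lemma has_sum_tr:
  "trace_class T \<Longrightarrow> ((\<lambda>e. cinner e (T e)) has_sum tr T) (SOME B. is_onb B)"
  unfolding tr_def trace_class_iff_nuclear_rep
  by (rule has_sum_infsum) (auto simp: summable_on_def dest: has_sum_trace_nuclear_rep(1)[OF _ is_onb_some])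

lemma tr_add: "trace_class S \<Longrightarrow> trace_class T \<Longrightarrow> tr (\<lambda>v. S v + T v) = tr S + tr T"
  using has_sum_add[OF has_sum_tr has_sum_tr, of S T] by (simp add: tr_def cinner_add_right infsumI)

lemma tr_scaleC: "trace_class T \<Longrightarrow> tr (\<lambda>v. c *\<^sub>C T v) = c * tr T"
  using has_sum_cmult_right[OF has_sum_tr, of T c] by (simp add: tr_def cinner_scaleC_right infsumI)

lemma tr_zero: "tr (\<lambda>v. 0) = 0"
  by (simp add: tr_def)

lemma tr_sum:
  "(\<And>i. i \<in> I \<Longrightarrow> trace_class (T i)) \<Longrightarrow> tr (\<lambda>v. \<Sum>i\<in>I. T i v) = (\<Sum>i\<in>I. tr (T i))"
  by (induction I rule: infinite_finite_induct) (simp_all add: tr_zero tr_add trace_class_sum)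

lemma tr_eq_cnj: "(\<And>v. cinner v (T v) = cnj (cinner v (S v))) \<Longrightarrow> tr T = cnj (tr S)"
  by (simp add: tr_def)

lemma tr_nonneg:
  assumes "trace_class T" "\<And>v. cinner v (T v) \<in> \<real>\<^sub>\<ge>\<^sub>0"
  shows "tr T \<in> \<real>\<^sub>\<ge>\<^sub>0"
proof -
  have "((\<lambda>e. Re (cinner e (T e))) has_sum Re (tr T)) (SOME B. is_onb B)"
    by (rule has_sum_Re[OF has_sum_tr[OF assms(1)]])
  then have "0 \<le> Re (tr T)"
    by (rule has_sum_nonneg) (use assms(2) in \<open>simp add: complex_nonneg_Reals_iff\<close>)
  moreover have "((\<lambda>e. Im (cinner e (T e))) has_sum Im (tr T)) (SOME B. is_onb B)"
    by (rule has_sum_Im[OF has_sum_tr[OF assms(1)]])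
  then have "((\<lambda>e. 0) has_sum Im (tr T)) (SOME B::'a set. is_onb B)"
    using assms(2) by (simp add: complex_nonneg_Reals_iff)
  then have "Im (tr T) = 0"
    using has_sum_0_simp has_sum_unique by blast
  ultimately show ?thesis
    by (simp add: complex_nonneg_Reals_iff)
qed

text \<open>Dominated convergence for the series of <b_n, M_k a_n>, with dominating terms ||a_n||
  ||b_n||. Weak convergence of contractions is enough, and this is what countable additivity of a
  quantum probability measure yields.\<close>

lemma tr_compose_tendsto:
  assumes "trace_class T" and M: "\<And>k::nat. bounded_clinear (M k)" and L: "bounded_clinear L"
    and le: "\<And>k v. norm (M k v) \<le> norm v"
    and lim: "\<And>u v. (\<lambda>k. cinner u (M k v)) \<longlonglongrightarrow> cinner u (L v)"
  shows "(\<lambda>k. tr (M k \<circ> T)) \<longlonglongrightarrow> tr (L \<circ> T)"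
proof -
  obtain a b where T: "nuclear_rep a b T"
    using assms(1) unfolding trace_class_iff_nuclear_rep by blast
  have eq: "tr (N \<circ> T) = (\<Sum>n. cinner (b n) (N (a n)))" if "bounded_clinear N" for N
    using tr_nuclear_rep[OF nuclear_rep_compose[OF T that]] by (simp add: sums_iff)
  have "(\<lambda>k. \<Sum>n. cinner (b n) (M k (a n))) \<longlonglongrightarrow> (\<Sum>n. cinner (b n) (L (a n)))"
  proof (rule tannerys_theorem[THEN conjunct2, THEN conjunct2])
    show "summable (\<lambda>n. norm (a n) * norm (b n))"
      using T by (simp add: nuclear_rep_def)
    have "norm (cinner (b n) (M k (a n))) \<le> norm (a n) * norm (b n)" for n k
      using order_trans[OF cinner_Cauchy_Schwarz mult_left_mono[OF le], of "b n" k "a n"]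
      by (simp add: mult.commute)
    then show "\<forall>\<^sub>F (n, k) in sequentially \<times>\<^sub>F sequentially.
        norm (cinner (b n) (M k (a n))) \<le> norm (a n) * norm (b n)"
      by (intro always_eventually) auto
  qed (use lim in auto)
  then show ?thesis
    by (simp add: eq M L)
qed

section \<open>Positive operators\<close>

text \<open>Polarization over the complex numbers: the vector u + v gives f u v + f v u = 0, the
  vector u + i v gives f u v - f v u = 0.\<close>

lemma sesquilinear_zero:
  fixes f :: "'h::complex_hilbert \<Rightarrow> 'h \<Rightarrow> complex"
  assumes "\<And>u v w. f (u + v) w = f u w + f v w" "\<And>u v w. f u (v + w) = f u v + f u w"
    and "\<And>c u v. f (c *\<^sub>C u) v = cnj c * f u v" "\<And>c u v. f u (c *\<^sub>C v) = c * f u v"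
    and "\<And>v. f v v = 0"
  shows "f u v = 0"
proof -
  have "f (u + v) (u + v) = f u v + f v u"
    by (simp only: assms(1,2)) (simp add: assms(5))
  moreover have "f (u + \<i> *\<^sub>C v) (u + \<i> *\<^sub>C v) = \<i> * (f u v - f v u)"
    by (simp only: assms(1-4)) (simp add: assms(5) algebra_simps)
  ultimately show ?thesis
    by (simp add: assms(5))
qed

lemma positive_opD: "positive_op T \<Longrightarrow> bounded_clinear T" "positive_op T \<Longrightarrow> 0 \<le> Re (cinner v (T v))"
    "positive_op T \<Longrightarrow> Im (cinner v (T v)) = 0"
  by (simp_all add: positive_op_def complex_nonneg_Reals_iff)

lemma positive_op_selfadjoint:
  assumes "positive_op T"
  shows "cinner u (T v) = cinner (T u) v"
proof -
  note T = bounded_clinearD[OF positive_opD(1)[OF assms]]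
  have "cinner v (T v) = cinner (T v) v" for v
    using positive_opD(3)[OF assms, of v] cinner_commute[of "T v" v] by (simp add: complex_eq_iff)
  then have "cinner u (T v) - cinner (T u) v = 0"
    by - (rule sesquilinear_zero[of "\<lambda>u v. cinner u (T v) - cinner (T u) v"],
      simp_all add: T cinner_simps algebra_simps)
  then show ?thesis by simp
qed

lemma positive_op_Cauchy_Schwarz:
  assumes "positive_op T"
  shows "(cmod (cinner u (T v)))\<^sup>2 \<le> Re (cinner u (T u)) * Re (cinner v (T v))"
proof (rule cmod_power2_le_of_quadratic)
  fix t
  note T = bounded_clinearD[OF positive_opD(1)[OF assms]]
  have 1: "cinner v (T u) = cnj (cinner u (T v))"
    by (metis positive_op_selfadjoint[OF assms] cinner_commute)
  have "cinner (u + t *\<^sub>C v) (T (u + t *\<^sub>C v)) = cinner u (T u) + t * cinner u (T v)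
      + cnj (t * cinner u (T v)) + (cnj t * t) * cinner v (T v)"
    by (simp add: T cinner_simps 1 algebra_simps)
  then have "Re (cinner (u + t *\<^sub>C v) (T (u + t *\<^sub>C v)))
      = Re (cinner u (T u)) + 2 * Re (t * cinner u (T v)) + (cmod t)\<^sup>2 * Re (cinner v (T v))"
    by (simp add: complex_mult_cnj_eq flip: of_real_power del: complex_cnj_mult)
  then show "0 \<le> Re (cinner u (T u)) + 2 * Re (t * cinner u (T v)) + (cmod t)\<^sup>2 * Re (cinner v (T v))"
    using positive_opD(2)[OF assms] by metis
qed (rule positive_opD(2)[OF assms])

definition effect :: "('h \<Rightarrow> 'h::complex_hilbert) \<Rightarrow> bool" where
  "effect T \<longleftrightarrow> positive_op T \<and> (\<forall>v. Re (cinner v (T v)) \<le> (norm v)\<^sup>2)"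

text \<open>This is T^2 \<le> T. The Cauchy-Schwarz inequality for the form of T at the vectors T v
  and v has ||T v||^4 on the left; bounding <T v, T T v> by ||T v||^2 and cancelling leaves the
  claim.\<close>

lemma effect_norm_power2_le:
  assumes "effect T"
  shows "(norm (T v))\<^sup>2 \<le> Re (cinner v (T v))"
proof (cases "T v = 0")
  case True
  then show ?thesis by simp
next
  case False
  have T: "positive_op T" using assms by (simp add: effect_def)
  have "((norm (T v))\<^sup>2)\<^sup>2 = (cmod (cinner (T v) (T v)))\<^sup>2"
    by (simp add: cinner_self norm_power)
  also have "\<dots> \<le> Re (cinner (T v) (T (T v))) * Re (cinner v (T v))"
    by (rule positive_op_Cauchy_Schwarz[OF T])
  also have "\<dots> \<le> (norm (T v))\<^sup>2 * Re (cinner v (T v))"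
    using assms positive_opD(2)[OF T] by (intro mult_right_mono) (auto simp: effect_def)
  finally have "(norm (T v))\<^sup>2 * (norm (T v))\<^sup>2 \<le> (norm (T v))\<^sup>2 * Re (cinner v (T v))"
    by (simp only: power2_eq_square mult.assoc)
  then show ?thesis
    by (rule mult_left_le_imp_le) (use False in simp)
qed

lemma effect_norm_le:
  assumes "effect T"
  shows "norm (T v) \<le> norm v"
proof -
  have "(norm (T v))\<^sup>2 \<le> (norm v)\<^sup>2"
    using order_trans[OF effect_norm_power2_le[OF assms, of v]] assms unfolding effect_def by blast
  then show ?thesis
    by (rule power2_le_imp_le) simp
qed

text \<open>Makes the passage from T to T - T^2 repeatable; positivity of the difference is T^2
  \<le> T.\<close>

lemma effect_diff_square:
  assumes "effect T"
  shows "effect (\<lambda>v. T v - T (T v))"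
proof -
  have T: "positive_op T" using assms by (simp add: effect_def)
  have eq: "cinner v (T v - T (T v)) = cinner v (T v) - of_real ((norm (T v))\<^sup>2)" for v
    by (simp add: cinner_diff_right positive_op_selfadjoint[OF T, of v "T v"] cinner_self)
  have "bounded_clinear (\<lambda>v. T v - T (T v))"
    using bounded_clinear_diff[OF positive_opD(1)[OF T]
        bounded_clinear_compose[OF positive_opD(1)[OF T] positive_opD(1)[OF T]]]
    by (simp add: o_def)
  then have "positive_op (\<lambda>v. T v - T (T v))"
    using effect_norm_power2_le[OF assms] positive_opD(3)[OF T]
    by (simp add: positive_op_def complex_nonneg_Reals_iff eq)
  moreover have "Re (cinner v (T v - T (T v))) \<le> (norm v)\<^sup>2" for v
  proof -
    have "Re (cinner v (T v)) \<le> (norm v)\<^sup>2" using assms by (simp add: effect_def)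
    moreover have "Re (cinner v (T v - T (T v))) = Re (cinner v (T v)) - (norm (T v))\<^sup>2"
      by (simp add: eq)
    moreover have "0 \<le> (norm (T v))\<^sup>2" by (rule zero_le_power2)
    ultimately show ?thesis by linarith
  qed
  ultimately show ?thesis
    by (simp add: effect_def)
qed

text \<open>Riesz's device replaces the square root of \<open>M\<close>: with \<open>M\<^sub>0 = M\<close> and
  \<open>M\<^sub>k\<^sub>+\<^sub>1 = M\<^sub>k - M\<^sub>k\<^sup>2\<close> one has \<open>M = M\<^sub>0\<^sup>2 + \<dots> + M\<^sub>n\<^sub>-\<^sub>1\<^sup>2 + M\<^sub>n\<close> and \<open>M\<^sub>n \<rightarrow> 0\<close> strongly.\<close>

lemma tr_effect_compose_nonneg:
  assumes "effect M" "trace_class W" "positive_op W"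
  shows "tr (M \<circ> W) \<in> \<real>\<^sub>\<ge>\<^sub>0"
proof -
  define E :: "nat \<Rightarrow> 'a \<Rightarrow> 'a" where "E = rec_nat M (\<lambda>_ T v. T v - T (T v))"
  have E0: "E 0 = M" and ES: "E (Suc n) = (\<lambda>v. E n v - E n (E n v))" for n
    by (simp_all add: E_def)
  have eff: "effect (E n)" for n
    by (induction n) (simp_all add: E0 ES assms(1) effect_diff_square)
  then have pos: "positive_op (E n)" for n
    by (simp add: effect_def)
  note lin = positive_opD(1)[OF pos]
  have sq_lin: "bounded_clinear (E n \<circ> E n)" for n
    by (rule bounded_clinear_compose[OF lin lin])
  have decomp: "M v = E n v + (\<Sum>k<n. E k (E k v))" for n v
    by (induction n) (simp_all add: E0 ES)
  have E_lim: "(\<lambda>n. E n v) \<longlonglongrightarrow> 0" for v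
  proof -
    \<comment> \<open>The decomposition read as quadratic forms: the squared norms have partial sums
      bounded by <v, M v>, hence tend to 0.\<close>
    have "(\<Sum>k<n. (norm (E k v))\<^sup>2) = Re (cinner v (M v)) - Re (cinner v (E n v))" for n
    proof -
      have "cinner v (E k (E k v)) = of_real ((norm (E k v))\<^sup>2)" for k
        by (simp add: positive_op_selfadjoint[OF pos, of v k] cinner_self)
      then show ?thesis
        using arg_cong[OF decomp[of v n], of "\<lambda>w. Re (cinner v w)"]
        by (simp add: cinner_add_right cinner_sum_right)
    qed
    then have "(\<Sum>k<n. (norm (E k v))\<^sup>2) \<le> Re (cinner v (M v))" for n
      using positive_opD(2)[OF pos, of v n] by simp
    then have "summable (\<lambda>k. (norm (E k v))\<^sup>2)"
      by (intro summableI_nonneg_bounded) auto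
    then have "(\<lambda>k. (norm (E k v))\<^sup>2) \<longlonglongrightarrow> 0"
      by (rule summable_LIMSEQ_zero)
    then have "(\<lambda>k. norm (E k v)) \<longlonglongrightarrow> 0"
      using tendsto_real_sqrt by fastforce
    then show ?thesis
      by (rule tendsto_norm_zero_cancel)
  qed
  obtain a b where W: "nuclear_rep a b W"
    using assms(2) unfolding trace_class_iff_nuclear_rep by blast
  \<comment> \<open>Cyclicity for the self-adjoint factor \<open>E k\<close>: both traces are the
    sum of <E b_n, E a_n>, and E W E inherits positivity from \<open>W\<close>.\<close>
  have sq: "tr (E k \<circ> E k \<circ> W) \<in> \<real>\<^sub>\<ge>\<^sub>0" for k
  proof -
    have "nuclear_rep (E k \<circ> a) (E k \<circ> b) (E k \<circ> W \<circ> E k)"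
      by (rule nuclear_rep_compose_right[OF nuclear_rep_compose[OF W lin] lin
            positive_op_selfadjoint[OF pos]])
    then have "(\<lambda>n. cinner (E k (b n)) (E k (a n))) sums tr (E k \<circ> W \<circ> E k)"
      and tc: "trace_class (E k \<circ> W \<circ> E k)"
      using tr_nuclear_rep trace_class_iff_nuclear_rep by fastforce+
    moreover have "(\<lambda>n. cinner (b n) (E k (E k (a n)))) sums tr (E k \<circ> E k \<circ> W)"
      using tr_nuclear_rep[OF nuclear_rep_compose[OF W sq_lin]] by simp
    ultimately have "tr (E k \<circ> E k \<circ> W) = tr (E k \<circ> W \<circ> E k)"
      using sums_unique2 by (simp add: positive_op_selfadjoint[OF pos])
    moreover have "tr (E k \<circ> W \<circ> E k) \<in> \<real>\<^sub>\<ge>\<^sub>0"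
      using assms(3) by (intro tr_nonneg[OF tc]) (simp add: positive_op_selfadjoint[OF pos] positive_op_def)
    ultimately show ?thesis by simp
  qed
  have tcE: "trace_class (N \<circ> W)" if "bounded_clinear N" for N
    using assms(2) that by (rule trace_class_compose)
  have "tr (M \<circ> W) - tr (E n \<circ> W) = (\<Sum>k<n. tr (E k \<circ> E k \<circ> W))" for n
  proof -
    have "M \<circ> W = (\<lambda>v. (E n \<circ> W) v + (\<Sum>k<n. (E k \<circ> E k \<circ> W) v))"
      by (simp add: fun_eq_iff decomp[of _ n])
    then have "tr (M \<circ> W) = tr (E n \<circ> W) + (\<Sum>k<n. tr (E k \<circ> E k \<circ> W))"
      using tcE[OF lin] tcE[OF sq_lin] by (simp only: tr_add trace_class_sum tr_sum)
    then show ?thesis by simp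
  qed
  then have "tr (M \<circ> W) - tr (E n \<circ> W) \<in> \<real>\<^sub>\<ge>\<^sub>0" for n
    using sq by (simp add: complex_nonneg_Reals_iff sum_nonneg)
  moreover have "(\<lambda>n. tr (E n \<circ> W)) \<longlonglongrightarrow> tr ((\<lambda>v. 0) \<circ> W)"
  proof (rule tr_compose_tendsto[OF assms(2) lin])
    show "bounded_clinear (\<lambda>v. 0)" by (simp add: bounded_clinear_def)
    show "(\<lambda>n. cinner u (E n v)) \<longlonglongrightarrow> cinner u 0" for u v
      by (intro tendsto_intros E_lim)
  qed (rule effect_norm_le[OF eff])
  then have "(\<lambda>n. tr (M \<circ> W) - tr (E n \<circ> W)) \<longlonglongrightarrow> tr (M \<circ> W)"
    using tendsto_diff[OF tendsto_const] by (fastforce simp: o_def tr_zero)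
  ultimately show ?thesis
    by (rule closed_sequentially[OF closed_nonneg_Reals_complex])
qed

lemma tr_compose_adjoint:
  assumes "trace_class T" and adj: "\<And>u v. cinner u (T' v) = cinner (T u) v" and "positive_op M"
  shows "tr (M \<circ> T') = cnj (tr (M \<circ> T))" "trace_class T'"
proof -
  obtain a b where T: "nuclear_rep a b T"
    using assms(1) unfolding trace_class_iff_nuclear_rep by blast
  have "T' = (\<lambda>v. \<Sum>n. cinner (a n) v *\<^sub>C b n)"
    using nuclear_rep_adjoint(2)[OF T] adj by (intro ext cinner_right_eqI) simp
  then have T': "nuclear_rep b a T'"
    using nuclear_rep_adjoint(1)[OF T] by simp
  then show "trace_class T'"
    unfolding trace_class_iff_nuclear_rep by blast
  have "cinner (a n) (M (b n)) = cnj (cinner (b n) (M (a n)))" for n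
    by (metis positive_op_selfadjoint[OF assms(3)] cinner_commute)
  then have "(\<lambda>n. cnj (cinner (b n) (M (a n)))) sums tr (M \<circ> T')"
    using tr_nuclear_rep[OF nuclear_rep_compose[OF T' positive_opD(1)[OF assms(3)]]] by simp
  moreover have "(\<lambda>n. cnj (cinner (b n) (M (a n)))) sums cnj (tr (M \<circ> T))"
    using tr_nuclear_rep[OF nuclear_rep_compose[OF T positive_opD(1)[OF assms(3)]]]
    by (simp add: sums_cnj)
  ultimately show "tr (M \<circ> T') = cnj (tr (M \<circ> T))"
    by (rule sums_unique2)
qed

lemma trace_class_adjoint:
  assumes "trace_class T"
  obtains T' where "trace_class T'" "\<And>u v. cinner u (T' v) = cinner (T u) v"
proof -
  obtain a b where T: "nuclear_rep a b T"
    using assms unfolding trace_class_iff_nuclear_rep by blast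
  show ?thesis
  proof (rule that)
    show "trace_class (\<lambda>v. \<Sum>n. cinner (a n) v *\<^sub>C b n)"
      using nuclear_rep_adjoint(1)[OF T] unfolding trace_class_iff_nuclear_rep by blast
  qed (rule nuclear_rep_adjoint(2)[OF T])
qed

section \<open>Quantum probability measures\<close>

text \<open>Countable additivity in \<open>qpm\<close> is postulated for quadratic forms only; this
  identity transfers it to all matrix elements.\<close>

lemma cinner_polarization:
  assumes "bounded_clinear T"
  shows "4 * cinner u (T v) = cinner (u + v) (T (u + v)) - cinner (u - v) (T (u - v))
    - \<i> * cinner (u + \<i> *\<^sub>C v) (T (u + \<i> *\<^sub>C v)) + \<i> * cinner (u - \<i> *\<^sub>C v) (T (u - \<i> *\<^sub>C v))"
  by (simp add: bounded_clinearD[OF assms] cinner_simps algebra_simps)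

lemma binary_sequence_sums: "(\<lambda>n::nat. if n = 0 then x else if n = 1 then y else 0) sums (x + y :: complex)"
  using sums_finite[of "{0,1::nat}" "\<lambda>n. if n = 0 then x else if n = 1 then y else 0"] by simp

locale quantum_measure =
  fixes M :: "(complex^'m) set \<Rightarrow> 'h \<Rightarrow> 'h::complex_hilbert"
  assumes qpm: "qpm M"
begin

lemma positive: "E \<in> sets borel \<Longrightarrow> positive_op (M E)"
  using qpm by (simp add: qpm_def)

lemma lin: "E \<in> sets borel \<Longrightarrow> bounded_clinear (M E)"
  by (rule positive_opD(1)[OF positive])

lemma M_UNIV: "M UNIV = id"
  using qpm by (simp add: qpm_def)

lemma sums_quadratic_form:
  assumes "range A \<subseteq> sets borel" "disjoint_family (A :: nat \<Rightarrow> _)"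
  shows "(\<lambda>n. cinner v (M (A n) v)) sums cinner v (M (\<Union>n. A n) v)"
  using qpm assms unfolding qpm_def by blast

lemma sums_cinner:
  assumes "range A \<subseteq> sets borel" "disjoint_family (A :: nat \<Rightarrow> _)"
  shows "(\<lambda>n. cinner u (M (A n) v)) sums cinner u (M (\<Union>n. A n) v)"
proof -
  note s = sums_quadratic_form[OF assms]
  have A: "A n \<in> sets borel" and UA: "(\<Union>n. A n) \<in> sets borel" for n
    using assms(1) by auto
  have "(\<lambda>n. 4 * cinner u (M (A n) v)) sums (4 * cinner u (M (\<Union>n. A n) v))"
    unfolding cinner_polarization[OF lin[OF A]] cinner_polarization[OF lin[OF UA]]
    by (intro sums_add sums_diff sums_mult s)
  from sums_mult[OF this, of "1/4"] show ?thesis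
    by simp
qed

text \<open>Additivity over a sequence of empty sets makes a constant series converge, so its terms
  are 0.\<close>

lemma M_empty: "M {} v = 0"
proof (rule cinner_right_eqI)
  fix u
  have "(\<lambda>n::nat. cinner u (M {} v)) sums cinner u (M {} v)"
    using sums_cinner[of "\<lambda>_. {}" u v] by (simp add: disjoint_family_on_def)
  then have "(\<lambda>n::nat. cinner u (M {} v)) \<longlonglongrightarrow> 0"
    by (intro summable_LIMSEQ_zero sums_summable)
  then show "cinner u (M {} v) = cinner u 0"
    by (simp add: LIMSEQ_const_iff)
qed

lemma M_Un:
  assumes "E \<in> sets borel" "F \<in> sets borel" "E \<inter> F = {}"
  shows "M (E \<union> F) v = M E v + M F v"
proof (rule cinner_right_eqI)
  fix u
  define A :: "nat \<Rightarrow> _" where "A n = (if n = 0 then E else if n = 1 then F else {})" for n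
  have U: "(\<Union>n. A n) = E \<union> F"
    by (auto simp: A_def split: if_splits)
  have "(\<lambda>n. cinner u (M (A n) v)) sums cinner u (M (E \<union> F) v)"
    unfolding U[symmetric]
    by (rule sums_cinner) (use assms in \<open>auto simp: A_def disjoint_family_on_def\<close>)
  moreover have "(\<lambda>n. cinner u (M (A n) v)) = (\<lambda>n. if n = 0 then cinner u (M E v)
      else if n = 1 then cinner u (M F v) else 0)"
    by (simp add: A_def M_empty fun_eq_iff)
  ultimately show "cinner u (M (E \<union> F) v) = cinner u (M E v + M F v)"
    using sums_unique2[OF _ binary_sequence_sums] by (simp add: cinner_add_right)
qed

lemma M_finite_UN:
  assumes "finite I" "\<And>i. i \<in> I \<Longrightarrow> A i \<in> sets borel" "disjoint_family_on A I"
  shows "M (\<Union>i\<in>I. A i) v = (\<Sum>i\<in>I. M (A i) v)"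
  using assms
proof (induction I rule: finite_induct)
  case empty
  then show ?case by (simp add: M_empty)
next
  case (insert i I)
  have "M (A i \<union> (\<Union>i\<in>I. A i)) v = M (A i) v + M (\<Union>i\<in>I. A i) v"
    using insert.prems insert.hyps by (intro M_Un sets.finite_UN) (auto simp: disjoint_family_on_def)
  moreover have "disjoint_family_on A I"
    using insert.prems(2) by (auto simp: disjoint_family_on_def)
  ultimately show ?case
    using insert by simp
qed

lemma effect_M:
  assumes "E \<in> sets borel"
  shows "effect (M E)"
  unfolding effect_def
proof (intro conjI allI positive assms)
  fix v
  have "v = M E v + M (- E) v"
    using M_Un[of E "- E" v] assms by (simp add: M_UNIV borel_comp)
  then have "cinner v v = cinner v (M E v) + cinner v (M (- E) v)"
    by (metis cinner_add_right)
  moreover have "0 \<le> Re (cinner v (M (- E) v))"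
    by (intro positive_opD(2) positive borel_comp assms)
  ultimately show "Re (cinner v (M E v)) \<le> (norm v)\<^sup>2"
    by (simp add: cinner_self)
      (metis Re_complex_of_real add.commute le_add_same_cancel1 of_real_power plus_complex.sel(1))
qed

text \<open>Finite additivity on the partial unions, followed by a limit: the operators of the
  partial unions converge weakly by additivity of the matrix elements and are contractions, being
  effects.\<close>

lemma sums_tr:
  assumes "range A \<subseteq> sets borel" "disjoint_family (A :: nat \<Rightarrow> _)" "trace_class T"
  shows "(\<lambda>n. tr (M (A n) \<circ> T)) sums tr (M (\<Union>n. A n) \<circ> T)"
proof -
  have A: "A n \<in> sets borel" for n
    using assms(1) by auto
  have dis: "disjoint_family_on A I" for I
    using assms(2) by (auto simp: disjoint_family_on_def)
  have fin: "M (\<Union>i<n. A i) v = (\<Sum>i<n. M (A i) v)" for n v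
    using M_finite_UN[of "{..<n}" A v] A dis by simp
  have UA: "(\<Union>i<n. A i) \<in> sets borel" for n
    using A by auto
  have "tr (M (\<Union>i<n. A i) \<circ> T) = (\<Sum>i<n. tr (M (A i) \<circ> T))" for n
  proof -
    have "M (\<Union>i<n. A i) \<circ> T = (\<lambda>v. \<Sum>i<n. (M (A i) \<circ> T) v)"
      by (simp add: fin fun_eq_iff)
    then show ?thesis
      using trace_class_compose[OF assms(3) lin[OF A]] by (simp only: tr_sum)
  qed
  moreover have "(\<lambda>n. tr (M (\<Union>i<n. A i) \<circ> T)) \<longlonglongrightarrow> tr (M (\<Union>n. A n) \<circ> T)"
  proof (rule tr_compose_tendsto[OF assms(3) lin[OF UA]])
    show "bounded_clinear (M (\<Union>n. A n))"
      using A by (intro lin) auto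
    show "(\<lambda>n. cinner u (M (\<Union>i<n. A i) v)) \<longlonglongrightarrow> cinner u (M (\<Union>n. A n) v)" for u v
      using sums_cinner[OF assms(1,2), of u v] by (simp add: sums_def fin cinner_sum_right)
  qed (rule effect_norm_le[OF effect_M[OF UA]])
  ultimately show ?thesis
    by (simp add: sums_def)
qed

lemma tr_state_nonneg:
  assumes "positive_op \<rho>" "trace_class \<rho>" "E \<in> sets borel"
  shows "tr (M E \<circ> \<rho>) = of_real (Re (tr (M E \<circ> \<rho>)))" "0 \<le> Re (tr (M E \<circ> \<rho>))"
  using tr_effect_compose_nonneg[OF effect_M[OF assms(3)] assms(2,1)]
  by (simp_all add: complex_nonneg_Reals_iff complex_eq_iff)

lemma sets_outcome [simp, measurable_cong]: "sets (outcome M \<rho>) = sets borel"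
  by (simp add: outcome_def sets.sigma_sets_eq[of borel, simplified])

lemma space_outcome [simp]: "space (outcome M \<rho>) = UNIV"
  by (simp add: outcome_def)

text \<open>\<open>measure_of\<close> takes the values of the given set function only if that is a
  measure. Nonnegativity comes from \<open>tr_effect_compose_nonneg\<close>, countable additivity
  from \<open>sums_tr\<close>.\<close>

lemma emeasure_outcome:
  assumes "positive_op \<rho>" "trace_class \<rho>" "E \<in> sets borel"
  shows "emeasure (outcome M \<rho>) E = ennreal (Re (tr (M E \<circ> \<rho>)))"
proof (rule emeasure_measure_of[OF outcome_def])
  note nonneg = tr_state_nonneg(2)[OF assms(1,2)]
  show "positive (sets (outcome M \<rho>)) (\<lambda>E. ennreal (Re (tr (M E \<circ> \<rho>))))"
    by (simp add: positive_def M_empty o_def tr_zero)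
  show "countably_additive (sets (outcome M \<rho>)) (\<lambda>E. ennreal (Re (tr (M E \<circ> \<rho>))))"
    unfolding sets_outcome
  proof (rule countably_additiveI)
    fix A :: "nat \<Rightarrow> (complex^'m) set"
    assume A: "range A \<subseteq> sets borel" "disjoint_family A"
    have "(\<lambda>n. Re (tr (M (A n) \<circ> \<rho>))) sums Re (tr (M (\<Union>n. A n) \<circ> \<rho>))"
      by (rule sums_Re[OF sums_tr[OF A assms(2)]])
    moreover have "0 \<le> Re (tr (M (A n) \<circ> \<rho>))" for n
      using A by (intro nonneg) auto
    ultimately show "(\<Sum>n. ennreal (Re (tr (M (A n) \<circ> \<rho>)))) = ennreal (Re (tr (M (\<Union>n. A n) \<circ> \<rho>)))"
      by (simp add: suminf_ennreal2 sums_iff)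
  qed
qed (use assms in auto)

lemma finite_measure_outcome:
  assumes "positive_op \<rho>" "trace_class \<rho>"
  shows "finite_measure (outcome M \<rho>)"
  by (rule finite_measureI) (simp add: emeasure_outcome[OF assms])

lemma measure_outcome:
  assumes "positive_op \<rho>" "trace_class \<rho>" "E \<in> sets borel"
  shows "of_real (measure (outcome M \<rho>) E) = tr (M E \<circ> \<rho>)"
  using tr_state_nonneg[OF assms] by (simp add: measure_def emeasure_outcome[OF assms])

end

text \<open>The Cauchy--Schwarz inequality for a quantum probability measure with finitely many results:
  expand \<open>\<Sum>\<^sub>w Tr N\<^sub>w (y\<^sup>* - z\<^sub>w) \<rho> (y - z\<^sub>w\<^sup>*) \<ge> 0\<close> with \<open>W = y\<^sup>* \<rho> y\<close> and \<open>A = y\<^sup>* \<rho>\<close>.\<close>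

lemma finite_partition_inequality:
  assumes "finite I" and N: "\<And>w. w \<in> I \<Longrightarrow> effect (N w)" and N1: "\<And>v. (\<Sum>w\<in>I. N w v) = v"
    and W: "trace_class W" "\<And>u. Im (cinner u (W u)) = 0"
    and A: "trace_class A" and \<rho>: "trace_class \<rho>" "positive_op \<rho>"
    and pos: "\<And>z u. 0 \<le> Re (cinner u (W u)) - 2 * Re (cnj z * cinner u (A u)) + (cmod z)\<^sup>2 * Re (cinner u (\<rho> u))"
  shows "2 * Re (\<Sum>w\<in>I. cnj (z w) * tr (N w \<circ> A))
    \<le> Re (tr W) + (\<Sum>w\<in>I. (cmod (z w))\<^sup>2 * Re (tr (N w \<circ> \<rho>)))"
proof -
  obtain A' where A': "trace_class A'" and adj: "\<And>u v. cinner u (A' v) = cinner (A u) v"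
    using trace_class_adjoint[OF A] by blast
  have w: "0 \<le> Re (tr (N w \<circ> W)) - 2 * Re (cnj (z w) * tr (N w \<circ> A)) + (cmod (z w))\<^sup>2 * Re (tr (N w \<circ> \<rho>))"
    if "w \<in> I" for w
  proof -
    have pN: "positive_op (N w)" and cN: "bounded_clinear (N w)"
      using N[OF that] positive_opD(1) by (auto simp: effect_def)
    let ?z = "z w"
    \<comment> \<open>With \<open>A'\<close> in the role of \<rho> y this is (y^* - z) \<rho> (y -
      cnj z) multiplied out. Each summand is trace class, although y may be unbounded.\<close>
    let ?V = "\<lambda>v. (W v + (- cnj ?z) *\<^sub>C A v) + ((- ?z) *\<^sub>C A' v + of_real ((cmod ?z)\<^sup>2) *\<^sub>C \<rho> v)"
    have tV: "trace_class ?V"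
      by (intro trace_class_add trace_class_scaleC W A A' \<rho>)
    have "cinner u (?V u) \<in> \<real>\<^sub>\<ge>\<^sub>0" for u
    proof -
      have "cinner (A u) u = cnj (cinner u (A u))"
        by (rule cinner_commute)
      then have "cinner u (?V u) = cinner u (W u) - (cnj ?z * cinner u (A u) + cnj (cnj ?z * cinner u (A u)))
          + of_real ((cmod ?z)\<^sup>2) * cinner u (\<rho> u)"
        by (simp add: cinner_add_right cinner_scaleC_right adj)
      also have "cnj ?z * cinner u (A u) + cnj (cnj ?z * cinner u (A u))
          = of_real (2 * Re (cnj ?z * cinner u (A u)))"
        by (rule complex_add_cnj)
      finally show ?thesis
        using pos[of u ?z] positive_opD(3)[OF \<rho>(2), of u] W(2)[of u]
        by (simp add: complex_nonneg_Reals_iff del: of_real_power)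
    qed
    then have "positive_op ?V"
      using trace_class_bounded_clinear[OF tV] by (simp add: positive_op_def)
    then have nonneg: "tr (N w \<circ> ?V) \<in> \<real>\<^sub>\<ge>\<^sub>0"
      by (rule tr_effect_compose_nonneg[OF N[OF that] tV])
    have expand: "tr (N w \<circ> ?V) = (tr (N w \<circ> W) + (- cnj ?z) * tr (N w \<circ> A))
        + ((- ?z) * tr (N w \<circ> A') + of_real ((cmod ?z)\<^sup>2) * tr (N w \<circ> \<rho>))"
    proof -
      have "N w \<circ> ?V = (\<lambda>v. ((N w \<circ> W) v + (- cnj ?z) *\<^sub>C (N w \<circ> A) v)
          + ((- ?z) *\<^sub>C (N w \<circ> A') v + of_real ((cmod ?z)\<^sup>2) *\<^sub>C (N w \<circ> \<rho>) v))"
        by (simp only: fun_eq_iff o_def bounded_clinearD[OF cN]) simp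
      then show ?thesis
        using W A A' \<rho> cN by (simp only: tr_add tr_scaleC trace_class_add trace_class_scaleC trace_class_compose)
    qed
    have adj_tr: "tr (N w \<circ> A') = cnj (tr (N w \<circ> A))"
      by (rule tr_compose_adjoint(1)[OF A adj pN])
    have "0 \<le> Re (tr (N w \<circ> ?V))"
      using nonneg by (simp only: complex_nonneg_Reals_iff)
    then show ?thesis
      unfolding expand adj_tr by (simp add: algebra_simps del: of_real_power)
  qed
  have "tr W = (\<Sum>w\<in>I. tr (N w \<circ> W))"
  proof -
    have "W = (\<lambda>v. \<Sum>w\<in>I. (N w \<circ> W) v)"
      by (simp add: N1)
    moreover have "tr (\<lambda>v. \<Sum>w\<in>I. (N w \<circ> W) v) = (\<Sum>w\<in>I. tr (N w \<circ> W))"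
      using N by (intro tr_sum trace_class_compose W positive_opD(1)) (simp add: effect_def)
    ultimately show ?thesis by simp
  qed
  moreover have "0 \<le> (\<Sum>w\<in>I. Re (tr (N w \<circ> W)) - 2 * Re (cnj (z w) * tr (N w \<circ> A))
      + (cmod (z w))\<^sup>2 * Re (tr (N w \<circ> \<rho>)))"
    by (intro sum_nonneg w)
  ultimately show ?thesis
    by (simp only: sum.distrib sum_subtractf Re_sum sum_distrib_left) 
qed

section \<open>Approximation by results with finitely many values\<close>

lemma integral_finite_range:
  fixes \<phi> :: "'b \<Rightarrow> 'c::{banach, second_countable_topology}"
  assumes "finite_measure \<mu>" "finite (range h)" "\<And>w. h -` {w} \<in> sets \<mu>"
  shows "(LINT l|\<mu>. \<phi> (h l)) = (\<Sum>w\<in>range h. measure \<mu> (h -` {w}) *\<^sub>R \<phi> w)"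
proof -
  interpret finite_measure \<mu> by fact
  have "\<phi> (h l) = (\<Sum>w\<in>range h. indicator (h -` {w}) l *\<^sub>R \<phi> w)" for l
  proof -
    have "(\<Sum>w\<in>range h. indicator (h -` {w}) l *\<^sub>R \<phi> w) = (\<Sum>w\<in>{h l}. indicator (h -` {w}) l *\<^sub>R \<phi> w)"
      using assms(2) by (intro sum.mono_neutral_right) (auto simp: indicator_def)
    then show ?thesis by simp
  qed
  then have "(LINT l|\<mu>. \<phi> (h l)) = (LINT l|\<mu>. (\<Sum>w\<in>range h. indicator (h -` {w}) l *\<^sub>R \<phi> w))"
    by simp
  also have "\<dots> = (\<Sum>w\<in>range h. LINT l|\<mu>. indicator (h -` {w}) l *\<^sub>R \<phi> w)"
    using assms(3) by (intro Bochner_Integration.integral_sum integrable_scaleR_left integrable_real_indicator)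
      (auto simp: emeasure_eq_measure)
  also have "\<dots> = (\<Sum>w\<in>range h. measure \<mu> (h -` {w}) *\<^sub>R \<phi> w)"
    using assms(3) sets.sets_into_space[OF assms(3)]
    by (intro sum.cong refl)
      (simp add: integral_scaleR_left integrable_real_indicator emeasure_eq_measure Int_absorb2)
  finally show ?thesis .
qed

text \<open>Each coordinate is approximated on its own, so that coordinate i is dominated by 2 |l_i|
  without reference to the others: the measures that represent an integral of l_i are known to
  integrate that coordinate only. The factor 2 comes from simple functions that stay within twice
  the distance to 0.\<close>

lemma exists_simple_approximation:
  obtains h :: "nat \<Rightarrow> complex^'m \<Rightarrow> complex^'m"
  where "\<And>n. finite (range (h n))" "\<And>n w. h n -` {w} \<in> sets borel"
    "\<And>l. (\<lambda>n. h n l) \<longlonglongrightarrow> l" "\<And>n l i. cmod (h n l $ i) \<le> 2 * cmod (l $ i)"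
proof -
  have "\<forall>i. \<exists>F. (\<forall>n::nat. simple_function borel (F n)) \<and>
      (\<forall>l. (\<lambda>n. F n l) \<longlonglongrightarrow> (l::complex^'m) $ i) \<and> (\<forall>n l. cmod (F n l) \<le> 2 * cmod (l $ i))"
  proof
    fix i :: 'm
    have "(\<lambda>l::complex^'m. l $ i) \<in> borel_measurable borel"
      by (intro borel_measurable_continuous_onI continuous_intros)
    from borel_measurable_implies_sequence_metric[OF this, of 0]
    show "\<exists>F. (\<forall>n::nat. simple_function borel (F n)) \<and>
      (\<forall>l. (\<lambda>n. F n l) \<longlonglongrightarrow> (l::complex^'m) $ i) \<and> (\<forall>n l. cmod (F n l) \<le> 2 * cmod (l $ i))"
      by simp
  qed
  then obtain F where F: "\<And>i n. simple_function borel (F i n)"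
    and lim: "\<And>i l. (\<lambda>n::nat. F i n l) \<longlonglongrightarrow> (l::complex^'m) $ i"
    and le: "\<And>i n l. cmod (F i n l) \<le> 2 * cmod (l $ i)"
    by metis
  define h where "h n l = (\<chi> i. F i n l)" for n l
  have vimage: "h n -` {w} = (\<Inter>i. F i n -` {w $ i})" for n w
    by (auto simp: h_def vec_eq_iff)
  show ?thesis
  proof (rule that)
    fix n
    have "range (h n) \<subseteq> vec_lambda ` (\<Pi>\<^sub>E i\<in>UNIV. range (F i n))"
      by (auto simp: h_def)
    moreover have "finite (\<Pi>\<^sub>E i\<in>UNIV. range (F i n))"
      using F by (intro finite_PiE) (auto simp: simple_function_def)
    ultimately show "finite (range (h n))"
      using finite_subset by blast
    show "h n -` {w} \<in> sets borel" for w
    proof -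
      have "F i n -` {w $ i} \<in> sets borel" for i
        using measurable_sets_borel[OF borel_measurable_simple_function[OF F[of i n]], of "{w $ i}"] by simp
      then show ?thesis
        unfolding vimage by (intro sets.countable_INT) auto
    qed
  next
    show "(\<lambda>n. h n l) \<longlonglongrightarrow> l" for l
      by (rule vec_tendstoI) (simp add: h_def lim)
  qed (simp add: h_def le)
qed

text \<open>The sums involve \<tau> alone; the four positive measures enter only through dominated
  convergence, applied to each of them with the bound 2 |l_i|. In particular the value of the
  integral does not depend on the decomposition chosen.\<close>

lemma cmeasure_integral_simple_approximation:
  assumes "has_cmeasure_integral \<tau> (\<lambda>l. l $ i) J"
    and h: "\<And>n. finite (range (h n))" "\<And>n w. h n -` {w} \<in> sets borel"
      "\<And>l. (\<lambda>n. h n l) \<longlonglongrightarrow> l" "\<And>n l. cmod (h n l $ i) \<le> 2 * cmod (l $ i)"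
  shows "(\<lambda>n. \<Sum>w\<in>range (h n). w $ i * \<tau> (h n -` {w})) \<longlonglongrightarrow> J"
proof -
  obtain m where m: "\<And>k::nat. k < 4 \<Longrightarrow> finite_measure (m k)" "\<And>k. k < 4 \<Longrightarrow> sets (m k) = sets borel"
      "\<And>k. k < 4 \<Longrightarrow> integrable (m k) (\<lambda>l. l $ i)"
    and \<tau>: "\<And>E. E \<in> sets borel \<Longrightarrow> \<tau> E = (\<Sum>k<4. \<i> ^ k * complex_of_real (measure (m k) E))"
    and J: "J = (\<Sum>k<4. \<i> ^ k * (LINT l|m k. l $ i))"
    using assms(1) unfolding has_cmeasure_integral_def by blast
  have "(\<Sum>w\<in>range (h n). w $ i * \<tau> (h n -` {w})) = (\<Sum>k<4. \<i> ^ k * (LINT l|m k. h n l $ i))" for n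
  proof -
    have "(\<Sum>w\<in>range (h n). w $ i * \<tau> (h n -` {w}))
        = (\<Sum>k<4. \<Sum>w\<in>range (h n). \<i> ^ k * (complex_of_real (measure (m k) (h n -` {w})) * w $ i))"
      by (subst sum.swap) (simp add: \<tau>[OF h(2)] sum_distrib_left mult_ac)
    also have "\<dots> = (\<Sum>k<4. \<i> ^ k * (LINT l|m k. h n l $ i))"
      using integral_finite_range[OF m(1) h(1), where \<phi>="\<lambda>w. w $ i"] m(2) h(2)
      by (intro sum.cong refl) (simp add: scaleR_conv_of_real sum_distrib_left)
    finally show ?thesis .
  qed
  moreover have "(\<lambda>n. \<Sum>k<4. \<i> ^ k * (LINT l|m k. h n l $ i)) \<longlonglongrightarrow> J"
    unfolding J
  proof (intro tendsto_sum tendsto_mult tendsto_const)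
    fix k :: nat assume "k \<in> {..<4}"
    then have k: "k < 4" by simp
    show "(\<lambda>n. LINT l|m k. h n l $ i) \<longlonglongrightarrow> (LINT l|m k. l $ i)"
    proof (rule integral_dominated_convergence)
      show "integrable (m k) (\<lambda>l. 2 * cmod (l $ i))"
        using m(3)[OF k] by simp
      show "(\<lambda>l. l $ i) \<in> borel_measurable (m k)"
        using m(3)[OF k] by simp
      show "(\<lambda>l. h n l $ i) \<in> borel_measurable (m k)" for n
      proof -
        have "simple_function (m k) (h n)"
          using h(1,2) m(2)[OF k] sets_eq_imp_space_eq[OF m(2)[OF k]] by (simp add: simple_function_def)
        then have "simple_function (m k) (\<lambda>l. h n l $ i)"
          by (rule simple_function_compose1)
        then show ?thesis
          by (rule borel_measurable_simple_function)
      qed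
      show "AE l in m k. (\<lambda>n. h n l $ i) \<longlonglongrightarrow> l $ i"
        by (intro AE_I2 tendsto_vec_nth h(3))
      show "AE l in m k. norm (h n l $ i) \<le> 2 * cmod (l $ i)" for n
        by (intro AE_I2) (rule h(4))
    qed
  qed
  ultimately show ?thesis by simp
qed

lemma power2_sum_le: "(x + y)\<^sup>2 \<le> 2 * x\<^sup>2 + 2 * (y::real)\<^sup>2"
  using zero_le_power2[of "x - y"] by (simp add: power2_eq_square algebra_simps)

lemma le_one_add_power2: "x \<le> 1 + (x::real)\<^sup>2"
proof -
  have "2 * x \<le> 1 + x\<^sup>2"
    using zero_le_power2[of "x - 1"] by (simp add: power2_eq_square algebra_simps)
  then show ?thesis
    using zero_le_power2[of x] by linarith
qed

section \<open>Moments of the results and the information inequality\<close>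

context quantum_measure
begin

lemma continuous_measurable:
  fixes f :: "complex^'m \<Rightarrow> 'b::topological_space"
  assumes "continuous_on UNIV f"
  shows "f \<in> borel_measurable (outcome M \<rho>)"
  using borel_measurable_continuous_onI[OF assms] by (simp cong: measurable_cong_sets)

lemma component_measurable [measurable]: "(\<lambda>l. l $ i) \<in> borel_measurable (outcome M \<rho>)"
  by (intro continuous_measurable continuous_intros)

text \<open>The distribution of the results is a finite measure, and |f| \<le> 1 + |f|^2.\<close>

lemma integrable_of_power2:
  fixes f :: "complex^'m \<Rightarrow> complex"
  assumes "positive_op \<rho>" "trace_class \<rho>" "f \<in> borel_measurable (outcome M \<rho>)"
    and "integrable (outcome M \<rho>) (\<lambda>l. (cmod (f l))\<^sup>2)"
  shows "integrable (outcome M \<rho>) f"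
proof (rule Bochner_Integration.integrable_bound)
  interpret finite_measure "outcome M \<rho>"
    by (rule finite_measure_outcome[OF assms(1,2)])
  show "integrable (outcome M \<rho>) (\<lambda>l. 1 + (cmod (f l))\<^sup>2)"
    using assms(4) by simp
  show "AE l in outcome M \<rho>. norm (f l) \<le> norm (1 + (cmod (f l))\<^sup>2)"
    using le_one_add_power2 by simp
qed (rule assms)

context
  fixes \<rho> and t :: "'m \<Rightarrow> complex"
  assumes \<rho>: "positive_op \<rho>" "trace_class \<rho>"
    and sq: "\<And>i. integrable (outcome M \<rho>) (\<lambda>l. (norm (l $ i))\<^sup>2)"
begin

lemma integrable_component: "integrable (outcome M \<rho>) (\<lambda>l. l $ i)"
  by (rule integrable_of_power2[OF \<rho> component_measurable sq])

lemma integrable_deviation_power2: "integrable (outcome M \<rho>) (\<lambda>l. (cmod (l $ i - t i))\<^sup>2)"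
proof (rule Bochner_Integration.integrable_bound)
  interpret finite_measure "outcome M \<rho>"
    by (rule finite_measure_outcome[OF \<rho>])
  show "integrable (outcome M \<rho>) (\<lambda>l. 2 * (norm (l $ i))\<^sup>2 + 2 * (norm (t i))\<^sup>2)"
    using sq by simp
  have "(cmod (x - y))\<^sup>2 \<le> 2 * (cmod x)\<^sup>2 + 2 * (cmod y)\<^sup>2" for x y
    using order_trans[OF power_mono[OF norm_triangle_ineq4 norm_ge_zero] power2_sum_le] .
  then show "AE l in outcome M \<rho>. norm ((cmod (l $ i - t i))\<^sup>2)
      \<le> norm (2 * (norm (l $ i))\<^sup>2 + 2 * (norm (t i))\<^sup>2)"
    by simp
qed simp

lemma integrable_deviation_product:
  "integrable (outcome M \<rho>) (\<lambda>l. (l $ i - t i) * (cnj (l $ j) - cnj (t j)))"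
proof (rule Bochner_Integration.integrable_bound)
  show "integrable (outcome M \<rho>) (\<lambda>l. (cmod (l $ i - t i))\<^sup>2 + (cmod (l $ j - t j))\<^sup>2)"
    by (intro Bochner_Integration.integrable_add integrable_deviation_power2)
  have *: "x * y \<le> x\<^sup>2 + y\<^sup>2" if "0 \<le> x" "0 \<le> y" for x y :: real
    using zero_le_power2[of "x - y"] mult_nonneg_nonneg[OF that] unfolding power2_diff by linarith
  have "cmod ((l $ i - t i) * (cnj (l $ j) - cnj (t j))) = cmod (l $ i - t i) * cmod (l $ j - t j)" for l :: "complex^'m"
    by (simp add: norm_mult flip: complex_cnj_diff)
  then show "AE l in outcome M \<rho>. norm ((l $ i - t i) * (cnj (l $ j) - cnj (t j)))
      \<le> norm ((cmod (l $ i - t i))\<^sup>2 + (cmod (l $ j - t j))\<^sup>2)"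
    using * by simp
qed (intro continuous_measurable continuous_intros)

lemma hadj_result_cov: "hadj (result_cov M \<rho> t) = result_cov M \<rho> t"
proof -
  have "cnj (LINT l|outcome M \<rho>. (l $ j - t j) * (cnj (l $ i) - cnj (t i)))
      = (LINT l|outcome M \<rho>. (l $ i - t i) * (cnj (l $ j) - cnj (t j)))" for i j
    by (subst Bochner_Integration.integral_cnj[symmetric]) (simp add: mult.commute)
  then show ?thesis
    by (simp add: hadj_def result_cov_def vec_eq_iff)
qed

lemma result_cov_quadratic_form:
  "(\<Sum>i\<in>UNIV. \<Sum>j\<in>UNIV. cnj (v $ i) * result_cov M \<rho> t $ i $ j * v $ j)
    = of_real (LINT l|outcome M \<rho>. (cmod (\<Sum>i\<in>UNIV. cnj (v $ i) * (l $ i - t i)))\<^sup>2)"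
proof -
  have "(\<Sum>i\<in>UNIV. \<Sum>j\<in>UNIV. cnj (v $ i) * result_cov M \<rho> t $ i $ j * v $ j)
      = (LINT l|outcome M \<rho>. (\<Sum>i\<in>UNIV. \<Sum>j\<in>UNIV.
          cnj (v $ i) * ((l $ i - t i) * (cnj (l $ j) - cnj (t j))) * v $ j))"
    using integrable_deviation_product by (simp add: result_cov_def)
  also have "\<dots> = (LINT l|outcome M \<rho>. of_real ((cmod (\<Sum>i\<in>UNIV. cnj (v $ i) * (l $ i - t i)))\<^sup>2))"
  proof (intro Bochner_Integration.integral_cong refl)
    fix l
    show "(\<Sum>i\<in>UNIV. \<Sum>j\<in>UNIV. cnj (v $ i) * ((l $ i - t i) * (cnj (l $ j) - cnj (t j))) * v $ j)
        = of_real ((cmod (\<Sum>i\<in>UNIV. cnj (v $ i) * (l $ i - t i)))\<^sup>2)"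
      unfolding complex_norm_square cnj_sum sum_product by (simp add: mult_ac)
  qed
  finally show ?thesis
    by (simp only: integral_complex_of_real)
qed

end

text \<open>\<open>A\<close> may contain a multiple of \<open>\<rho>\<close> because the deviations \<open>l $ i - t i\<close> have mean \<open>0\<close>.  The integrals
  \<open>J i k\<close> come with a different decomposition for each \<open>i\<close> and \<open>k\<close>, hence the approximating sequence
  is chosen independently of the measures and dominated in each component separately.\<close>

theorem information_inequality:
  fixes d :: "'k::finite \<Rightarrow> 'h \<Rightarrow> 'h"
  assumes \<rho>: "positive_op \<rho>" "trace_class \<rho>" "tr \<rho> = 1"
    and d: "\<And>k. trace_class (d k)" "\<And>k. tr (d k) = 0"
    and W: "trace_class W" "\<And>u. Im (cinner u (W u)) = 0"
    and A: "\<And>u. A u = (\<Sum>k\<in>UNIV. \<alpha> k *\<^sub>C d k u) + c *\<^sub>C \<rho> u"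
    and pos: "\<And>z u. 0 \<le> Re (cinner u (W u)) - 2 * Re (cnj z * cinner u (A u)) + (cmod z)\<^sup>2 * Re (cinner u (\<rho> u))"
    and J: "\<And>i k. has_cmeasure_integral (\<lambda>E. tr (M E \<circ> d k)) (\<lambda>l. l $ i) (J i k)"
    and sq: "\<And>i. integrable (outcome M \<rho>) (\<lambda>l. (norm (l $ i))\<^sup>2)"
    and mean: "\<And>i. (LINT l|outcome M \<rho>. l $ i) = t i"
  shows "2 * Re (\<Sum>k\<in>UNIV. \<alpha> k * (\<Sum>i\<in>UNIV. cnj (v $ i) * J i k))
    \<le> Re (tr W) + (LINT l|outcome M \<rho>. (cmod (\<Sum>i\<in>UNIV. cnj (v $ i) * (l $ i - t i)))\<^sup>2)"
proof -
  let ?P = "outcome M \<rho>"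
  define g :: "complex^'m \<Rightarrow> complex" where "g w = (\<Sum>i\<in>UNIV. cnj (v $ i) * (w $ i - t i))" for w
  interpret P: finite_measure ?P
    by (rule finite_measure_outcome[OF \<rho>(1,2)])
  obtain h :: "nat \<Rightarrow> complex^'m \<Rightarrow> complex^'m" where fin: "\<And>n. finite (range (h n))"
    and vim: "\<And>n w. h n -` {w} \<in> sets borel" and lim: "\<And>l. (\<lambda>n. h n l) \<longlonglongrightarrow> l"
    and le: "\<And>n l i. cmod (h n l $ i) \<le> 2 * cmod (l $ i)"
    using exists_simple_approximation by blast
  have part: "(\<Sum>w\<in>range (h n). M (h n -` {w}) u) = u" for n u
  proof -
    have "(\<Union>w\<in>range (h n). h n -` {w}) = UNIV"
      by auto
    moreover have "M (\<Union>w\<in>range (h n). h n -` {w}) u = (\<Sum>w\<in>range (h n). M (h n -` {w}) u)"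
      by (rule M_finite_UN[OF fin vim]) (auto simp: disjoint_family_on_def)
    ultimately show ?thesis
      by (simp add: M_UNIV)
  qed
  have tA: "trace_class A"
  proof -
    have "trace_class (\<lambda>u. (\<Sum>k\<in>UNIV. \<alpha> k *\<^sub>C d k u) + c *\<^sub>C \<rho> u)"
      by (intro trace_class_add trace_class_sum trace_class_scaleC d \<rho>)
    then show ?thesis
      by (simp add: A[symmetric])
  qed
  have trA: "tr (M E \<circ> A) = (\<Sum>k\<in>UNIV. \<alpha> k * tr (M E \<circ> d k)) + c * tr (M E \<circ> \<rho>)"
    if E: "E \<in> sets borel" for E
  proof -
    have "M E \<circ> A = (\<lambda>u. (\<Sum>k\<in>UNIV. \<alpha> k *\<^sub>C (M E \<circ> d k) u) + c *\<^sub>C (M E \<circ> \<rho>) u)"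
      by (simp add: fun_eq_iff A bounded_clinearD[OF lin[OF E]])
    moreover have "trace_class (M E \<circ> d k)" "trace_class (M E \<circ> \<rho>)" for k
      using trace_class_compose[OF _ lin[OF E]] d(1) \<rho>(2) by blast+
    ultimately show ?thesis
      by (simp only: tr_add tr_sum tr_scaleC trace_class_scaleC trace_class_sum)
  qed
  \<comment> \<open>The two parts have limits of different kinds: the first through the complex
    measures Tr M d_k, the second, which has to vanish, through the distribution of the
    results.\<close>
  define L where "L n = (\<Sum>k\<in>UNIV. \<alpha> k * (\<Sum>w\<in>range (h n). g w * tr (M (h n -` {w}) \<circ> d k)))
      + c * (LINT l|?P. g (h n l))" for n
  have ineq: "2 * Re (L n) \<le> Re (tr W) + (LINT l|?P. (cmod (g (h n l)))\<^sup>2)" for n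
  proof -
    \<comment> \<open>The partition inequality is used with z_w = cnj (g w), which it conjugates
      once more.\<close>
    have a: "2 * Re (\<Sum>w\<in>range (h n). cnj (cnj (g w)) * tr (M (h n -` {w}) \<circ> A))
      \<le> Re (tr W) + (\<Sum>w\<in>range (h n). (cmod (cnj (g w)))\<^sup>2 * Re (tr (M (h n -` {w}) \<circ> \<rho>)))"
      by (rule finite_partition_inequality[OF fin effect_M[OF vim] part W tA \<rho>(2,1) pos])
    have b: "(LINT l|?P. (cmod (g (h n l)))\<^sup>2)
        = (\<Sum>w\<in>range (h n). (cmod (cnj (g w)))\<^sup>2 * Re (tr (M (h n -` {w}) \<circ> \<rho>)))"
      using integral_finite_range[OF P.finite_measure_axioms fin[of n], where \<phi>="\<lambda>w. (cmod (g w))\<^sup>2"] vim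
      by (simp add: measure_outcome[OF \<rho>(1,2) vim, symmetric] mult.commute)
    have c: "(\<Sum>w\<in>range (h n). cnj (cnj (g w)) * tr (M (h n -` {w}) \<circ> A)) = L n"
    proof -
      have "(LINT l|?P. g (h n l)) = (\<Sum>w\<in>range (h n). g w * tr (M (h n -` {w}) \<circ> \<rho>))"
        using integral_finite_range[OF P.finite_measure_axioms fin[of n], where \<phi>=g] vim
        by (simp add: measure_outcome[OF \<rho>(1,2) vim, symmetric] scaleR_conv_of_real mult.commute)
      then show ?thesis
        unfolding L_def trA[OF vim]
        by (simp add: distrib_left sum.distrib sum_distrib_left mult_ac)
          (rule sum.swap)
    qed
    show ?thesis
      using a unfolding b c .
  qed
  have Lk: "(\<lambda>n. \<Sum>w\<in>range (h n). g w * tr (M (h n -` {w}) \<circ> d k)) \<longlonglongrightarrow> (\<Sum>i\<in>UNIV. cnj (v $ i) * J i k)" for k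
  proof -
    have "(\<Sum>w\<in>range (h n). g w * tr (M (h n -` {w}) \<circ> d k))
        = (\<Sum>i\<in>UNIV. cnj (v $ i) * (\<Sum>w\<in>range (h n). w $ i * tr (M (h n -` {w}) \<circ> d k)))" for n
    proof -
      \<comment> \<open>The complex measure Tr M d_k has total mass Tr d_k = 0; this removes the
        constants t_i from g and leaves the coordinate integrals described by J.\<close>
      have "tr (d k) = tr (\<lambda>u. \<Sum>w\<in>range (h n). (M (h n -` {w}) \<circ> d k) u)"
        by (simp add: part)
      also have "\<dots> = (\<Sum>w\<in>range (h n). tr (M (h n -` {w}) \<circ> d k))"
        by (intro tr_sum trace_class_compose d lin vim)
      finally have 0: "(\<Sum>w\<in>range (h n). tr (M (h n -` {w}) \<circ> d k)) = 0"
        by (simp add: d)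
      have "(\<Sum>w\<in>range (h n). g w * tr (M (h n -` {w}) \<circ> d k))
          = (\<Sum>i\<in>UNIV. \<Sum>w\<in>range (h n). cnj (v $ i) * (w $ i - t i) * tr (M (h n -` {w}) \<circ> d k))"
        unfolding g_def sum_distrib_right by (rule sum.swap)
      also have "\<dots> = (\<Sum>i\<in>UNIV. cnj (v $ i) * (\<Sum>w\<in>range (h n). w $ i * tr (M (h n -` {w}) \<circ> d k))
          - cnj (v $ i) * t i * (\<Sum>w\<in>range (h n). tr (M (h n -` {w}) \<circ> d k)))"
        by (simp add: sum_distrib_left sum_subtractf algebra_simps)
      finally show ?thesis
        by (simp add: 0)
    qed
    moreover have "(\<lambda>n. \<Sum>w\<in>range (h n). w $ i * tr (M (h n -` {w}) \<circ> d k)) \<longlonglongrightarrow> J i k" for i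
      by (rule cmeasure_integral_simple_approximation[OF J fin vim lim le])
    ultimately show ?thesis
      by (simp add: tendsto_sum tendsto_mult)
  qed
  \<comment> \<open>\<open>CARD('m)\<close> comes from squaring a sum of that many terms, 8 and 2
    from (2 p + q)^2 \<le> 2 (2 p)^2 + 2 q^2.\<close>
  define B where "B l = real CARD('m) * (\<Sum>i\<in>UNIV. (cmod (v $ i))\<^sup>2 * (8 * (cmod (l $ i))\<^sup>2 + 2 * (cmod (t i))\<^sup>2))"
    for l :: "complex^'m"
  have int_B: "integrable ?P B"
    unfolding B_def using sq by simp
  have g_le: "(cmod (g (h n l)))\<^sup>2 \<le> B l" for n l
  proof -
    have "cmod (g (h n l)) \<le> (\<Sum>i\<in>UNIV. cmod (v $ i) * (2 * cmod (l $ i) + cmod (t i)))"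
      unfolding g_def
    proof (rule sum_norm_le)
      fix i
      have "cmod (h n l $ i - t i) \<le> 2 * cmod (l $ i) + cmod (t i)"
        using norm_triangle_ineq4[of "h n l $ i" "t i"] le[of n l i] by linarith
      then show "cmod (cnj (v $ i) * (h n l $ i - t i)) \<le> cmod (v $ i) * (2 * cmod (l $ i) + cmod (t i))"
        by (simp add: norm_mult mult_left_mono)
    qed
    then have "(cmod (g (h n l)))\<^sup>2 \<le> (\<Sum>i\<in>UNIV. cmod (v $ i) * (2 * cmod (l $ i) + cmod (t i)))\<^sup>2"
      by (rule power_mono) simp
    also have "\<dots> \<le> real CARD('m) * (\<Sum>i\<in>UNIV. (cmod (v $ i) * (2 * cmod (l $ i) + cmod (t i)))\<^sup>2)"
      using sum_squared_le_sum_of_squares[of _ UNIV] by (simp add: mult.commute)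
    also have "\<dots> \<le> B l"
      unfolding B_def
    proof (intro mult_left_mono sum_mono)
      fix i
      show "(cmod (v $ i) * (2 * cmod (l $ i) + cmod (t i)))\<^sup>2
          \<le> (cmod (v $ i))\<^sup>2 * (8 * (cmod (l $ i))\<^sup>2 + 2 * (cmod (t i))\<^sup>2)"
        using power2_sum_le[of "2 * cmod (l $ i)" "cmod (t i)"]
        unfolding power_mult_distrib by (intro mult_left_mono) simp_all
    qed simp
    finally show ?thesis .
  qed
  have g_le': "cmod (g (h n l)) \<le> 1 + B l" for n l
    using g_le[of n l] le_one_add_power2[of "cmod (g (h n l))"] by linarith
  have g_cont: "continuous_on UNIV g"
    unfolding g_def by (intro continuous_intros)
  have g_meas: "g \<in> borel_measurable ?P"
    by (rule continuous_measurable[OF g_cont])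
  have gh_meas: "(\<lambda>l. g (h n l)) \<in> borel_measurable ?P" for n
  proof -
    have "simple_function ?P (h n)"
      using fin vim by (simp add: simple_function_def)
    then have "simple_function ?P (\<lambda>l. g (h n l))"
      by (rule simple_function_compose1)
    then show ?thesis
      by (rule borel_measurable_simple_function)
  qed
  have g_lim: "(\<lambda>n. g (h n l)) \<longlonglongrightarrow> g l" for l
    using g_cont by (intro isCont_tendsto_compose[OF _ lim]) (simp add: continuous_on_eq_continuous_at)
  have "(\<lambda>n. LINT l|?P. g (h n l)) \<longlonglongrightarrow> (LINT l|?P. g l)"
  proof (rule integral_dominated_convergence[where w="\<lambda>l. 1 + B l"])
    show "AE l in ?P. norm (g (h n l)) \<le> 1 + B l" for n
      using g_le' by simp
  qed (use g_meas gh_meas int_B g_lim in simp_all)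
  moreover have "(LINT l|?P. g l) = 0"
  proof -
    have "measure ?P UNIV = 1"
      using measure_outcome[OF \<rho>(1,2), of UNIV] by (simp add: M_UNIV \<rho>(3))
    then show ?thesis
      unfolding g_def using integrable_component[OF \<rho>(1,2) sq] by (simp add: mean)
  qed
  ultimately have "L \<longlonglongrightarrow> (\<Sum>k\<in>UNIV. \<alpha> k * (\<Sum>i\<in>UNIV. cnj (v $ i) * J i k)) + c * 0"
    unfolding L_def by (intro tendsto_intros Lk) simp
  then have "(\<lambda>n. 2 * Re (L n)) \<longlonglongrightarrow> 2 * Re (\<Sum>k\<in>UNIV. \<alpha> k * (\<Sum>i\<in>UNIV. cnj (v $ i) * J i k))"
    by (intro tendsto_intros) simp
  moreover have "(\<lambda>n. Re (tr W) + (LINT l|?P. (cmod (g (h n l)))\<^sup>2)) \<longlonglongrightarrow> Re (tr W) + (LINT l|?P. (cmod (g l))\<^sup>2)"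
  proof (intro tendsto_intros integral_dominated_convergence[where w=B])
    show "AE l in ?P. norm ((cmod (g (h n l)))\<^sup>2) \<le> B l" for n
      using g_le by simp
    show "AE l in ?P. (\<lambda>n. (cmod (g (h n l)))\<^sup>2) \<longlonglongrightarrow> (cmod (g l))\<^sup>2"
      by (intro AE_I2 tendsto_intros g_lim)
  qed (use g_meas gh_meas int_B in simp_all)
  ultimately have "2 * Re (\<Sum>k\<in>UNIV. \<alpha> k * (\<Sum>i\<in>UNIV. cnj (v $ i) * J i k))
      \<le> Re (tr W) + (LINT l|?P. (cmod (g l))\<^sup>2)"
    by (rule LIMSEQ_le) (use ineq in blast)
  then show ?thesis
    unfolding g_def .
qed

end

section \<open>Unbounded operators\<close>

lemma adj_eqI:
  assumes "closure S = UNIV" "\<And>u. u \<in> S \<Longrightarrow> cinner (T u) v = cinner u w"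
  shows "adj S T v = w"
  unfolding adj_def
proof (rule the_equality)
  fix w' assume "\<forall>u\<in>S. cinner (T u) v = cinner u w'"
  then show "w' = w"
    using assms by (intro cinner_right_extensionality[OF assms(1)]) simp
qed (use assms(2) in blast)

lemma cinner_adj:
  assumes "closure S = UNIV" "v \<in> adj_dom S T" "u \<in> S"
  shows "cinner (T u) v = cinner u (adj S T v)"
proof -
  obtain w where w: "\<And>u. u \<in> S \<Longrightarrow> cinner (T u) v = cinner u w"
    using assms(2) unfolding adj_dom_def by blast
  then have "adj S T v = w"
    by (intro adj_eqI assms(1))
  then show ?thesis
    using w assms(3) by simp
qed

lemma bounded_clinear_continuous: "bounded_clinear T \<Longrightarrow> continuous_on A T"
  by (intro linear_continuous_on bounded_clinearD(7))

lemma bounded_ext_eqI: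
  assumes S: "closure S = UNIV" and B: "bounded_clinear B" "\<And>v. v \<in> S \<Longrightarrow> B v = T v"
  shows "bounded_ext S T = B"
  unfolding bounded_ext_def
proof (rule the_equality)
  fix B' assume B': "bounded_clinear B' \<and> (\<forall>v\<in>S. B' v = T v)"
  have "closed {v. B' v = B v}"
    using B' B(1) by (intro closed_Collect_eq bounded_clinear_continuous) auto
  then have "closure S \<subseteq> {v. B' v = B v}"
    using B(2) B' by (intro closure_minimal) auto
  then show "B' = B"
    using S by auto
qed (use B in blast)

lemma trace_class_bounded_ext:
  assumes "closure S = UNIV" "has_trace_class_ext S T"
  shows "trace_class (bounded_ext S T)" "v \<in> S \<Longrightarrow> bounded_ext S T v = T v"
proof -
  obtain B where B: "trace_class B" "\<And>v. v \<in> S \<Longrightarrow> B v = T v"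
    using assms(2) unfolding has_trace_class_ext_def by blast
  moreover have "bounded_ext S T = B"
    by (rule bounded_ext_eqI[OF assms(1) trace_class_bounded_clinear[OF B(1)] B(2)])
  ultimately show "trace_class (bounded_ext S T)" "v \<in> S \<Longrightarrow> bounded_ext S T v = T v"
    by auto
qed

lemma csubspace_sum: "csubspace S \<Longrightarrow> (\<And>i. i \<in> I \<Longrightarrow> f i \<in> S) \<Longrightarrow> (\<Sum>i\<in>I. f i) \<in> S"
  by (induction I rule: infinite_finite_induct) (auto simp: csubspace_def)

lemma clinear_on_sum:
  assumes "csubspace S" "clinear_on S T" "\<And>i. i \<in> I \<Longrightarrow> f i \<in> S"
  shows "T (\<Sum>i\<in>I. c i *\<^sub>C f i) = (\<Sum>i\<in>I. c i *\<^sub>C T (f i))"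
  using assms(3)
proof (induction I rule: infinite_finite_induct)
  case (insert i I)
  have "(\<Sum>i\<in>I. c i *\<^sub>C f i) \<in> S" "c i *\<^sub>C f i \<in> S"
    using insert.prems assms(1) by (auto intro!: csubspace_sum simp: csubspace_def)
  then show ?case
    using insert assms(2) by (simp add: clinear_on_def)
next
  case empty
  have "T (0 *\<^sub>C 0) = 0 *\<^sub>C T 0"
    using assms(1,2) by (simp only: clinear_on_def csubspace_def)
  then show ?case by simp
next
  case (infinite I)
  have "T (0 *\<^sub>C 0) = 0 *\<^sub>C T 0"
    using assms(1,2) by (simp only: clinear_on_def csubspace_def)
  then show ?case using infinite by simp
qed

text \<open>Powers cross the inner product one factor at a time, since invariance keeps every
  intermediate vector in \<open>S\<close>; the two exponential series are then summed separately.
  The adjoint of the exponential as an unbounded operator never has to be identified.\<close>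

lemma cinner_op_exp:
  assumes T: "\<And>u v. u \<in> S \<Longrightarrow> v \<in> S \<Longrightarrow> cinner (T u) v = cinner u (T' v)"
    and inv: "\<And>u. u \<in> S \<Longrightarrow> T u \<in> S" "\<And>u. u \<in> S \<Longrightarrow> T' u \<in> S"
    and u: "u \<in> exp_dom S T" and v: "v \<in> exp_dom S T'"
  shows "cinner (op_exp T u) v = cinner u (op_exp T' v)"
proof -
  have uS: "u \<in> S" and vS: "v \<in> S" and su: "summable (\<lambda>r. (1 / fact r) *\<^sub>R (T ^^ r) u)"
    and sv: "summable (\<lambda>r. (1 / fact r) *\<^sub>R (T' ^^ r) v)"
    using u v by (auto simp: exp_dom_def)
  have Tr: "(T ^^ r) w \<in> S" if "w \<in> S" for r w
    using that by (induction r) (auto intro: inv)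
  have pow: "cinner ((T ^^ r) u) v = cinner u ((T' ^^ r) v)" if "v \<in> S" for r v
    using that
  proof (induction r arbitrary: v)
    case (Suc r)
    have "cinner ((T ^^ Suc r) u) v = cinner ((T ^^ r) u) (T' v)"
      using T[OF Tr[OF uS] Suc.prems] by simp
    also have "\<dots> = cinner u ((T' ^^ r) (T' v))"
      by (rule Suc.IH[OF inv(2)[OF Suc.prems]])
    finally show ?case
      by (simp add: funpow_swap1)
  qed simp
  have "(\<lambda>r. cinner ((1 / fact r) *\<^sub>R (T ^^ r) u) v) sums cinner (op_exp T u) v"
    unfolding op_exp_def
    by (rule bounded_linear.sums[OF bounded_linear_cinner_left summable_sums[OF su]])
  moreover have "(\<lambda>r. cinner u ((1 / fact r) *\<^sub>R (T' ^^ r) v)) sums cinner u (op_exp T' v)"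
    unfolding op_exp_def
    by (rule bounded_linear.sums[OF bounded_linear_cinner_right summable_sums[OF sv]])
  then have "(\<lambda>r. cinner ((1 / fact r) *\<^sub>R (T ^^ r) u) v) sums cinner u (op_exp T' v)"
    by (simp add: cinner_scaleR_left cinner_scaleR_right pow[OF vS])
  ultimately show ?thesis
    by (rule sums_unique2)
qed

section \<open>The Lie series\<close>

lemma matpow_Suc: "matpow A (Suc r) = A ** matpow A r" "matpow A (Suc r) = matpow A r ** A"
proof -
  show 1: "matpow A (Suc r) = A ** matpow A r" for r
    by (simp add: matpow_def)
  show "matpow A (Suc r) = matpow A r ** A"
    by (induction r) (simp_all add: 1 matrix_mul_assoc, simp add: matpow_def)
qed

lemma matpow_0: "matpow A 0 = mat 1"
  by (simp add: matpow_def)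

text \<open>A crude bound by the sum of all moduli, enough to compare \<open>K_series\<close>
  entrywise with a scalar exponential series.\<close>

lemma cmod_matpow_le: "cmod (matpow A r $ k $ l) \<le> (\<Sum>i\<in>UNIV. \<Sum>j\<in>UNIV. cmod (A $ i $ j)) ^ r"
proof (induction r arbitrary: k)
  case 0
  then show ?case by (simp add: matpow_0 mat_def)
next
  case (Suc r)
  let ?c = "\<Sum>i\<in>UNIV. \<Sum>j\<in>UNIV. cmod (A $ i $ j)"
  have "cmod (matpow A (Suc r) $ k $ l) \<le> (\<Sum>j\<in>UNIV. cmod (A $ k $ j) * ?c ^ r)"
    unfolding matpow_Suc(1) matrix_matrix_mult_def
    by (simp, intro sum_norm_le) (simp add: norm_mult mult_left_mono Suc)
  also have "\<dots> = (\<Sum>j\<in>UNIV. cmod (A $ k $ j)) * ?c ^ r"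
    by (simp add: sum_distrib_right)
  also have "\<dots> \<le> ?c * ?c ^ r"
    using member_le_sum[of k UNIV "\<lambda>i. \<Sum>j\<in>UNIV. cmod (A $ i $ j)"]
    by (intro mult_right_mono) (auto simp: sum_nonneg)
  finally show ?case by simp
qed

lemma K_series_sums:
  "(\<lambda>r. (1 / fact (r + 1)) *\<^sub>R matpow (struct_mat C \<gamma>) r $ k $ l) sums K_series C \<gamma> $ k $ l"
proof -
  let ?f = "\<lambda>r. (1 / fact (r + 1)) *\<^sub>R matpow (struct_mat C \<gamma>) r"
  let ?c = "\<Sum>i\<in>UNIV. \<Sum>j\<in>UNIV. cmod (struct_mat C \<gamma> $ i $ j)"
  have "summable (\<lambda>r. ?f r $ k $ l)" for k l
  proof (rule summable_comparison_test_ev)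
    show "summable (\<lambda>r. inverse (fact r) * ?c ^ r)"
      by (rule summable_exp)
    have "norm (?f r $ k $ l) \<le> inverse (fact r) * ?c ^ r" for r
    proof -
      have "1 / fact (r + 1) \<le> (inverse (fact r) :: real)"
        using fact_mono[of r "r + 1", where 'a=real] by (simp add: inverse_eq_divide frac_le)
      then show ?thesis
        using mult_mono[OF _ cmod_matpow_le[of "struct_mat C \<gamma>" r k l], of "1 / fact (r + 1)" "inverse (fact r)"]
        by simp
    qed
    then show "\<forall>\<^sub>F r in sequentially. norm (?f r $ k $ l) \<le> inverse (fact r) * ?c ^ r"
      by simp
  qed
  then have s: "(\<lambda>r. ?f r $ k $ l) sums (\<Sum>r. ?f r $ k $ l)" for k l
    by (rule summable_sums)
  have "?f sums (\<chi> k l. \<Sum>r. ?f r $ k $ l)"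
    using s unfolding sums_def by (intro vec_tendstoI) simp
  then have "K_series C \<gamma> = (\<chi> k l. \<Sum>r. ?f r $ k $ l)"
    unfolding K_series_def by (rule sums_unique[symmetric])
  then show ?thesis
    using s[of k l] by simp
qed

locale lie_generators =
  fixes Dom :: "'h::complex_hilbert set"
    and x :: "'n::finite \<Rightarrow> 'h \<Rightarrow> 'h"
    and C :: "'n \<Rightarrow> 'n \<Rightarrow> 'n \<Rightarrow> complex"
  assumes Dom: "csubspace Dom" and Dom_dense: "closure Dom = UNIV"
    and x_linear: "\<And>k. clinear_on Dom (x k)"
    and x_Dom: "\<And>k v. v \<in> Dom \<Longrightarrow> x k v \<in> Dom"
    and x_adj: "\<And>k v. v \<in> Dom \<Longrightarrow> v \<in> adj_dom Dom (x k) \<and> adj Dom (x k) v \<in> Dom"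
    and commutation: "\<And>i k v. v \<in> Dom \<Longrightarrow>
          x i (x k v) - x k (x i v) = (\<Sum>j\<in>UNIV. C i k j *\<^sub>C x j v)"
begin

lemma scaleC_Dom: "v \<in> Dom \<Longrightarrow> c *\<^sub>C v \<in> Dom"
  using Dom by (simp add: csubspace_def)

lemma lincomb_Dom: "v \<in> Dom \<Longrightarrow> lincomb c x v \<in> Dom"
  unfolding lincomb_def by (intro csubspace_sum Dom scaleC_Dom x_Dom)

lemma lincomb_adj_Dom: "v \<in> Dom \<Longrightarrow> lincomb c (\<lambda>k. adj Dom (x k)) v \<in> Dom"
  unfolding lincomb_def using x_adj by (intro csubspace_sum Dom scaleC_Dom) simp

lemma cinner_x: "u \<in> Dom \<Longrightarrow> v \<in> Dom \<Longrightarrow> cinner (x k u) v = cinner u (adj Dom (x k) v)"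
  using x_adj by (intro cinner_adj[OF Dom_dense]) simp

lemma cinner_lincomb:
  "u \<in> Dom \<Longrightarrow> v \<in> Dom \<Longrightarrow>
    cinner (lincomb (vcnj c) x u) v = cinner u (lincomb c (\<lambda>k. adj Dom (x k)) v)"
  by (simp add: lincomb_def cinner_simps cinner_x vcnj_def)

lemma x_sum: "(\<And>i. i \<in> I \<Longrightarrow> f i \<in> Dom) \<Longrightarrow> x k (\<Sum>i\<in>I. c i *\<^sub>C f i) = (\<Sum>i\<in>I. c i *\<^sub>C x k (f i))"
  by (rule clinear_on_sum[OF Dom x_linear])

text \<open>The structure constants C_lj describe [x_l, x_j], whereas here x_l stands second; hence
  the sign and row l of \<open>struct_mat\<close>.\<close>

lemma commutator_lincomb:
  assumes "v \<in> Dom"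
  shows "commutator (lincomb \<gamma> x) (x l) v = - (\<Sum>m\<in>UNIV. struct_mat C \<gamma> $ l $ m *\<^sub>C x m v)"
proof -
  have "commutator (lincomb \<gamma> x) (x l) v = (\<Sum>j\<in>UNIV. \<gamma> $ j *\<^sub>C (x j (x l v) - x l (x j v)))"
    using assms by (simp add: commutator_def lincomb_def x_sum x_Dom sum_subtractf scaleC_diff_right)
  also have "\<dots> = (\<Sum>j\<in>UNIV. - (\<Sum>m\<in>UNIV. (\<gamma> $ j * C l j m) *\<^sub>C x m v))"
  proof (rule sum.cong[OF refl])
    fix j
    have "x j (x l v) - x l (x j v) = - (\<Sum>m\<in>UNIV. C l j m *\<^sub>C x m v)"
      using commutation[OF assms, of l j] by (simp add: algebra_simps)
    then show "\<gamma> $ j *\<^sub>C (x j (x l v) - x l (x j v)) = - (\<Sum>m\<in>UNIV. (\<gamma> $ j * C l j m) *\<^sub>C x m v)"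
      by (simp add: scaleC_minus_right scaleC_sum_right scaleC_scaleC)
  qed
  also have "\<dots> = - (\<Sum>m\<in>UNIV. struct_mat C \<gamma> $ l $ m *\<^sub>C x m v)"
    unfolding sum_negf struct_mat_def by (subst sum.swap) (simp add: scaleC_sum_left)
  finally show ?thesis .
qed

text \<open>On the span of the generators the commutator map acts as minus
  \<open>struct_mat\<close>, with the coefficients forming a row vector; each step therefore
  multiplies by the matrix on the right.\<close>

lemma commutator_power:
  assumes "v \<in> Dom"
  shows "(commutator (lincomb \<gamma> x) ^^ r) (x k) v
    = (-1) ^ r *\<^sub>C (\<Sum>l\<in>UNIV. matpow (struct_mat C \<gamma>) r $ k $ l *\<^sub>C x l v)"
  using assms
proof (induction r arbitrary: v)
  case 0
  have "(\<Sum>l\<in>UNIV. matpow (struct_mat C \<gamma>) 0 $ k $ l *\<^sub>C x l v) = (\<Sum>l\<in>UNIV. if l = k then x l v else 0)"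
    by (intro sum.cong refl) (simp add: matpow_0 mat_def)
  then show ?case by simp
next
  case (Suc r)
  let ?X = "lincomb \<gamma> x" and ?P = "matpow (struct_mat C \<gamma>) r"
  have X: "?X (\<Sum>l\<in>UNIV. c l *\<^sub>C x l v) = (\<Sum>l\<in>UNIV. c l *\<^sub>C ?X (x l v))" for c :: "'n \<Rightarrow> complex"
    unfolding lincomb_def using Suc.prems
    by (simp add: x_sum x_Dom scaleC_sum_right scaleC_scaleC mult.commute) (rule sum.swap)
  have X1: "?X (c *\<^sub>C w) = c *\<^sub>C ?X w" if "w \<in> Dom" for c w
    using that x_linear by (simp add: lincomb_def clinear_on_def scaleC_sum_right scaleC_scaleC mult.commute)
  have "(commutator ?X ^^ Suc r) (x k) v
      = ?X ((commutator ?X ^^ r) (x k) v) - (commutator ?X ^^ r) (x k) (?X v)"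
    by (simp add: commutator_def)
  also have "(commutator ?X ^^ r) (x k) v = (-1) ^ r *\<^sub>C (\<Sum>l\<in>UNIV. ?P $ k $ l *\<^sub>C x l v)"
    by (rule Suc.IH[OF Suc.prems])
  \<comment> \<open>The vector is generalised in the induction because the inner commutator is also
    evaluated at X v.\<close>
  also have "(commutator ?X ^^ r) (x k) (?X v) = (-1) ^ r *\<^sub>C (\<Sum>l\<in>UNIV. ?P $ k $ l *\<^sub>C x l (?X v))"
    by (rule Suc.IH[OF lincomb_Dom[OF Suc.prems]])
  also have "?X ((-1) ^ r *\<^sub>C (\<Sum>l\<in>UNIV. ?P $ k $ l *\<^sub>C x l v))
      = (-1) ^ r *\<^sub>C (\<Sum>l\<in>UNIV. ?P $ k $ l *\<^sub>C ?X (x l v))"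
    using Suc.prems by (subst X1) (auto simp: X intro!: csubspace_sum Dom scaleC_Dom x_Dom)
  also have "(-1) ^ r *\<^sub>C (\<Sum>l\<in>UNIV. ?P $ k $ l *\<^sub>C ?X (x l v))
        - (-1) ^ r *\<^sub>C (\<Sum>l\<in>UNIV. ?P $ k $ l *\<^sub>C x l (?X v))
      = (-1) ^ r *\<^sub>C (\<Sum>l\<in>UNIV. ?P $ k $ l *\<^sub>C commutator ?X (x l) v)"
    by (simp add: commutator_def scaleC_diff_right sum_subtractf)
  also have "(\<Sum>l\<in>UNIV. ?P $ k $ l *\<^sub>C commutator ?X (x l) v)
      = - (\<Sum>l\<in>UNIV. \<Sum>m\<in>UNIV. (?P $ k $ l * struct_mat C \<gamma> $ l $ m) *\<^sub>C x m v)"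
    using Suc.prems
    by (simp add: commutator_lincomb scaleC_minus_right scaleC_sum_right scaleC_scaleC sum_negf)
  also have "(\<Sum>l\<in>UNIV. \<Sum>m\<in>UNIV. (?P $ k $ l * struct_mat C \<gamma> $ l $ m) *\<^sub>C x m v)
      = (\<Sum>m\<in>UNIV. matpow (struct_mat C \<gamma>) (Suc r) $ k $ m *\<^sub>C x m v)"
    unfolding matpow_Suc(2) matrix_matrix_mult_def by (subst sum.swap) (simp add: scaleC_sum_left)
  finally show ?case
    by (simp add: scaleC_minus_right scaleC_minus_left)
qed

text \<open>The alternating signs of the Lie series cancel those of the iterated commutators, so the
  coefficients are the entries of the very matrix that \<open>K_mat\<close> inverts; this is how K
  enters the bound.\<close>

lemma lie_series_eq:
  assumes "v \<in> Dom"
  shows "lie_series (lincomb \<gamma> x) (x k) v = (\<Sum>l\<in>UNIV. K_series C \<gamma> $ k $ l *\<^sub>C x l v)"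
proof -
  have "((-1) ^ r / fact (r + 1)) *\<^sub>R (commutator (lincomb \<gamma> x) ^^ r) (x k) v
      = (\<Sum>l\<in>UNIV. ((1 / fact (r + 1)) *\<^sub>R matpow (struct_mat C \<gamma>) r $ k $ l) *\<^sub>C x l v)" for r
  proof -
    have "((-1) ^ r / fact (r + 1)) *\<^sub>R (commutator (lincomb \<gamma> x) ^^ r) (x k) v
        = (of_real ((-1) ^ r / fact (r + 1)) * (-1) ^ r) *\<^sub>C
            (\<Sum>l\<in>UNIV. matpow (struct_mat C \<gamma>) r $ k $ l *\<^sub>C x l v)"
      by (simp only: commutator_power[OF assms] scaleR_scaleC scaleC_scaleC)
    also have "of_real ((-1) ^ r / fact (r + 1)) * (-1) ^ r = complex_of_real (1 / fact (r + 1))"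
      by (simp add: power_mult_distrib[symmetric] flip: power_add mult_2)
    finally show ?thesis
      by (simp only: scaleC_sum_right scaleC_scaleC scaleR_conv_of_real)
  qed
  moreover have "(\<lambda>r. \<Sum>l\<in>UNIV. ((1 / fact (r + 1)) *\<^sub>R matpow (struct_mat C \<gamma>) r $ k $ l) *\<^sub>C x l v)
      sums (\<Sum>l\<in>UNIV. K_series C \<gamma> $ k $ l *\<^sub>C x l v)"
    by (intro sums_sum bounded_linear.sums[OF
          bounded_bilinear.bounded_linear_left[OF bounded_bilinear_scaleC]] K_series_sums)
  ultimately show ?thesis
    unfolding lie_series_def by (simp only: sums_unique[symmetric])
qed

end

section \<open>The canonical family\<close>

lemma wirtinger_cong:
  assumes "f differentiable (at \<beta>)" "open U" "\<beta> \<in> U" "\<And>b. b \<in> U \<Longrightarrow> f b = g b"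
  shows "wirtinger k f \<beta> = wirtinger k g \<beta>"
  by (simp only: wirtinger_def frechet_derivative_transform_within_open[OF assms])

lemma wirtinger_const: "wirtinger k (\<lambda>_. c) \<beta> = 0"
  by (simp add: wirtinger_def)

lemma rank_one_bounded_clinear: "bounded_clinear (\<lambda>w. cinner u w *\<^sub>C v)"
  unfolding bounded_clinear_def
  by (intro conjI allI bounded_linear_compose[OF
        bounded_bilinear.bounded_linear_left[OF bounded_bilinear_scaleC] bounded_linear_cinner_right])
    (simp add: cinner_scaleC_right scaleC_scaleC)

text \<open>Turns a matrix element into a trace against a bounded operator, the kind of functional
  of \<rho> whose derivatives in the parameters are given.\<close>

lemma tr_rank_one_compose:
  assumes "trace_class T"
  shows "tr ((\<lambda>w. cinner u w *\<^sub>C v) \<circ> T) = cinner u (T v)"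
proof -
  obtain a b where T: "nuclear_rep a b T"
    using assms unfolding trace_class_iff_nuclear_rep by blast
  have "(\<lambda>n. cinner u (a n) * cinner (b n) v) sums tr ((\<lambda>w. cinner u w *\<^sub>C v) \<circ> T)"
    using tr_nuclear_rep[OF nuclear_rep_compose[OF T rank_one_bounded_clinear[of u v]]]
    by (simp add: cinner_scaleC_right)
  moreover have "(\<lambda>n. cinner u (a n) * cinner (b n) v) sums cinner u (T v)"
    using bounded_linear.sums[OF bounded_linear_cinner_right nuclear_rep_sums[OF T, of v], of u]
    by (simp add: cinner_scaleC_right mult.commute)
  ultimately show ?thesis
    by (rule sums_unique2)
qed

locale canonical_family = lie_generators Dom x C
  for Dom :: "'h::complex_hilbert set" and x :: "'n::finite \<Rightarrow> 'h \<Rightarrow> 'h"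
    and C :: "'n \<Rightarrow> 'n \<Rightarrow> 'n \<Rightarrow> complex" +
  fixes Core :: "'h set"
    and \<rho>\<^sub>0 :: "'h \<Rightarrow> 'h"
    and U :: "(complex^'n) set"
    and d\<rho> :: "'n \<Rightarrow> complex^'n \<Rightarrow> 'h \<Rightarrow> 'h"
  assumes \<rho>\<^sub>0: "density_op \<rho>\<^sub>0"
    and U: "open U"
    and \<rho>\<^sub>0_exp_dom: "\<And>\<beta> v. \<beta> \<in> U \<Longrightarrow> v \<in> exp_gen_dom Dom x \<beta> \<Longrightarrow>
          \<rho>\<^sub>0 (exp_gen x \<beta> v) \<in> exp_dom Dom (lincomb \<beta> (\<lambda>k. adj Dom (x k)))"
    and chi_finite: "\<And>\<beta>. \<beta> \<in> U \<Longrightarrow>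
          has_trace_class_ext (exp_gen_dom Dom x \<beta>) (\<lambda>v. exp_adj Dom x \<beta> (\<rho>\<^sub>0 (exp_gen x \<beta> v)))"
    and chi_nonzero: "\<And>\<beta>. \<beta> \<in> U \<Longrightarrow> can_chi Dom x \<rho>\<^sub>0 \<beta> \<noteq> 0"
    and chi_differentiable: "\<And>\<beta>. \<beta> \<in> U \<Longrightarrow> can_chi Dom x \<rho>\<^sub>0 differentiable (at \<beta>)"
    and Core_Dom: "Core \<subseteq> Dom" and Core_dense: "closure Core = UNIV"
    and Core_exp: "\<And>\<beta> v. \<beta> \<in> U \<Longrightarrow> v \<in> Core \<Longrightarrow> v \<in> exp_gen_dom Dom x \<beta>"
    and Core_lie: "\<And>\<beta> k v. \<beta> \<in> U \<Longrightarrow> v \<in> Core \<Longrightarrow>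
          lie_series (lincomb (vcnj \<beta>) x) (x k) v \<in> exp_gen_dom Dom x \<beta>"
    and lie_derivative: "\<And>\<beta> k v. \<beta> \<in> U \<Longrightarrow> v \<in> Core \<Longrightarrow>
          ((\<lambda>t::complex. op_exp (lincomb (vcnj \<beta> + axis k t) x) v) has_derivative
           (\<lambda>t. t *\<^sub>C exp_gen x \<beta> (lie_series (lincomb (vcnj \<beta>) x) (x k) v))) (at 0)"
    and \<rho>_Dom: "\<And>\<beta> v. \<beta> \<in> U \<Longrightarrow> can_rho Dom x \<rho>\<^sub>0 \<beta> v \<in> Dom"
    and second_moments: "\<And>\<beta> i k. \<beta> \<in> U \<Longrightarrow> has_trace_class_ext Dom
          (\<lambda>v. adj Dom (centered x (can_rho Dom x \<rho>\<^sub>0 \<beta>) k)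
            (can_rho Dom x \<rho>\<^sub>0 \<beta> (centered x (can_rho Dom x \<rho>\<^sub>0 \<beta>) i v)))"
    and d\<rho>_trace_class: "\<And>\<beta> k. \<beta> \<in> U \<Longrightarrow> trace_class (d\<rho> k \<beta>)"
    and \<rho>_differentiable: "\<And>\<beta> Y. \<beta> \<in> U \<Longrightarrow> bounded_clinear Y \<Longrightarrow>
          (\<lambda>b. tr (Y \<circ> can_rho Dom x \<rho>\<^sub>0 b)) differentiable (at \<beta>)"
    and wirtinger_\<rho>: "\<And>\<beta> k Y. \<beta> \<in> U \<Longrightarrow> bounded_clinear Y \<Longrightarrow>
          wirtinger k (\<lambda>b. tr (Y \<circ> can_rho Dom x \<rho>\<^sub>0 b)) \<beta> = tr (Y \<circ> d\<rho> k \<beta>)"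
begin

abbreviation "\<rho> \<equiv> can_rho Dom x \<rho>\<^sub>0"
abbreviation "chi \<equiv> can_chi Dom x \<rho>\<^sub>0"

text \<open>The unnormalised state \<chi> \<rho>, whose trace is \<chi>.\<close>

abbreviation T :: "complex^'n \<Rightarrow> 'h \<Rightarrow> 'h" where
  "T \<beta> \<equiv> bounded_ext (exp_gen_dom Dom x \<beta>) (\<lambda>v. exp_adj Dom x \<beta> (\<rho>\<^sub>0 (exp_gen x \<beta> v)))"

lemma \<rho>_eq: "\<rho> \<beta> v = inverse (chi \<beta>) *\<^sub>C T \<beta> v"
  by (simp add: can_rho_def)

lemma chi_eq: "chi \<beta> = tr (T \<beta>)"
  by (simp add: can_chi_def tr_prod_def)

lemma \<rho>\<^sub>0_positive: "positive_op \<rho>\<^sub>0"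
  using \<rho>\<^sub>0 by (simp add: density_op_def)

section \<open>The state and its derivative at a fixed parameter\<close>

context
  fixes \<beta>
  assumes \<beta>: "\<beta> \<in> U"
begin

lemma exp_gen_dom_dense: "closure (exp_gen_dom Dom x \<beta>) = UNIV"
proof -
  have "Core \<subseteq> exp_gen_dom Dom x \<beta>"
    using Core_exp[OF \<beta>] by blast
  then show ?thesis
    using closure_mono Core_dense by blast
qed

lemmas T_trace_class = trace_class_bounded_ext(1)[OF exp_gen_dom_dense chi_finite[OF \<beta>]]

text \<open>Moving the left exponential to the first argument makes positivity visible and puts the
  parameter dependence into two vectors, one on each side of \<open>\<rho>\<^sub>0\<close>.\<close>

lemma cinner_T:
  assumes "u \<in> exp_gen_dom Dom x \<beta>" "v \<in> exp_gen_dom Dom x \<beta>"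
  shows "cinner u (T \<beta> v) = cinner (exp_gen x \<beta> u) (\<rho>\<^sub>0 (exp_gen x \<beta> v))"
proof -
  have "cinner (exp_gen x \<beta> u) (\<rho>\<^sub>0 (exp_gen x \<beta> v)) = cinner u (exp_adj Dom x \<beta> (\<rho>\<^sub>0 (exp_gen x \<beta> v)))"
    by (rule cinner_op_exp[OF cinner_lincomb lincomb_Dom lincomb_adj_Dom assms(1)
          \<rho>\<^sub>0_exp_dom[OF \<beta> assms(2)]])
  then show ?thesis
    using trace_class_bounded_ext(2)[OF exp_gen_dom_dense chi_finite[OF \<beta>] assms(2)] by simp
qed

text \<open>On the core the form is that of \<open>\<rho>\<^sub>0\<close> at e^X v. Nonnegativity is
  a closed condition on a continuous form, so it extends from the dense core.\<close>

lemma T_positive: "positive_op (T \<beta>)"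
proof -
  have lin: "bounded_clinear (T \<beta>)"
    by (rule trace_class_bounded_clinear[OF T_trace_class])
  have "continuous_on UNIV (\<lambda>v. cinner v (T \<beta> v))"
    by (intro bounded_bilinear.continuous_on[OF bounded_bilinear_cinner] continuous_on_id
        bounded_clinear_continuous lin)
  then have "closed ((\<lambda>v. cinner v (T \<beta> v)) -` \<real>\<^sub>\<ge>\<^sub>0)"
    by (intro closed_vimage closed_nonneg_Reals_complex)
  moreover have "Core \<subseteq> (\<lambda>v. cinner v (T \<beta> v)) -` \<real>\<^sub>\<ge>\<^sub>0"
    using \<rho>\<^sub>0_positive by (auto simp: cinner_T Core_exp[OF \<beta>] positive_op_def)
  ultimately have "closure Core \<subseteq> (\<lambda>v. cinner v (T \<beta> v)) -` \<real>\<^sub>\<ge>\<^sub>0"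
    by (rule closure_minimal[rotated])
  then show ?thesis
    using lin Core_dense by (auto simp: positive_op_def)
qed

lemma \<rho>_trace_class: "trace_class (\<rho> \<beta>)"
  using trace_class_scaleC[OF T_trace_class, of "inverse (chi \<beta>)"] by (simp flip: \<rho>_eq)

lemma tr_\<rho>: "tr (\<rho> \<beta>) = 1"
  using tr_scaleC[OF T_trace_class, of "inverse (chi \<beta>)"] chi_nonzero[OF \<beta>]
  by (simp flip: \<rho>_eq chi_eq)

lemma \<rho>_positive: "positive_op (\<rho> \<beta>)"
proof -
  have "chi \<beta> \<in> \<real>\<^sub>\<ge>\<^sub>0"
    unfolding chi_eq using T_positive by (intro tr_nonneg T_trace_class) (simp add: positive_op_def)
  then have "inverse (chi \<beta>) \<in> \<real>\<^sub>\<ge>\<^sub>0"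
    by simp
  then show ?thesis
    using T_positive trace_class_bounded_clinear[OF \<rho>_trace_class]
    by (simp add: positive_op_def \<rho>_eq cinner_scaleC_right nonneg_Reals_mult_I)
qed

text \<open>\<open>exp_gen\<close> depends on \<beta> through its conjugate, so the derivative along
  the complex line \<beta> + s e_k is antilinear in s.\<close>

lemma exp_gen_has_derivative:
  assumes "v \<in> Core"
  shows "((\<lambda>s::complex. exp_gen x (\<beta> + axis k s) v) has_derivative
    (\<lambda>s. cnj s *\<^sub>C exp_gen x \<beta> (lie_series (lincomb (vcnj \<beta>) x) (x k) v))) (at 0)"
proof -
  have eq: "vcnj (\<beta> + axis k s) = vcnj \<beta> + axis k (cnj s)" for s
    by (simp add: vcnj_def vec_eq_iff axis_def)
  have "(cnj has_derivative cnj) (at 0)"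
    by (rule bounded_linear_imp_has_derivative[OF bounded_linear_cnj])
  from has_derivative_compose[OF this, of "\<lambda>t. op_exp (lincomb (vcnj \<beta> + axis k t) x) v"
      "\<lambda>t. t *\<^sub>C exp_gen x \<beta> (lie_series (lincomb (vcnj \<beta>) x) (x k) v)"]
    lie_derivative[OF \<beta> assms, of k]
  show ?thesis
    by (simp add: eq)
qed

text \<open>\<chi> times the matrix element of \<rho> is <e^X u, \<open>\<rho>\<^sub>0\<close> e^X
  v>. Its derivative along \<beta> + s e_k is found in two ways: by the product rule from the
  derivatives of \<chi> and of the trace, and by the Lie series in both arguments. Comparing them
  gives the derivative of the state.\<close>

lemma cinner_d\<rho>_Core:
  assumes u: "u \<in> Core" and v: "v \<in> Core"
  shows "cinner u (d\<rho> k \<beta> v) = cinner (lie_series (lincomb (vcnj \<beta>) x) (x k) u) (\<rho> \<beta> v)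
    - (wirtinger k chi \<beta> / chi \<beta>) * cinner u (\<rho> \<beta> v)"
proof -
  let ?Y = "\<lambda>w. cinner u w *\<^sub>C v"
  let ?G = "\<lambda>b. tr (?Y \<circ> \<rho> b)"
  let ?Lu = "lie_series (lincomb (vcnj \<beta>) x) (x k) u" and ?Lv = "lie_series (lincomb (vcnj \<beta>) x) (x k) v"
  let ?E = "exp_gen x \<beta>"
  define DG where "DG = frechet_derivative ?G (at \<beta>)"
  define Dchi where "Dchi = frechet_derivative chi (at \<beta>)"
  have DG: "(?G has_derivative DG) (at \<beta>)"
    unfolding DG_def using \<rho>_differentiable[OF \<beta> rank_one_bounded_clinear] by (rule frechet_derivative_works[THEN iffD1])
  have Dchi: "(chi has_derivative Dchi) (at \<beta>)"
    unfolding Dchi_def using chi_differentiable[OF \<beta>] by (rule frechet_derivative_works[THEN iffD1])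
  have G: "?G b = inverse (chi b) * cinner (exp_gen x b u) (\<rho>\<^sub>0 (exp_gen x b v))" if "b \<in> U" for b
    using that by (simp add: tr_rank_one_compose canonical_family.\<rho>_trace_class[OF canonical_family_axioms]
        \<rho>_eq cinner_scaleC_right canonical_family.cinner_T[OF canonical_family_axioms that] Core_exp u v)
  have "linear (\<lambda>s::complex. axis k s :: complex^'n)"
    by (rule linearI) (simp_all add: vec_eq_iff axis_def)
  then have axis: "bounded_linear (\<lambda>s::complex. axis k s :: complex^'n)"
    by (simp add: linear_conv_bounded_linear)
  have axis_0: "\<beta> + axis k 0 = \<beta>"
    by (simp add: vec_eq_iff axis_def)
  have line: "((\<lambda>s::complex. \<beta> + axis k s) has_derivative (\<lambda>s. 0 + axis k s)) (at 0)"
    by (intro has_derivative_add has_derivative_const bounded_linear_imp_has_derivative axis)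
  have "((\<lambda>b. chi b * ?G b) has_derivative (\<lambda>h. chi \<beta> * DG h + Dchi h * ?G \<beta>)) (at (\<beta> + axis k 0))"
    unfolding axis_0 by (rule has_derivative_mult[OF Dchi DG])
  from has_derivative_compose[OF line this] have "((\<lambda>s. chi (\<beta> + axis k s) * ?G (\<beta> + axis k s)) has_derivative
      (\<lambda>s. chi \<beta> * DG (axis k s) + Dchi (axis k s) * ?G \<beta>)) (at 0)"
    by simp
  then have 1: "((\<lambda>s. cinner (exp_gen x (\<beta> + axis k s) u) (\<rho>\<^sub>0 (exp_gen x (\<beta> + axis k s) v))) has_derivative
      (\<lambda>s. chi \<beta> * DG (axis k s) + Dchi (axis k s) * ?G \<beta>)) (at 0)"
  proof (rule has_derivative_transform_within_open)
    show "open ((\<lambda>s::complex. \<beta> + axis k s) -` U)"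
      by (rule open_vimage[OF U])
        (intro continuous_on_add continuous_on_const linear_continuous_on axis)
    show "0 \<in> (\<lambda>s::complex. \<beta> + axis k s) -` U"
      using \<beta> by (simp add: axis_0)
    fix s assume "s \<in> (\<lambda>s::complex. \<beta> + axis k s) -` U"
    then show "chi (\<beta> + axis k s) * ?G (\<beta> + axis k s)
        = cinner (exp_gen x (\<beta> + axis k s) u) (\<rho>\<^sub>0 (exp_gen x (\<beta> + axis k s) v))"
      using chi_nonzero[of "\<beta> + axis k s"] by (simp add: G)
  qed
  note lin = bounded_clinearD[OF positive_opD(1)[OF \<rho>\<^sub>0_positive]]
  have 2: "((\<lambda>s. cinner (exp_gen x (\<beta> + axis k s) u) (\<rho>\<^sub>0 (exp_gen x (\<beta> + axis k s) v))) has_derivative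
      (\<lambda>s. cinner (exp_gen x (\<beta> + axis k 0) u) (\<rho>\<^sub>0 (cnj s *\<^sub>C ?E ?Lv))
        + cinner (cnj s *\<^sub>C ?E ?Lu) (\<rho>\<^sub>0 (exp_gen x (\<beta> + axis k 0) v)))) (at 0)"
    by (intro bounded_bilinear.FDERIV[OF bounded_bilinear_cinner]
        bounded_linear.has_derivative[OF lin(7)] exp_gen_has_derivative u v)
  define p q where "p = cinner (?E u) (\<rho>\<^sub>0 (?E ?Lv))" and "q = cinner (?E ?Lu) (\<rho>\<^sub>0 (?E v))"
  \<comment> \<open>Varying v contributes the part antilinear in s. Varying u contributes the linear
    part, because the first argument of the inner product conjugates once more.\<close>
  have H: "chi \<beta> * DG (axis k s) + Dchi (axis k s) * ?G \<beta> = cnj s * p + s * q" for s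
    using has_derivative_unique[OF 1 2, THEN fun_cong, of s]
    by (simp add: p_def q_def cinner_simps lin axis_0)
  have "chi \<beta> * wirtinger k ?G \<beta> + wirtinger k chi \<beta> * ?G \<beta>
      = ((chi \<beta> * DG (axis k 1) + Dchi (axis k 1) * ?G \<beta>)
        - \<i> * (chi \<beta> * DG (axis k \<i>) + Dchi (axis k \<i>) * ?G \<beta>)) / 2"
    unfolding wirtinger_def DG_def[symmetric] Dchi_def[symmetric] by (simp add: field_simps)
  \<comment> \<open>The Wirtinger combination of s = 1 and s = i annihilates cnj s and keeps the
    coefficient of s.\<close>
  also have "\<dots> = q"
    unfolding H by (simp add: algebra_simps)
  also have "q = cinner ?Lu (T \<beta> v)"
    unfolding q_def by (rule cinner_T[OF Core_lie[OF \<beta> u] Core_exp[OF \<beta> v], symmetric])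
  finally have "wirtinger k ?G \<beta> = inverse (chi \<beta>) * cinner ?Lu (T \<beta> v) - (wirtinger k chi \<beta> / chi \<beta>) * ?G \<beta>"
    using chi_nonzero[OF \<beta>] by (simp add: field_simps)
  moreover have "wirtinger k ?G \<beta> = cinner u (d\<rho> k \<beta> v)"
    by (simp only: wirtinger_\<rho>[OF \<beta> rank_one_bounded_clinear] tr_rank_one_compose[OF d\<rho>_trace_class[OF \<beta>]])
  moreover have "?G \<beta> = cinner u (\<rho> \<beta> v)"
    by (rule tr_rank_one_compose[OF \<rho>_trace_class])
  ultimately show ?thesis
    by (simp add: \<rho>_eq cinner_scaleC_right)
qed

lemma d\<rho>_eq:
  "d\<rho> k \<beta> v = (\<Sum>l\<in>UNIV. cnj (K_series C (vcnj \<beta>) $ k $ l) *\<^sub>C adj Dom (x l) (\<rho> \<beta> v))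
    - (wirtinger k chi \<beta> / chi \<beta>) *\<^sub>C \<rho> \<beta> v"
proof (rule cinner_right_extensionality[OF Core_dense])
  fix u assume u: "u \<in> Core"
  then have uD: "u \<in> Dom"
    using Core_Dom by blast
  let ?p = "lie_series (lincomb (vcnj \<beta>) x) (x k) u" and ?c = "wirtinger k chi \<beta> / chi \<beta>"
  \<comment> \<open>The identity is extended in v while u stays in the core, where the Lie series is
    controlled; the generators are then moved over to \<rho> v, which lies in
    \<open>Dom\<close>.\<close>
  let ?Z = "{v. cinner u (d\<rho> k \<beta> v) = cinner ?p (\<rho> \<beta> v) - ?c * cinner u (\<rho> \<beta> v)}"
  note cont = linear_continuous_on[OF bounded_linear_compose[OF bounded_linear_cinner_right bounded_clinearD(7)]]
  have "closed ?Z"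
    by (intro closed_Collect_eq continuous_intros cont trace_class_bounded_clinear
        d\<rho>_trace_class \<beta> \<rho>_trace_class)
  then have "closure Core \<subseteq> ?Z"
    using cinner_d\<rho>_Core[OF u] by (intro closure_minimal) auto
  then have "cinner u (d\<rho> k \<beta> v) = cinner ?p (\<rho> \<beta> v) - ?c * cinner u (\<rho> \<beta> v)"
    using Core_dense by blast
  also have "cinner ?p (\<rho> \<beta> v)
      = cinner u (\<Sum>l\<in>UNIV. cnj (K_series C (vcnj \<beta>) $ k $ l) *\<^sub>C adj Dom (x l) (\<rho> \<beta> v))"
    by (simp add: lie_series_eq[OF uD] cinner_simps cinner_x[OF uD \<rho>_Dom[OF \<beta>]])
  finally show "cinner u (d\<rho> k \<beta> v)
      = cinner u ((\<Sum>l\<in>UNIV. cnj (K_series C (vcnj \<beta>) $ k $ l) *\<^sub>C adj Dom (x l) (\<rho> \<beta> v)) - ?c *\<^sub>C \<rho> \<beta> v)"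
    by (simp add: cinner_simps)
qed

text \<open>Differentiates Tr \<rho> = 1, with the identity as the bounded operator.\<close>

lemma tr_d\<rho>: "tr (d\<rho> k \<beta>) = 0"
proof -
  have "tr (d\<rho> k \<beta>) = wirtinger k (\<lambda>b. tr (\<rho> b)) \<beta>"
    by (rule wirtinger_\<rho>[OF \<beta> bounded_clinear_id(1), unfolded id_comp, symmetric])
  also have "\<dots> = wirtinger k (\<lambda>b. 1) \<beta>"
    by (rule wirtinger_cong[OF \<rho>_differentiable[OF \<beta> bounded_clinear_id(1), unfolded id_comp] U \<beta>])
      (simp add: canonical_family.tr_\<rho>[OF canonical_family_axioms])
  finally show ?thesis
    by (simp add: wirtinger_const)
qed

section \<open>Centered generators and their covariance\<close>

abbreviation "y \<equiv> centered x (\<rho> \<beta>)"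

lemma adj_y:
  assumes "v \<in> Dom"
  shows "adj Dom (y k) v = adj Dom (x k) v - cnj (mean x (\<rho> \<beta>) k) *\<^sub>C v"
  by (rule adj_eqI[OF Dom_dense]) (simp add: centered_def cinner_simps cinner_x assms)

lemma cinner_y: "u \<in> Dom \<Longrightarrow> v \<in> Dom \<Longrightarrow> cinner (y k u) v = cinner u (adj Dom (y k) v)"
  by (simp add: adj_y) (simp add: centered_def cinner_simps cinner_x)

text \<open>The order of the indices comes from reading Tr \<rho> y_i y_k^* cyclically, as the trace
  of y_k^* \<rho> y_i.\<close>

abbreviation W :: "'n \<Rightarrow> 'n \<Rightarrow> 'h \<Rightarrow> 'h" where
  "W i k \<equiv> bounded_ext Dom (\<lambda>v. adj Dom (y k) (\<rho> \<beta> (y i v)))"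

lemmas W_trace_class = trace_class_bounded_ext(1)[OF Dom_dense second_moments[OF \<beta>]]

lemma gen_cov_eq: "gen_cov Dom x (\<rho> \<beta>) $ i $ k = tr (W i k)"
  by (simp add: gen_cov_def tr_prod_def)

lemma cinner_W:
  assumes "u \<in> Dom" "v \<in> Dom"
  shows "cinner u (W i k v) = cinner (y k u) (\<rho> \<beta> (y i v))"
  using trace_class_bounded_ext(2)[OF Dom_dense second_moments[OF \<beta>] assms(2)] cinner_y[OF assms(1) \<rho>_Dom[OF \<beta>]]
  by simp

lemma continuous_on_form: "bounded_clinear B \<Longrightarrow> continuous_on UNIV (\<lambda>v. cinner v (B v))"
  by (intro bounded_bilinear.continuous_on[OF bounded_bilinear_cinner] continuous_on_id
      bounded_clinear_continuous)

lemma hadj_gen_cov: "hadj (gen_cov Dom x (\<rho> \<beta>)) = gen_cov Dom x (\<rho> \<beta>)"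
proof -
  have "tr (W i k) = cnj (tr (W k i))" for i k
  proof (rule tr_eq_cnj)
    fix v
    let ?Z = "{v. cinner v (W i k v) = cnj (cinner v (W k i v))}"
    have "closed ?Z"
      by (intro closed_Collect_eq continuous_intros continuous_on_form
          trace_class_bounded_clinear W_trace_class)
    moreover have "Dom \<subseteq> ?Z"
    proof
      fix v assume v: "v \<in> Dom"
      have "cinner (y k v) (\<rho> \<beta> (y i v)) = cinner (\<rho> \<beta> (y k v)) (y i v)"
        by (rule positive_op_selfadjoint[OF \<rho>_positive])
      also have "\<dots> = cnj (cinner (y i v) (\<rho> \<beta> (y k v)))"
        by (rule cinner_commute)
      finally show "v \<in> ?Z"
        by (simp add: cinner_W v)
    qed
    ultimately have "closure Dom \<subseteq> ?Z"
      by (rule closure_minimal[rotated])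
    then show "cinner v (W i k v) = cnj (cinner v (W k i v))"
      using Dom_dense by blast
  qed
  then have "cnj (tr (W k i)) = tr (W i k)" for i k
    by metis
  then show ?thesis
    by (simp add: hadj_def vec_eq_iff gen_cov_eq)
qed

text \<open>The operator used is y = sum of cnj (b_l) y_l. For b = hadj (\<open>K_series\<close>)
  \<alpha>, the operator y^* \<rho> equals the sum of \<alpha>_k d\<rho>_k up to a multiple of
  \<rho>, and the trace of y^* \<rho> y is the form of S at b.\<close>

lemma quantum_information_bound:
  fixes M :: "(complex^'m) set \<Rightarrow> 'h \<Rightarrow> 'h"
  assumes "qpm M" and b: "\<And>l. b l = (\<Sum>k\<in>UNIV. \<alpha> k * cnj (K_series C (vcnj \<beta>) $ k $ l))"
    and J: "\<And>i k. has_cmeasure_integral (\<lambda>E. tr (M E \<circ> d\<rho> k \<beta>)) (\<lambda>l. l $ i) (J i k)"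
    and sq: "\<And>i. integrable (outcome M (\<rho> \<beta>)) (\<lambda>l. (norm (l $ i))\<^sup>2)"
    and mean: "\<And>i. (LINT l|outcome M (\<rho> \<beta>). l $ i) = t i"
  shows "2 * Re (\<Sum>k\<in>UNIV. \<alpha> k * (\<Sum>i\<in>UNIV. cnj (v $ i) * J i k))
    \<le> Re (\<Sum>l\<in>UNIV. \<Sum>k\<in>UNIV. cnj (b l) * gen_cov Dom x (\<rho> \<beta>) $ l $ k * b k)
      + (LINT l|outcome M (\<rho> \<beta>). (cmod (\<Sum>i\<in>UNIV. cnj (v $ i) * (l $ i - t i)))\<^sup>2)"
proof -
  interpret quantum_measure M by standard fact
  let ?W = "\<lambda>u. \<Sum>l\<in>UNIV. \<Sum>k\<in>UNIV. (cnj (b l) * b k) *\<^sub>C W l k u"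
  \<comment> \<open>The two multiples of \<rho> to be compensated: the first stems from the
    normalisation \<chi>, the second from centering the generators.\<close>
  let ?c = "(\<Sum>k\<in>UNIV. \<alpha> k * (wirtinger k chi \<beta> / chi \<beta>)) - (\<Sum>l\<in>UNIV. b l * cnj (mean x (\<rho> \<beta>) l))"
  let ?A = "\<lambda>u. (\<Sum>k\<in>UNIV. \<alpha> k *\<^sub>C d\<rho> k \<beta> u) + ?c *\<^sub>C \<rho> \<beta> u"
  have tW: "trace_class ?W"
    by (intro trace_class_sum trace_class_scaleC W_trace_class)
  have tA: "trace_class ?A"
    by (intro trace_class_add trace_class_sum trace_class_scaleC d\<rho>_trace_class \<beta> \<rho>_trace_class)
  have A_eq: "?A u = (\<Sum>l\<in>UNIV. b l *\<^sub>C adj Dom (y l) (\<rho> \<beta> u))" for u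
  proof -
    have "(\<Sum>k\<in>UNIV. \<alpha> k *\<^sub>C d\<rho> k \<beta> u)
        = (\<Sum>k\<in>UNIV. \<Sum>l\<in>UNIV. (\<alpha> k * cnj (K_series C (vcnj \<beta>) $ k $ l)) *\<^sub>C adj Dom (x l) (\<rho> \<beta> u))
          - (\<Sum>k\<in>UNIV. \<alpha> k * (wirtinger k chi \<beta> / chi \<beta>)) *\<^sub>C \<rho> \<beta> u"
      by (simp add: d\<rho>_eq scaleC_diff_right scaleC_sum_right scaleC_sum_left scaleC_scaleC sum_subtractf)
    also have "(\<Sum>k\<in>UNIV. \<Sum>l\<in>UNIV. (\<alpha> k * cnj (K_series C (vcnj \<beta>) $ k $ l)) *\<^sub>C adj Dom (x l) (\<rho> \<beta> u))
        = (\<Sum>l\<in>UNIV. b l *\<^sub>C adj Dom (x l) (\<rho> \<beta> u))"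
      unfolding b by (subst sum.swap) (simp add: scaleC_sum_left)
    finally have "?A u = (\<Sum>l\<in>UNIV. b l *\<^sub>C adj Dom (x l) (\<rho> \<beta> u))
        - (\<Sum>l\<in>UNIV. b l * cnj (mean x (\<rho> \<beta>) l)) *\<^sub>C \<rho> \<beta> u"
      by (simp add: scaleC_diff_left)
    then show ?thesis
      by (simp add: adj_y[OF \<rho>_Dom[OF \<beta>]] scaleC_diff_right sum_subtractf scaleC_sum_left scaleC_scaleC)
  qed
  define Y where "Y u = (\<Sum>l\<in>UNIV. cnj (b l) *\<^sub>C y l u)" for u
  note \<rho>lin = bounded_clinearD[OF positive_opD(1)[OF \<rho>_positive]]
  have W_form: "cinner u (?W u) = cinner (Y u) (\<rho> \<beta> (Y u))" if "u \<in> Dom" for u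
    unfolding Y_def using that
    by (simp add: cinner_simps cinner_W \<rho>lin sum_distrib_left mult_ac)
  have A_form: "cinner u (?A u) = cinner (Y u) (\<rho> \<beta> u)" if "u \<in> Dom" for u
    unfolding Y_def A_eq using that
    by (simp add: cinner_simps cinner_y \<rho>_Dom[OF \<beta>])
  have W_Im: "Im (cinner u (?W u)) = 0" for u
  proof -
    have "closed {u. Im (cinner u (?W u)) = 0}"
      by (intro closed_Collect_eq continuous_intros continuous_on_form
          trace_class_bounded_clinear tW)
    then have "closure Dom \<subseteq> {u. Im (cinner u (?W u)) = 0}"
      using W_form positive_opD(3)[OF \<rho>_positive] by (intro closure_minimal) auto
    then show ?thesis
      using Dom_dense by blast
  qed
  have pos: "0 \<le> Re (cinner u (?W u)) - 2 * Re (cnj z * cinner u (?A u)) + (cmod z)\<^sup>2 * Re (cinner u (\<rho> \<beta> u))" for z u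
  proof -
    let ?Z = "{u. 0 \<le> Re (cinner u (?W u)) - 2 * Re (cnj z * cinner u (?A u)) + (cmod z)\<^sup>2 * Re (cinner u (\<rho> \<beta> u))}"
    have "closed ?Z"
      by (intro closed_Collect_le continuous_intros continuous_on_form
          trace_class_bounded_clinear tW tA \<rho>_trace_class)
    moreover have "u \<in> ?Z" if u: "u \<in> Dom" for u
    proof -
      have com: "cinner u (\<rho> \<beta> (Y u)) = cnj (cinner (Y u) (\<rho> \<beta> u))"
        by (metis positive_op_selfadjoint[OF \<rho>_positive] cinner_commute)
      \<comment> \<open>The expression to be bounded is the form of \<rho> at the vector Y u - cnj z
        u; it is identified on \<open>Dom\<close>, where Y is meaningful.\<close>
      have "cinner (Y u - cnj z *\<^sub>C u) (\<rho> \<beta> (Y u - cnj z *\<^sub>C u))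
          = cinner (Y u) (\<rho> \<beta> (Y u)) - (cnj z * cinner (Y u) (\<rho> \<beta> u) + cnj (cnj z * cinner (Y u) (\<rho> \<beta> u)))
            + (z * cnj z) * cinner u (\<rho> \<beta> u)"
        by (simp add: cinner_simps \<rho>lin com algebra_simps)
      also have "cnj z * cinner (Y u) (\<rho> \<beta> u) + cnj (cnj z * cinner (Y u) (\<rho> \<beta> u))
          = of_real (2 * Re (cnj z * cinner (Y u) (\<rho> \<beta> u)))"
        by (rule complex_add_cnj)
      finally have "Re (cinner (Y u - cnj z *\<^sub>C u) (\<rho> \<beta> (Y u - cnj z *\<^sub>C u)))
          = Re (cinner u (?W u)) - 2 * Re (cnj z * cinner u (?A u)) + (cmod z)\<^sup>2 * Re (cinner u (\<rho> \<beta> u))"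
        unfolding W_form[OF u] A_form[OF u] complex_norm_square[symmetric] by (simp del: of_real_power)
      then show ?thesis
        using positive_opD(2)[OF \<rho>_positive, of "Y u - cnj z *\<^sub>C u"] by simp
    qed
    ultimately have "closure Dom \<subseteq> ?Z"
      by (intro closure_minimal subsetI)
    then show ?thesis
      using Dom_dense by blast
  qed
  have "tr ?W = (\<Sum>l\<in>UNIV. \<Sum>k\<in>UNIV. cnj (b l) * gen_cov Dom x (\<rho> \<beta>) $ l $ k * b k)"
    by (simp add: tr_sum trace_class_sum trace_class_scaleC W_trace_class tr_scaleC gen_cov_eq mult_ac)
  moreover have "2 * Re (\<Sum>k\<in>UNIV. \<alpha> k * (\<Sum>i\<in>UNIV. cnj (v $ i) * J i k))
      \<le> Re (tr ?W) + (LINT l|outcome M (\<rho> \<beta>). (cmod (\<Sum>i\<in>UNIV. cnj (v $ i) * (l $ i - t i)))\<^sup>2)"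
    by (rule information_inequality[OF \<rho>_positive \<rho>_trace_class tr_\<rho> d\<rho>_trace_class[OF \<beta>] tr_d\<rho>
          tW W_Im refl pos J sq mean])
  ultimately show ?thesis
    by simp
qed

end

end

section \<open>The matrix inequality\<close>

lemma hadj_hadj: "hadj (hadj A) = A"
  by (simp add: hadj_def vec_eq_iff)

lemma hadj_mult: "hadj (A ** B) = hadj B ** hadj A"
  by (simp add: hadj_def matrix_matrix_mult_def vec_eq_iff mult.commute)

lemma hadj_mat_1: "hadj (mat 1) = mat 1"
  by (simp add: hadj_def mat_def vec_eq_iff)

lemma hadj_diff: "hadj (A - B) = hadj A - hadj B"
  by (simp add: hadj_def vec_eq_iff)

lemma matrix_inv_mult:
  fixes A :: "complex^'n^'n"
  assumes "invertible A"
  shows "A ** matrix_inv A = mat 1" "matrix_inv A ** A = mat 1"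
proof -
  have "A ** matrix_inv A = mat 1 \<and> matrix_inv A ** A = mat 1"
    using assms unfolding invertible_def matrix_inv_def by (rule someI_ex)
  then show "A ** matrix_inv A = mat 1" "matrix_inv A ** A = mat 1"
    by auto
qed

lemma hadj_matrix_inv:
  fixes A :: "complex^'n^'n"
  assumes "invertible A" "hadj A = A"
  shows "hadj (matrix_inv A) = matrix_inv A"
proof -
  have "hadj (matrix_inv A) ** A = mat 1"
    using arg_cong[OF matrix_inv_mult(1)[OF assms(1)], of hadj] by (simp add: hadj_mult hadj_mat_1 assms(2))
  then have "hadj (matrix_inv A) ** (A ** matrix_inv A) = matrix_inv A"
    by (simp add: matrix_mul_assoc)
  then show ?thesis
    by (simp add: matrix_inv_mult[OF assms(1)])
qed

definition cdot :: "complex^'n \<Rightarrow> complex^'n \<Rightarrow> complex" where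
  "cdot u v = (\<Sum>i\<in>UNIV. cnj (u $ i) * v $ i)"

lemma cnj_cdot: "cnj (cdot u v) = cdot v u"
  by (simp add: cdot_def mult.commute)

lemma cdot_hadj: "cdot u (A *v w) = cdot (hadj A *v u) w"
  unfolding cdot_def matrix_vector_mult_def hadj_def
  by (simp add: sum_distrib_left sum_distrib_right mult_ac) (rule sum.swap)

lemma quadratic_form_eq_cdot:
  "(\<Sum>i\<in>UNIV. \<Sum>j\<in>UNIV. cnj (v $ i) * A $ i $ j * v $ j) = cdot v (A *v v)"
  by (simp add: cdot_def matrix_vector_mult_def sum_distrib_left mult.assoc)

text \<open>\<open>N\<close> is the inverse of K. At the right \<alpha> the left side is twice the
  form of the lower bound, while the term with S is exactly once that form; subtracting leaves the
  comparison with R.\<close>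

lemma mat_geI:
  fixes S N :: "complex^'n^'n" and D :: "complex^'n^'m" and R :: "complex^'m^'m"
  assumes S: "hadj S = S" "invertible S" and N: "invertible N" and R: "hadj R = R"
    and le: "\<And>v \<alpha>. 2 * Re (cdot v (D *v \<alpha>))
      \<le> Re (cdot (hadj N *v \<alpha>) (S *v (hadj N *v \<alpha>))) + Re (cdot v (R *v v))"
  shows "mat_ge R (D ** hadj (matrix_inv N) ** matrix_inv S ** matrix_inv N ** hadj D)"
proof -
  let ?K = "matrix_inv N" and ?T = "matrix_inv S"
  let ?B = "D ** hadj ?K ** ?T ** ?K ** hadj D"
  have "hadj ?B = ?B"
    by (simp add: hadj_mult hadj_hadj hadj_matrix_inv[OF S(2,1)] matrix_mul_assoc)
  then have herm: "hadj (R - ?B) = R - ?B"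
    by (simp add: hadj_diff R)
  have "cdot v ((R - ?B) *v v) \<in> \<real>\<^sub>\<ge>\<^sub>0" for v
  proof -
    \<comment> \<open>For fixed v the quantity 2 Re <q,b> - <b,S b> is stationary where S b = q;
      then \<alpha> is recovered from hadj N \<alpha> = b.\<close>
    define q where "q = ?K *v (hadj D *v v)"
    define b where "b = ?T *v q"
    define \<alpha> where "\<alpha> = hadj ?K *v b"
    have NK: "hadj N ** hadj ?K = mat 1"
      by (simp add: hadj_mult[symmetric] matrix_inv_mult(2)[OF N] hadj_mat_1)
    have b: "hadj N *v \<alpha> = b"
      by (simp add: \<alpha>_def matrix_vector_mul_assoc NK)
    have Sb: "S *v b = q"
      by (simp add: b_def matrix_vector_mul_assoc matrix_inv_mult(1)[OF S(2)])
    have "cdot v (D *v \<alpha>) = cdot q b"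
      by (simp add: \<alpha>_def q_def cdot_hadj hadj_hadj)
    moreover have qb: "cdot b q = cdot q b"
      using cdot_hadj[of b S b] by (simp add: Sb S(1))
    ultimately have "Re (cdot q b) \<le> Re (cdot v (R *v v))"
      using le[of v \<alpha>] by (simp add: b Sb)
    moreover have "Im (cdot q b) = 0"
      using cnj_cdot[of q b] qb by (simp add: complex_eq_iff)
    moreover have "Im (cdot v (R *v v)) = 0"
      using cnj_cdot[of v "R *v v"] cdot_hadj[of v R v] by (simp add: R complex_eq_iff)
    moreover have "cdot v (?B *v v) = cdot q b"
      by (simp add: b_def q_def cdot_hadj hadj_hadj flip: matrix_vector_mul_assoc)
    moreover have "cdot v ((R - ?B) *v v) = cdot v (R *v v) - cdot v (?B *v v)"
      by (simp add: matrix_vector_mult_diff_rdistrib cdot_def algebra_simps sum_subtractf)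
    ultimately show ?thesis
      by (simp add: complex_nonneg_Reals_iff)
  qed
  with herm show ?thesis
    unfolding mat_ge_def quadratic_form_eq_cdot by blast
qed

theorem mainTheorem4:
  fixes Dom Core :: "'h::complex_hilbert set"
    and x :: "'n::finite \<Rightarrow> 'h \<Rightarrow> 'h"
    and C :: "'n \<Rightarrow> 'n \<Rightarrow> 'n \<Rightarrow> complex"
    and \<rho>\<^sub>0 :: "'h \<Rightarrow> 'h"
    and U :: "(complex^'n) set"
    and \<theta> :: "'m::finite \<Rightarrow> complex^'n \<Rightarrow> complex"
    and M :: "(complex^'m) set \<Rightarrow> 'h \<Rightarrow> 'h"
    and d\<rho> :: "'n \<Rightarrow> complex^'n \<Rightarrow> 'h \<Rightarrow> 'h"
  defines "\<chi>f \<equiv> can_chi Dom x \<rho>\<^sub>0"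
    and "\<rho> \<equiv> can_rho Dom x \<rho>\<^sub>0"
  defines "S \<equiv> \<lambda>\<beta>. gen_cov Dom x (\<rho> \<beta>)"
    and "D \<equiv> \<lambda>\<beta>. ((\<chi> i k. wirtinger k (\<theta> i) \<beta>) :: complex^'n^'m)"
    and "K \<equiv> \<lambda>\<beta>. K_mat C (vcnj \<beta>)"
    and "R \<equiv> \<lambda>\<beta>. result_cov M (\<rho> \<beta>) (\<lambda>i. \<theta> i \<beta>)"
  \<comment> \<open>the generators: operators with a common dense domain, invariant under them and their adjoints\<close>
  assumes "csubspace Dom" and "closure Dom = UNIV"
    and "\<And>k. clinear_on Dom (x k)"
    and "\<And>k v. v \<in> Dom \<Longrightarrow> x k v \<in> Dom"
    and "\<And>k v. v \<in> Dom \<Longrightarrow> v \<in> adj_dom Dom (x k) \<and> adj Dom (x k) v \<in> Dom"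
    and linearly_independent: "\<And>c. (\<And>v. v \<in> Dom \<Longrightarrow> lincomb c x v = 0) \<Longrightarrow> c = 0"
    and commutation: "\<And>i k v. v \<in> Dom \<Longrightarrow>
          x i (x k v) - x k (x i v) = (\<Sum>j\<in>UNIV. C i k j *\<^sub>C x j v)"
  \<comment> \<open>the canonical family on the neighborhood \<open>U\<close>\<close>
    and "density_op \<rho>\<^sub>0"
    and "open U" and "0 \<in> U"
    and K_exists: "\<And>\<beta>. \<beta> \<in> U \<Longrightarrow> invertible (K_series C (vcnj \<beta>))"
    and "\<And>\<beta> v. \<beta> \<in> U \<Longrightarrow> v \<in> exp_gen_dom Dom x \<beta> \<Longrightarrow>
          \<rho>\<^sub>0 (exp_gen x \<beta> v) \<in> exp_dom Dom (lincomb \<beta> (\<lambda>k. adj Dom (x k)))"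
    and chi_finite: "\<And>\<beta>. \<beta> \<in> U \<Longrightarrow>
          has_trace_class_ext (exp_gen_dom Dom x \<beta>) (\<lambda>v. exp_adj Dom x \<beta> (\<rho>\<^sub>0 (exp_gen x \<beta> v)))"
    and "\<And>\<beta>. \<beta> \<in> U \<Longrightarrow> \<chi>f \<beta> \<noteq> 0"
    and "\<And>\<beta>. \<beta> \<in> U \<Longrightarrow> \<chi>f differentiable (at \<beta>)"
  \<comment> \<open>on a dense core, the exponentials exist and their derivatives are given by the Lie series\<close>
    and "Core \<subseteq> Dom" and "closure Core = UNIV"
    and "\<And>\<beta> v. \<beta> \<in> U \<Longrightarrow> v \<in> Core \<Longrightarrow> v \<in> exp_gen_dom Dom x \<beta>"
    and "\<And>\<beta> k v. \<beta> \<in> U \<Longrightarrow> v \<in> Core \<Longrightarrow>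
          lie_series (lincomb (vcnj \<beta>) x) (x k) v \<in> exp_gen_dom Dom x \<beta>"
    and lie_derivative: "\<And>\<beta> k v. \<beta> \<in> U \<Longrightarrow> v \<in> Core \<Longrightarrow>
          ((\<lambda>t::complex. op_exp (lincomb (vcnj \<beta> + axis k t) x) v) has_derivative
           (\<lambda>t. t *\<^sub>C exp_gen x \<beta> (lie_series (lincomb (vcnj \<beta>) x) (x k) v))) (at 0)"
  \<comment> \<open>finite first and second moments, nondegenerate covariance\<close>
    and "\<And>\<beta> v. \<beta> \<in> U \<Longrightarrow> \<rho> \<beta> v \<in> Dom"
    and "\<And>\<beta> k. \<beta> \<in> U \<Longrightarrow> trace_class (\<lambda>v. x k (\<rho> \<beta> v))"
    and "\<And>\<beta> i k. \<beta> \<in> U \<Longrightarrow> has_trace_class_ext Dom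
          (\<lambda>v. adj Dom (centered x (\<rho> \<beta>) k) (\<rho> \<beta> (centered x (\<rho> \<beta>) i v)))"
    and S_nondegenerate: "\<And>\<beta>. \<beta> \<in> U \<Longrightarrow> invertible (S \<beta>)"
  \<comment> \<open>\<open>d\<rho> k\<close> is \<open>\<partial>\<rho>/\<partial>\<beta>\<^sup>k\<close>; differentiation and trace may be interchanged\<close>
    and "\<And>\<beta> k. \<beta> \<in> U \<Longrightarrow> trace_class (d\<rho> k \<beta>)"
    and "\<And>\<beta> Y. \<beta> \<in> U \<Longrightarrow> bounded_clinear Y \<Longrightarrow> (\<lambda>b. tr (Y \<circ> \<rho> b)) differentiable (at \<beta>)"
    and "\<And>\<beta> k Y. \<beta> \<in> U \<Longrightarrow> bounded_clinear Y \<Longrightarrow>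
          wirtinger k (\<lambda>b. tr (Y \<circ> \<rho> b)) \<beta> = tr (Y \<circ> d\<rho> k \<beta>)"
  \<comment> \<open>the estimated functions and the unbiased quantum probability measure\<close>
    and "\<And>i \<beta>. \<beta> \<in> U \<Longrightarrow> \<theta> i differentiable (at \<beta>)"
    and "qpm M"
    and "\<And>i \<beta>. \<beta> \<in> U \<Longrightarrow> integrable (outcome M (\<rho> \<beta>)) (\<lambda>l. (norm (l $ i))\<^sup>2)"
    and unbiased: "\<And>i \<beta>. \<beta> \<in> U \<Longrightarrow> (LINT l|outcome M (\<rho> \<beta>). l $ i) = \<theta> i \<beta>"
    and "\<And>i \<beta> k. \<beta> \<in> U \<Longrightarrow> has_cmeasure_integral (\<lambda>E. tr (M E \<circ> d\<rho> k \<beta>)) (\<lambda>l. l $ i)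
          (wirtinger k (\<lambda>b. LINT l|outcome M (\<rho> b). l $ i) \<beta>)"
  shows "\<forall>\<beta>\<in>U. mat_ge (R \<beta>)
    (D \<beta> ** hadj (K \<beta>) ** matrix_inv (S \<beta>) ** K \<beta> ** hadj (D \<beta>))"
proof
  fix \<beta> assume \<beta>: "\<beta> \<in> U"
  interpret canonical_family Dom x C Core \<rho>\<^sub>0 U d\<rho>
    by unfold_locales (fact assms[unfolded \<chi>f_def \<rho>_def])+
  interpret quantum_measure M
    by standard fact
  note state = \<rho>_positive[OF \<beta>, folded \<rho>_def] \<rho>_trace_class[OF \<beta>, folded \<rho>_def]
  have sq: "integrable (outcome M (\<rho> \<beta>)) (\<lambda>l. (norm (l $ i))\<^sup>2)" for i
    by (rule assms(36)[OF \<beta>])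
  \<comment> \<open>The hypothesis provides the derivative of the mean result. The mean equals
    \<theta>_i on the whole open set \<open>U\<close>, so their derivatives at \<beta> agree; this
    is where unbiasedness near \<beta>, and not just at \<beta>, matters.\<close>
  have J: "has_cmeasure_integral (\<lambda>E. tr (M E \<circ> d\<rho> k \<beta>)) (\<lambda>l. l $ i) (wirtinger k (\<theta> i) \<beta>)" for i k
  proof -
    have "wirtinger k (\<theta> i) \<beta> = wirtinger k (\<lambda>b. LINT l|outcome M (\<rho> b). l $ i) \<beta>"
      by (rule wirtinger_cong[OF assms(34)[OF \<beta>] U \<beta>]) (simp add: unbiased)
    then show ?thesis
      using assms(38)[OF \<beta>, of k i] by simp
  qed
  show "mat_ge (R \<beta>) (D \<beta> ** hadj (K \<beta>) ** matrix_inv (S \<beta>) ** K \<beta> ** hadj (D \<beta>))"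
    unfolding K_def K_mat_def
  proof (rule mat_geI)
    show "hadj (S \<beta>) = S \<beta>"
      unfolding S_def \<rho>_def by (rule hadj_gen_cov[OF \<beta>])
    show "hadj (R \<beta>) = R \<beta>"
      unfolding R_def by (rule hadj_result_cov[OF state sq])
    fix v :: "complex^'m" and \<alpha> :: "complex^'n"
    let ?b = "hadj (K_series C (vcnj \<beta>)) *v \<alpha>"
    have "2 * Re (\<Sum>k\<in>UNIV. \<alpha> $ k * (\<Sum>i\<in>UNIV. cnj (v $ i) * wirtinger k (\<theta> i) \<beta>))
        \<le> Re (\<Sum>l\<in>UNIV. \<Sum>k\<in>UNIV. cnj (?b $ l) * S \<beta> $ l $ k * ?b $ k)
          + (LINT l|outcome M (\<rho> \<beta>). (cmod (\<Sum>i\<in>UNIV. cnj (v $ i) * (l $ i - \<theta> i \<beta>)))\<^sup>2)"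
      unfolding S_def \<rho>_def
    proof (rule quantum_information_bound[OF \<beta> \<open>qpm M\<close> _ J sq[unfolded \<rho>_def]])
      show "?b $ l = (\<Sum>k\<in>UNIV. \<alpha> $ k * cnj (K_series C (vcnj \<beta>) $ k $ l))" for l
        by (simp add: matrix_vector_mult_def hadj_def mult.commute)
      show "(LINT l|outcome M (can_rho Dom x \<rho>\<^sub>0 \<beta>). l $ i) = \<theta> i \<beta>" for i
        using unbiased[OF \<beta>, of i] by (simp add: \<rho>_def)
    qed
    also have "(\<Sum>k\<in>UNIV. \<alpha> $ k * (\<Sum>i\<in>UNIV. cnj (v $ i) * wirtinger k (\<theta> i) \<beta>)) = cdot v (D \<beta> *v \<alpha>)"
      unfolding D_def cdot_def matrix_vector_mult_def
      by (simp add: sum_distrib_left mult_ac) (rule sum.swap)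
    also have "(\<Sum>l\<in>UNIV. \<Sum>k\<in>UNIV. cnj (?b $ l) * S \<beta> $ l $ k * ?b $ k) = cdot ?b (S \<beta> *v ?b)"
      by (rule quadratic_form_eq_cdot)
    also have "(LINT l|outcome M (\<rho> \<beta>). (cmod (\<Sum>i\<in>UNIV. cnj (v $ i) * (l $ i - \<theta> i \<beta>)))\<^sup>2)
        = Re (cdot v (R \<beta> *v v))"
      unfolding quadratic_form_eq_cdot[symmetric] R_def
      by (subst result_cov_quadratic_form[OF state sq]) simp
    finally show "2 * Re (cdot v (D \<beta> *v \<alpha>)) \<le> Re (cdot ?b (S \<beta> *v ?b)) + Re (cdot v (R \<beta> *v v))" .
  qed (fact S_nondegenerate[OF \<beta>] K_exists[OF \<beta>])+
qed

end
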